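(* Let $n\geq 1$ and let $T\colon M_n(\mathbb{C})\to M_n(\mathbb{C})$ be a $\tau_n$-Markov map written in the form $Tx=\sum_{i=1}^d a_i^*xa_i$, $x\in M_n(\mathbb{C})$, where $a_1,\ldots,a_d\in M_n(\mathbb{C})$ are linearly independent and $\sum_{i=1}^d a_i^*a_i=\sum_{i=1}^d a_ia_i^*=1_n$. Then the following conditions are equivalent: (1) $T\in\mathrm{conv}(\mathrm{Aut}(M_n(\mathbb{C})))$. (2) There exist an abelian von Neumann algebra $N$ equipped with a normal faithful tracial state $\tau_N$ and a unitary operator $u\in M_n(\mathbb{C})\otimes N$ such that $Tx=(\mathrm{id}_{M_n(\mathbb{C})}\otimes\tau_N)(u^*(x\otimes 1_N)u)$ for all $x\in M_n(\mathbb{C})$. (3) There exist an abelian von Neumann algebra $N$ equipped with a normal faithful tracial state $\tau_N$ and $v_1,\ldots,v_d\in N$ such that $u:=\sum_{i=1}^d a_i\otimes v_i$ is a unitary operator in $M_n(\mathbb{C})\otimes N$ and $\tau_N(v_i^*v_j)=\delta_{ij}$ for $1\leq i,j\leq d$.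
   Context: $\tau_n$ is the normalized trace on $M_n(\mathbb{C})$ and $1_n$ the identity matrix. A $\tau_n$-Markov map on $M_n(\mathbb{C})$ is a completely positive, unital linear map $T$ with $\tau_n\circ T=\tau_n$. $\mathrm{Aut}(M_n(\mathbb{C}))$ is the set of $*$-automorphisms of $M_n(\mathbb{C})$, i.e. the maps $x\mapsto uxu^*$ with $u$ a unitary $n\times n$ matrix, and $\mathrm{conv}(\mathrm{Aut}(M_n(\mathbb{C})))$ is its convex hull inside the bounded linear maps on $M_n(\mathbb{C})$. *)

theory Defs
  imports
    "HOL-Analysis.Analysis"
    "HOL-Algebra.Module"
    "HOL-Algebra.Algebraic_Closure_Type"
    "HOL-Library.Infinite_Typeclass"
begin

section \<open>Complex matrices and \<open>\<tau>\<^sub>n\<close>-Markov maps\<close>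

definition mscale :: "complex \<Rightarrow> complex^'n^'n \<Rightarrow> complex^'n^'n" where
  "mscale c A = map_matrix (\<lambda>z. c * z) A"

definition mstar :: "complex^'n^'n \<Rightarrow> complex^'n^'n" where
  "mstar A = map_matrix cnj (transpose A)"

definition normalized_trace :: "complex^'n^'n \<Rightarrow> complex" where
  "normalized_trace A = trace A / of_nat CARD('n)"

definition cvec_inner :: "complex^'n \<Rightarrow> complex^'n \<Rightarrow> complex" where
  "cvec_inner v w = (\<Sum>r\<in>UNIV. v $ r * cnj (w $ r))"

(* Y i j (i, j < k) are the n x n blocks of an element of M_k(M_n(C)), which acts on k-tuples
   of vectors of C^n. *)
definition block_positive :: "nat \<Rightarrow> (nat \<Rightarrow> nat \<Rightarrow> complex^'n^'n) \<Rightarrow> bool" where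
  "block_positive k Y \<longleftrightarrow>
     (\<forall>\<xi>. (\<Sum>i<k. \<Sum>j<k. cvec_inner (Y i j *v \<xi> j) (\<xi> i)) \<in> \<real>\<^sub>\<ge>\<^sub>0)"

definition completely_positive :: "(complex^'n^'n \<Rightarrow> complex^'n^'n) \<Rightarrow> bool" where
  "completely_positive T \<longleftrightarrow>
     (\<forall>k Y. block_positive k Y \<longrightarrow> block_positive k (\<lambda>i j. T (Y i j)))"

(* The elements of the type \<Rightarrow>\<^sub>L are real-linear, so complex homogeneity has to be
   required separately. *)
definition markov_map :: "((complex^'n^'n) \<Rightarrow>\<^sub>L (complex^'n^'n)) \<Rightarrow> bool" where
  "markov_map T \<longleftrightarrow>
     (\<forall>c x. T (mscale c x) = mscale c (T x)) \<and>
     completely_positive T \<and>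
     T (mat 1) = mat 1 \<and>
     (\<forall>x. normalized_trace (T x) = normalized_trace x)"

definition Aut_matrices :: "((complex^'n^'n) \<Rightarrow>\<^sub>L (complex^'n^'n)) set" where
  "Aut_matrices = {\<phi>.
     bij (blinfun_apply \<phi>) \<and>
     (\<forall>c x. \<phi> (mscale c x) = mscale c (\<phi> x)) \<and>
     (\<forall>x y. \<phi> (x ** y) = \<phi> x ** \<phi> y) \<and>
     (\<forall>x. \<phi> (mstar x) = mstar (\<phi> x))}"

section \<open>Complex Hilbert spaces and their bounded operators\<close>

(* The ring multiplication and unit that the record inherits from module are unused.
   The inner product is linear in its first argument. *)
record 'h hilbert = "(complex, 'h) module" +
  inprod :: "'h \<Rightarrow> 'h \<Rightarrow> complex"

definition hnorm :: "'h hilbert \<Rightarrow> 'h \<Rightarrow> real" where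
  "hnorm H \<xi> = sqrt (Re (inprod H \<xi> \<xi>))"

definition complex_hilbert_space :: "'h hilbert \<Rightarrow> bool" where
  "complex_hilbert_space H \<longleftrightarrow>
     Module.module (ring_of_type_algebra :: complex ring) H \<and>
     (\<forall>\<xi>\<in>carrier H. \<forall>\<eta>\<in>carrier H. \<forall>\<zeta>\<in>carrier H.
        inprod H (\<xi> \<oplus>\<^bsub>H\<^esub> \<eta>) \<zeta> = inprod H \<xi> \<zeta> + inprod H \<eta> \<zeta>) \<and>
     (\<forall>c. \<forall>\<xi>\<in>carrier H. \<forall>\<eta>\<in>carrier H. inprod H (c \<odot>\<^bsub>H\<^esub> \<xi>) \<eta> = c * inprod H \<xi> \<eta>) \<and>
     (\<forall>\<xi>\<in>carrier H. \<forall>\<eta>\<in>carrier H. inprod H \<eta> \<xi> = cnj (inprod H \<xi> \<eta>)) \<and>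
     (\<forall>\<xi>\<in>carrier H. inprod H \<xi> \<xi> \<in> \<real>\<^sub>\<ge>\<^sub>0) \<and>
     (\<forall>\<xi>\<in>carrier H. inprod H \<xi> \<xi> = 0 \<longrightarrow> \<xi> = \<zero>\<^bsub>H\<^esub>) \<and>
     (\<forall>s. range s \<subseteq> carrier H \<and>
          (\<forall>e>0. \<exists>M. \<forall>m\<ge>M. \<forall>n\<ge>M. hnorm H (s m \<ominus>\<^bsub>H\<^esub> s n) < e) \<longrightarrow>
          (\<exists>\<xi>\<in>carrier H. (\<lambda>n. hnorm H (s n \<ominus>\<^bsub>H\<^esub> \<xi>)) \<longlonglongrightarrow> 0))"

(* Operators are extensional (undefined off the carrier), so that equality of functions is
   equality of operators. *)
definition bounded_operators :: "'h hilbert \<Rightarrow> ('h \<Rightarrow> 'h) set" where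
  "bounded_operators H = {x \<in> carrier H \<rightarrow>\<^sub>E carrier H.
     (\<forall>\<xi>\<in>carrier H. \<forall>\<eta>\<in>carrier H. x (\<xi> \<oplus>\<^bsub>H\<^esub> \<eta>) = x \<xi> \<oplus>\<^bsub>H\<^esub> x \<eta>) \<and>
     (\<forall>c. \<forall>\<xi>\<in>carrier H. x (c \<odot>\<^bsub>H\<^esub> \<xi>) = c \<odot>\<^bsub>H\<^esub> x \<xi>) \<and>
     (\<exists>K. \<forall>\<xi>\<in>carrier H. hnorm H (x \<xi>) \<le> K * hnorm H \<xi>)}"

definition B :: "'h hilbert \<Rightarrow> (complex, 'h \<Rightarrow> 'h) module" where
  "B H = \<lparr>
     carrier = bounded_operators H,
     monoid.mult = (\<lambda>x y. compose (carrier H) x y),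
     one = (\<lambda>\<xi>\<in>carrier H. \<xi>),
     zero = (\<lambda>\<xi>\<in>carrier H. \<zero>\<^bsub>H\<^esub>),
     add = (\<lambda>x y. \<lambda>\<xi>\<in>carrier H. x \<xi> \<oplus>\<^bsub>H\<^esub> y \<xi>),
     smult = (\<lambda>c x. \<lambda>\<xi>\<in>carrier H. c \<odot>\<^bsub>H\<^esub> x \<xi>)\<rparr>"

definition is_adjoint :: "'h hilbert \<Rightarrow> ('h \<Rightarrow> 'h) \<Rightarrow> ('h \<Rightarrow> 'h) \<Rightarrow> bool" where
  "is_adjoint H x y \<longleftrightarrow> y \<in> carrier (B H) \<and>
     (\<forall>\<xi>\<in>carrier H. \<forall>\<eta>\<in>carrier H. inprod H (x \<xi>) \<eta> = inprod H \<xi> (y \<eta>))"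

definition op_star :: "'h hilbert \<Rightarrow> ('h \<Rightarrow> 'h) \<Rightarrow> ('h \<Rightarrow> 'h)" where
  "op_star H x = (THE y. is_adjoint H x y)"

definition op_le :: "'h hilbert \<Rightarrow> ('h \<Rightarrow> 'h) \<Rightarrow> ('h \<Rightarrow> 'h) \<Rightarrow> bool" where
  "op_le H x y \<longleftrightarrow> (\<forall>\<xi>\<in>carrier H. inprod H (y \<xi>) \<xi> - inprod H (x \<xi>) \<xi> \<in> \<real>\<^sub>\<ge>\<^sub>0)"

section \<open>Von Neumann algebras\<close>

definition commutant :: "'h hilbert \<Rightarrow> ('h \<Rightarrow> 'h) set \<Rightarrow> ('h \<Rightarrow> 'h) set" where
  "commutant H S = {x \<in> carrier (B H). \<forall>y\<in>S. x \<otimes>\<^bsub>B H\<^esub> y = y \<otimes>\<^bsub>B H\<^esub> x}"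

definition von_neumann_algebra :: "'h hilbert \<Rightarrow> ('h \<Rightarrow> 'h) set \<Rightarrow> bool" where
  "von_neumann_algebra H N \<longleftrightarrow>
     complex_hilbert_space H \<and>
     N \<subseteq> carrier (B H) \<and>
     (\<forall>x\<in>N. \<exists>y\<in>N. is_adjoint H x y) \<and>
     commutant H (commutant H N) = N"

definition abelian_von_neumann_algebra :: "'h hilbert \<Rightarrow> ('h \<Rightarrow> 'h) set \<Rightarrow> bool" where
  "abelian_von_neumann_algebra H N \<longleftrightarrow>
     von_neumann_algebra H N \<and> (\<forall>x\<in>N. \<forall>y\<in>N. x \<otimes>\<^bsub>B H\<^esub> y = y \<otimes>\<^bsub>B H\<^esub> x)"

definition state_on :: "'h hilbert \<Rightarrow> ('h \<Rightarrow> 'h) set \<Rightarrow> (('h \<Rightarrow> 'h) \<Rightarrow> complex) \<Rightarrow> bool" where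
  "state_on H N \<tau> \<longleftrightarrow>
     (\<forall>x\<in>N. \<forall>y\<in>N. \<tau> (x \<oplus>\<^bsub>B H\<^esub> y) = \<tau> x + \<tau> y) \<and>
     (\<forall>c. \<forall>x\<in>N. \<tau> (c \<odot>\<^bsub>B H\<^esub> x) = c * \<tau> x) \<and>
     (\<forall>x\<in>N. op_le H \<zero>\<^bsub>B H\<^esub> x \<longrightarrow> \<tau> x \<in> \<real>\<^sub>\<ge>\<^sub>0) \<and>
     \<tau> \<one>\<^bsub>B H\<^esub> = 1"

(* \<tau> preserves suprema of bounded increasing nets of positive elements; D is the range of
   such a net. *)
definition normal_on :: "'h hilbert \<Rightarrow> ('h \<Rightarrow> 'h) set \<Rightarrow> (('h \<Rightarrow> 'h) \<Rightarrow> complex) \<Rightarrow> bool" where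
  "normal_on H N \<tau> \<longleftrightarrow>
     (\<forall>D x. D \<subseteq> N \<and> D \<noteq> {} \<and>
        (\<forall>y\<in>D. op_le H \<zero>\<^bsub>B H\<^esub> y) \<and>
        (\<forall>y\<in>D. \<forall>z\<in>D. \<exists>w\<in>D. op_le H y w \<and> op_le H z w) \<and>
        x \<in> N \<and> (\<forall>y\<in>D. op_le H y x) \<and>
        (\<forall>z\<in>N. (\<forall>y\<in>D. op_le H y z) \<longrightarrow> op_le H x z) \<longrightarrow>
        Re (\<tau> x) = (SUP y\<in>D. Re (\<tau> y)))"

definition normal_faithful_tracial_state ::
    "'h hilbert \<Rightarrow> ('h \<Rightarrow> 'h) set \<Rightarrow> (('h \<Rightarrow> 'h) \<Rightarrow> complex) \<Rightarrow> bool" where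
  "normal_faithful_tracial_state H N \<tau> \<longleftrightarrow>
     state_on H N \<tau> \<and>
     normal_on H N \<tau> \<and>
     (\<forall>x\<in>N. \<tau> (op_star H x \<otimes>\<^bsub>B H\<^esub> x) = 0 \<longrightarrow> x = \<zero>\<^bsub>B H\<^esub>) \<and>
     (\<forall>x\<in>N. \<forall>y\<in>N. \<tau> (x \<otimes>\<^bsub>B H\<^esub> y) = \<tau> (y \<otimes>\<^bsub>B H\<^esub> x))"

section \<open>The tensor product with a matrix algebra\<close>

(* As M_n(C) is finite-dimensional, the von Neumann tensor product of M_n(C) and N is the
   algebraic one, i.e. the n x n matrices with entries in N; an elementary tensor of a and v
   is the matrix with entries a_ij v. *)
definition matrix_tensor ::
    "'h hilbert \<Rightarrow> ('h \<Rightarrow> 'h) set \<Rightarrow> (complex, ('h \<Rightarrow> 'h)^'n^'n) module" where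
  "matrix_tensor H N = \<lparr>
     carrier = {u. \<forall>i j. u $ i $ j \<in> N},
     monoid.mult = (\<lambda>u w. \<chi> i j. \<Oplus>\<^bsub>B H\<^esub>k\<in>UNIV. u $ i $ k \<otimes>\<^bsub>B H\<^esub> w $ k $ j),
     one = (\<chi> i j. if i = j then \<one>\<^bsub>B H\<^esub> else \<zero>\<^bsub>B H\<^esub>),
     zero = (\<chi> i j. \<zero>\<^bsub>B H\<^esub>),
     add = (\<lambda>u w. \<chi> i j. u $ i $ j \<oplus>\<^bsub>B H\<^esub> w $ i $ j),
     smult = (\<lambda>c u. \<chi> i j. c \<odot>\<^bsub>B H\<^esub> u $ i $ j)\<rparr>"

definition elem_tensor ::
    "'h hilbert \<Rightarrow> complex^'n^'n \<Rightarrow> ('h \<Rightarrow> 'h) \<Rightarrow> ('h \<Rightarrow> 'h)^'n^'n" where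
  "elem_tensor H a v = (\<chi> i j. a $ i $ j \<odot>\<^bsub>B H\<^esub> v)"

definition tensor_star :: "'h hilbert \<Rightarrow> ('h \<Rightarrow> 'h)^'n^'n \<Rightarrow> ('h \<Rightarrow> 'h)^'n^'n" where
  "tensor_star H u = (\<chi> i j. op_star H (u $ j $ i))"

definition unitary_in_tensor ::
    "'h hilbert \<Rightarrow> ('h \<Rightarrow> 'h) set \<Rightarrow> ('h \<Rightarrow> 'h)^'n^'n \<Rightarrow> bool" where
  "unitary_in_tensor H N u \<longleftrightarrow>
     u \<in> carrier (matrix_tensor H N) \<and>
     tensor_star H u \<otimes>\<^bsub>matrix_tensor H N\<^esub> u = \<one>\<^bsub>matrix_tensor H N\<^esub> \<and>
     u \<otimes>\<^bsub>matrix_tensor H N\<^esub> tensor_star H u = \<one>\<^bsub>matrix_tensor H N\<^esub>"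

definition id_tensor :: "(('h \<Rightarrow> 'h) \<Rightarrow> complex) \<Rightarrow> ('h \<Rightarrow> 'h)^'n^'n \<Rightarrow> complex^'n^'n" where
  "id_tensor \<tau> u = map_matrix \<tau> u"

section \<open>The two dilation conditions\<close>

(* HOL cannot quantify existentially over types, so the Hilbert spaces range over all those
   whose underlying set is contained in the type 'i \<Rightarrow> complex, with arbitrary linear
   structure and inner product on that set. Every Hilbert space has a copy of this form for a
   suitable 'i, and 'i is universally quantified in any statement about these conditions.
   That 'i is infinite excludes only types too small to contain Hilbert spaces of arbitrary
   finite dimension. *)

definition abelian_dilation ::
    "'i::infinite itself \<Rightarrow> ((complex^'n^'n) \<Rightarrow>\<^sub>L (complex^'n^'n)) \<Rightarrow> bool" where
  "abelian_dilation TYPE('i) T \<longleftrightarrow>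
     (\<exists>(H :: ('i \<Rightarrow> complex) hilbert) N \<tau> u.
        abelian_von_neumann_algebra H N \<and>
        normal_faithful_tracial_state H N \<tau> \<and>
        unitary_in_tensor H N u \<and>
        (\<forall>x. T x = id_tensor \<tau>
           (tensor_star H u \<otimes>\<^bsub>matrix_tensor H N\<^esub> elem_tensor H x \<one>\<^bsub>B H\<^esub>
              \<otimes>\<^bsub>matrix_tensor H N\<^esub> u)))"

definition orthonormal_abelian_unitary ::
    "'i::infinite itself \<Rightarrow> nat \<Rightarrow> (nat \<Rightarrow> complex^'n^'n) \<Rightarrow> bool" where
  "orthonormal_abelian_unitary TYPE('i) d a \<longleftrightarrow>
     (\<exists>(H :: ('i \<Rightarrow> complex) hilbert) N \<tau> v.
        abelian_von_neumann_algebra H N \<and>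
        normal_faithful_tracial_state H N \<tau> \<and>
        (\<forall>i\<in>{1..d}. v i \<in> N) \<and>
        unitary_in_tensor H N (\<Oplus>\<^bsub>matrix_tensor H N\<^esub>i\<in>{1..d}. elem_tensor H (a i) (v i)) \<and>
        (\<forall>i\<in>{1..d}. \<forall>j\<in>{1..d}.
           \<tau> (op_star H (v i) \<otimes>\<^bsub>B H\<^esub> v j) = (if i = j then 1 else 0)))"

end

theory Submission
  imports Defs
begin

text \<open>The conditions are proved in the cycle (1) \<open>\<Longrightarrow>\<close> (3) \<open>\<Longrightarrow>\<close> (2) \<open>\<Longrightarrow>\<close> (1).

  (1) \<open>\<Longrightarrow>\<close> (3): every \<open>*\<close>-automorphism of the matrix algebra is inner, so \<open>T\<close> is a convex combination
  \<open>\<Sum> \<lambda>\<^sub>s g\<^sub>s\<^sup>* x g\<^sub>s\<close> with unitary \<open>g\<^sub>s\<close>. Comparing the two Kraus forms of \<open>T\<close> through functionals dual to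
  \<open>a\<^sub>1, \<dots>, a\<^sub>d\<close> shows that \<open>g\<^sub>s = \<Sum> c\<^sub>s\<^sub>i a\<^sub>i\<close> with orthonormal coefficients, and the \<open>v\<^sub>i\<close> are the diagonal
  operators with entries \<open>c\<^sub>s\<^sub>i\<close>.

  (3) \<open>\<Longrightarrow>\<close> (2): expand \<open>u\<close> bilinearly.

  (2) \<open>\<Longrightarrow>\<close> (1): instead of representing \<open>N\<close> as an \<open>L\<^sup>\<infinity>\<close> space, work with commutative \<open>*\<close>-algebras and
  functionals that are nonnegative on squares. The real and imaginary parts of the entries \<open>u\<^sub>i\<^sub>j\<close>, moved
  into \<open>[0, 1]\<close>, give elements \<open>e\<close> such that \<open>e\<close> and \<open>1 - e\<close> are sums of squares. Multiplying out
  \<open>1 = (e + (1 - e))\<^sup>D\<close> over all these elements splits the state into positive functionals, each of which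
  is nearly a point mass at a scalar matrix \<open>g\<close>, with mean squared error \<open>O(1/D)\<close> as in Bernstein's proof
  of the Weierstrass theorem. Hence the second moments of \<open>u\<close>, paired with the defect \<open>0\<close>, are limits of
  convex combinations of the second moments of the \<open>g\<close>'s, paired with their defects from unitarity. The convex
  hull of a compact set in finite dimension is compact, so the limit is itself such a combination, and
  because the defects are nonnegative with average \<open>0\<close>, only unitary \<open>g\<close> occur in it.\<close>

unbundle no Formal_Power_Series.fps_syntax

section \<open>Positive functionals on commutative \<open>*\<close>-algebras\<close>

text \<open>Neither a norm nor a topology enters: the positivity arguments are purely algebraic.
  \<open>star_mult\<close> keeps the order of the factors, as commutativity permits.\<close>

locale comm_star_algebra = cring M for M :: "(complex, 'a) module" (structure) +
  fixes star :: "'a \<Rightarrow> 'a"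
  assumes smult_closed [simp, intro]: "x \<in> carrier M \<Longrightarrow> c \<odot> x \<in> carrier M"
    and smult_l_distr: "x \<in> carrier M \<Longrightarrow> (b + c) \<odot> x = b \<odot> x \<oplus> c \<odot> x"
    and smult_r_distr: "x \<in> carrier M \<Longrightarrow> y \<in> carrier M \<Longrightarrow> c \<odot> (x \<oplus> y) = c \<odot> x \<oplus> c \<odot> y"
    and smult_assoc1: "x \<in> carrier M \<Longrightarrow> (b * c) \<odot> x = b \<odot> (c \<odot> x)"
    and smult_one [simp]: "x \<in> carrier M \<Longrightarrow> 1 \<odot> x = x"
    and smult_assoc2: "x \<in> carrier M \<Longrightarrow> y \<in> carrier M \<Longrightarrow> (c \<odot> x) \<otimes> y = c \<odot> (x \<otimes> y)"
    and star_closed [simp, intro]: "x \<in> carrier M \<Longrightarrow> star x \<in> carrier M"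
    and star_add: "x \<in> carrier M \<Longrightarrow> y \<in> carrier M \<Longrightarrow> star (x \<oplus> y) = star x \<oplus> star y"
    and star_smult: "x \<in> carrier M \<Longrightarrow> star (c \<odot> x) = cnj c \<odot> star x"
    and star_mult: "x \<in> carrier M \<Longrightarrow> y \<in> carrier M \<Longrightarrow> star (x \<otimes> y) = star x \<otimes> star y"
    and star_star [simp]: "x \<in> carrier M \<Longrightarrow> star (star x) = x"
    and star_one [simp]: "star \<one> = \<one>"
begin

lemma smult_assoc3: "x \<in> carrier M \<Longrightarrow> y \<in> carrier M \<Longrightarrow> x \<otimes> (c \<odot> y) = c \<odot> (x \<otimes> y)"
  by (metis m_comm smult_assoc2 smult_closed)

lemma smult_0 [simp]: "x \<in> carrier M \<Longrightarrow> 0 \<odot> x = \<zero>"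
  using smult_l_distr[of x 0 0] by (simp add: add.l_cancel_one')

lemma minus_eq_smult: "x \<in> carrier M \<Longrightarrow> \<ominus> x = (-1) \<odot> x"
  using smult_l_distr[of x 1 "-1"] by (metis add.inv_equality a_comm smult_0 smult_closed smult_one add.right_inverse)

section \<open>Positive functionals and positive multipliers\<close>

text \<open>Positivity is asked for on squares \<open>star q \<otimes> q\<close>, so that no order
  on the algebra has to be supplied. States of an abelian von Neumann algebra are instances
  (\<open>state_posfun\<close>).\<close>

definition posfun :: "('a \<Rightarrow> complex) \<Rightarrow> bool" where
  "posfun \<phi> \<longleftrightarrow> (\<forall>x\<in>carrier M. \<forall>y\<in>carrier M. \<phi> (x \<oplus> y) = \<phi> x + \<phi> y) \<and>
     (\<forall>c. \<forall>x\<in>carrier M. \<phi> (c \<odot> x) = c * \<phi> x) \<and>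
     (\<forall>q\<in>carrier M. \<phi> (star q \<otimes> q) \<in> \<real>\<^sub>\<ge>\<^sub>0)"

lemma posfun_add: "posfun \<phi> \<Longrightarrow> x \<in> carrier M \<Longrightarrow> y \<in> carrier M \<Longrightarrow> \<phi> (x \<oplus> y) = \<phi> x + \<phi> y"
  and posfun_smult: "posfun \<phi> \<Longrightarrow> x \<in> carrier M \<Longrightarrow> \<phi> (c \<odot> x) = c * \<phi> x"
  and posfun_square: "posfun \<phi> \<Longrightarrow> x \<in> carrier M \<Longrightarrow> \<phi> (star x \<otimes> x) \<in> \<real>\<^sub>\<ge>\<^sub>0"
  by (auto simp: posfun_def)

lemma posfun_minus: "posfun \<phi> \<Longrightarrow> x \<in> carrier M \<Longrightarrow> y \<in> carrier M \<Longrightarrow> \<phi> (x \<ominus> y) = \<phi> x - \<phi> y"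
  by (simp add: minus_eq minus_eq_smult posfun_add posfun_smult)

lemma posfun_zero: "posfun \<phi> \<Longrightarrow> \<phi> \<zero> = 0"
  using posfun_smult[of \<phi> \<zero> 0] by simp

lemma posfun_finsum:
  assumes "posfun \<phi>" "finite A" "f \<in> A \<rightarrow> carrier M"
  shows "\<phi> (finsum M f A) = (\<Sum>k\<in>A. \<phi> (f k))"
  using assms(2,3) by (induction A) (auto simp: posfun_zero posfun_add assms(1) finsum_closed)

text \<open>The substitute for a positive element: multiplication by it keeps every positive
  functional positive. Phrased through functionals, the notion is closed under products without
  taking square roots. Having both \<open>posmult e\<close> and
  \<open>posmult (\<one> \<ominus> e)\<close> stands for 0 \<le> e \<le> 1.\<close>

definition posmult :: "'a \<Rightarrow> bool" where
  "posmult e \<longleftrightarrow> e \<in> carrier M \<and> (\<forall>\<phi>. posfun \<phi> \<longrightarrow> posfun (\<lambda>y. \<phi> (e \<otimes> y)))"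

lemma posmult_closed [simp]: "posmult e \<Longrightarrow> e \<in> carrier M"
  by (simp add: posmult_def)

lemma posmult_posfun: "posmult e \<Longrightarrow> posfun \<phi> \<Longrightarrow> posfun (\<lambda>y. \<phi> (e \<otimes> y))"
  by (simp add: posmult_def)

lemma posmultI:
  assumes "e \<in> carrier M" "\<And>\<phi> q. posfun \<phi> \<Longrightarrow> q \<in> carrier M \<Longrightarrow> \<phi> (e \<otimes> (star q \<otimes> q)) \<in> \<real>\<^sub>\<ge>\<^sub>0"
  shows "posmult e"
  using assms unfolding posmult_def posfun_def by (auto simp: r_distr smult_assoc3)

text \<open>By commutativity a product of two squares is the square of the product.\<close>

lemma posmult_square: 
  assumes "c \<in> carrier M" shows "posmult (star c \<otimes> c)"
proof (rule posmultI)
  fix \<phi> q assume \<phi>: "posfun \<phi>" and q: "q \<in> carrier M"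
  have "star c \<otimes> c \<otimes> (star q \<otimes> q) = star (c \<otimes> q) \<otimes> (c \<otimes> q)"
    using assms q by (simp add: star_mult m_ac)
  thus "\<phi> (star c \<otimes> c \<otimes> (star q \<otimes> q)) \<in> \<real>\<^sub>\<ge>\<^sub>0"
    using \<phi> assms q by (simp add: posfun_square)
qed (use assms in simp)

lemma posmult_add: "posmult a \<Longrightarrow> posmult b \<Longrightarrow> posmult (a \<oplus> b)"
proof (rule posmultI)
  fix \<phi> q assume a: "posmult a" and b: "posmult b" and \<phi>: "posfun \<phi>" and q: "q \<in> carrier M"
  from posfun_square[OF posmult_posfun[OF a \<phi>] q] posfun_square[OF posmult_posfun[OF b \<phi>] q]
  show "\<phi> ((a \<oplus> b) \<otimes> (star q \<otimes> q)) \<in> \<real>\<^sub>\<ge>\<^sub>0"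
    using a b q \<phi> by (simp add: l_distr posfun_add nonneg_Reals_add_I)
qed auto

lemma posmult_zero: "posmult \<zero>"
  by (rule posmultI) (auto simp: posfun_zero)

text \<open>The multipliers act one after the other: \<open>a\<close> turns \<phi> into another
  positive functional, to which the positivity of \<open>b\<close> is then applied.\<close>

lemma posmult_mult: "posmult a \<Longrightarrow> posmult b \<Longrightarrow> posmult (a \<otimes> b)"
proof (rule posmultI)
  fix \<phi> q assume a: "posmult a" and b: "posmult b" and \<phi>: "posfun \<phi>" and q: "q \<in> carrier M"
  have "posfun (\<lambda>y. \<phi> (a \<otimes> (b \<otimes> y)))"
    using posmult_posfun[OF b posmult_posfun[OF a \<phi>]] .
  from posfun_square[OF this q] show "\<phi> (a \<otimes> b \<otimes> (star q \<otimes> q)) \<in> \<real>\<^sub>\<ge>\<^sub>0"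
    using a b q by (simp add: m_assoc)
qed auto

lemma posmult_smult: "posmult a \<Longrightarrow> 0 \<le> t \<Longrightarrow> posmult (complex_of_real t \<odot> a)"
proof (rule posmultI)
  fix \<phi> q assume a: "posmult a" and t: "0 \<le> t" and \<phi>: "posfun \<phi>" and q: "q \<in> carrier M"
  from posfun_square[OF posmult_posfun[OF a \<phi>] q]
  show "\<phi> (complex_of_real t \<odot> a \<otimes> (star q \<otimes> q)) \<in> \<real>\<^sub>\<ge>\<^sub>0"
    using a t q \<phi> by (simp add: smult_assoc2 posfun_smult nonneg_Reals_mult_I)
qed auto

lemma posmult_finsum: "finite A \<Longrightarrow> (\<And>k. k \<in> A \<Longrightarrow> posmult (f k)) \<Longrightarrow> posmult (finsum M f A)"
proof (induction A rule: finite_induct)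
  case (insert x F)
  have "f \<in> F \<rightarrow> carrier M" "f x \<in> carrier M" using insert.prems by auto
  with insert show ?case by (simp add: posmult_add)
qed (simp add: posmult_zero)

lemma posmult_one: "posmult \<one>"
  using posmult_square[of \<one>] by simp

lemma posmult_nonneg: "posmult a \<Longrightarrow> posfun \<phi> \<Longrightarrow> \<phi> a \<in> \<real>\<^sub>\<ge>\<^sub>0"
  using posfun_square[OF posmult_posfun, of a \<phi> \<one>] by simp

section \<open>Bernoulli splitting of a positive functional\<close>

text \<open>The deviation of a Bernoulli count: for \<open>c\<close> trials with operator-valued
  success weight \<open>e\<close>, the expected number of successes, c times \<open>e\<close>, minus
  the observed number \<open>j\<close>.\<close>

definition dev :: "nat \<Rightarrow> nat \<Rightarrow> 'a \<Rightarrow> 'a" where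
  "dev c j e = of_nat c \<odot> e \<oplus> (- of_nat j) \<odot> \<one>"

lemma dev_closed [simp]: "e \<in> carrier M \<Longrightarrow> dev c j e \<in> carrier M"
  by (simp add: dev_def)

lemma dev_Suc: "e \<in> carrier M \<Longrightarrow> dev (Suc c) j e = dev c j e \<oplus> e"
  and dev_Suc_Suc: "e \<in> carrier M \<Longrightarrow> dev (Suc c) (Suc j) e = dev c j e \<oplus> e \<ominus> \<one>"
proof -
  assume e: "e \<in> carrier M"
  show *: "dev (Suc c) j e = dev c j e \<oplus> e" for j
    using e by (simp add: dev_def smult_l_distr a_ac)
  have "dev c (Suc j) e = dev c j e \<ominus> \<one>"
    using e smult_l_distr[of \<one> "-1" "- of_nat j"]
    by (simp add: dev_def minus_eq minus_eq_smult a_ac)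
  thus "dev (Suc c) (Suc j) e = dev c j e \<oplus> e \<ominus> \<one>"
    using e unfolding * by (simp add: minus_eq a_ac)
qed

text \<open>The variance of one Bernoulli step: an \<open>e\<close>-weighted step up and a \<open>(1 - e)\<close>-weighted step
  down add \<open>e (1 - e)\<close> to the squared deviation.\<close>
lemma bernoulli_step:
  assumes "e \<in> carrier M" "y \<in> carrier M"
  shows "e \<otimes> ((y \<oplus> e \<ominus> \<one>) \<otimes> (y \<oplus> e \<ominus> \<one>)) \<oplus> (\<one> \<ominus> e) \<otimes> ((y \<oplus> e) \<otimes> (y \<oplus> e)) =
    y \<otimes> y \<oplus> e \<otimes> (\<one> \<ominus> e)"
  using assms by algebra

text \<open>Multiplies out the product over k of the powers (e k + (1 - e k))^(c k). Each list entry
  is \<phi> weighted by one term of the expansion, and \<open>K k\<close> counts how often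
  \<open>e k\<close> was chosen in it. The last conjunct is the variance of a binomial distribution.
  The induction splits off one factor at a time; a list is used because entries count with
  multiplicity.\<close>

lemma bernoulli_family:
  fixes e :: "'v::finite \<Rightarrow> 'a" and c :: "'v \<Rightarrow> nat"
  assumes \<phi>: "posfun \<phi>" and e: "\<And>k. posmult (e k)" "\<And>k. posmult (\<one> \<ominus> e k)"
  shows "\<exists>F :: (('a \<Rightarrow> complex) \<times> ('v \<Rightarrow> nat)) list.
      (\<forall>(\<psi>, K)\<in>set F. posfun \<psi> \<and> K \<le> c) \<and>
      (\<forall>y\<in>carrier M. (\<Sum>(\<psi>, K)\<leftarrow>F. \<psi> y) = \<phi> y) \<and>
      (\<forall>k. (\<Sum>(\<psi>, K)\<leftarrow>F. \<psi> (dev (c k) (K k) (e k) \<otimes> dev (c k) (K k) (e k))) =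
        of_nat (c k) * \<phi> (e k \<otimes> (\<one> \<ominus> e k)))"
proof (induction "sum c UNIV" arbitrary: c)
  case 0
  have [simp]: "e k \<in> carrier M" for k using e(1) by simp
  have "dev 0 0 (e k) = \<zero>" for k by (simp add: dev_def)
  with 0 show ?case
    by (intro exI[of _ "[(\<phi>, \<lambda>_. 0)]"]) (auto simp: \<phi> le_fun_def posfun_zero)
next
  case (Suc n)
  have [simp]: "e k \<in> carrier M" for k using e(1) by simp
  from Suc.hyps(2) obtain k where k: "c k \<noteq> 0"
    by (metis nat.distinct(1) sum.neutral)
  define c' where "c' = c(k := c k - 1)"
  have c: "c = c'(k := Suc (c' k))" using k by (auto simp: c'_def)
  have "sum c UNIV = c k + sum c (UNIV - {k})" "sum c' UNIV = c' k + sum c' (UNIV - {k})"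
    by (simp_all add: sum.remove)
  moreover have "sum c (UNIV - {k}) = sum c' (UNIV - {k})" by (rule sum.cong) (auto simp: c'_def)
  moreover have "c' k = c k - 1" by (simp add: c'_def)
  ultimately have "n = sum c' UNIV" using Suc.hyps(2) k by linarith
  from Suc.hyps(1)[OF this] obtain F :: "(('a \<Rightarrow> complex) \<times> ('v \<Rightarrow> nat)) list" where
    F: "\<forall>(\<psi>, K)\<in>set F. posfun \<psi> \<and> K \<le> c'" and
    tot: "\<forall>y\<in>carrier M. (\<Sum>(\<psi>, K)\<leftarrow>F. \<psi> y) = \<phi> y" and
    var: "\<forall>k. (\<Sum>(\<psi>, K)\<leftarrow>F. \<psi> (dev (c' k) (K k) (e k) \<otimes> dev (c' k) (K k) (e k))) =
        of_nat (c' k) * \<phi> (e k \<otimes> (\<one> \<ominus> e k))"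
    by blast
  have pos: "posfun \<psi>" and le: "K \<le> c'" if "(\<psi>, K) \<in> set F" for \<psi> K
    using F that by blast+
  \<comment> \<open>\<open>U\<close> chooses the weight \<open>e k\<close> and raises the count at
    \<open>k\<close>; \<open>D\<close> chooses \<open>\<one> \<ominus> e k\<close> and leaves the
    counts alone. The two weights add up to 1, so both branches together give \<psi> back
    (\<open>merge\<close>).\<close>
  define U where "U = map (\<lambda>(\<psi>, K). (\<lambda>y. \<psi> (e k \<otimes> y), K(k := Suc (K k)))) F"
  define D where "D = map (\<lambda>(\<psi>, K). (\<lambda>y. \<psi> ((\<one> \<ominus> e k) \<otimes> y), K)) F"
  have merge: "\<psi> (e k \<otimes> y) + \<psi> ((\<one> \<ominus> e k) \<otimes> y) = \<psi> y" if "posfun \<psi>" "y \<in> carrier M" for \<psi> y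
  proof -
    have "e k \<otimes> y \<oplus> (\<one> \<ominus> e k) \<otimes> y = y"
      using that(2) \<open>e k \<in> carrier M\<close> by algebra
    thus ?thesis using that by (simp add: posfun_add[symmetric])
  qed
  have sum_UD: "(\<Sum>z\<leftarrow>U @ D. h z) =
      (\<Sum>(\<psi>, K)\<leftarrow>F. h (\<lambda>y. \<psi> (e k \<otimes> y), K(k := Suc (K k))) + h (\<lambda>y. \<psi> ((\<one> \<ominus> e k) \<otimes> y), K))"
    for h :: "('a \<Rightarrow> complex) \<times> ('v \<Rightarrow> nat) \<Rightarrow> complex"
    by (simp add: U_def D_def o_def sum_list_addf[symmetric])
      (simp add: case_prod_unfold)
  show ?case
  proof (intro exI[of _ "U @ D"] conjI allI ballI)
    fix z assume z: "z \<in> set (U @ D)"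
    then obtain \<psi> K where F: "(\<psi>, K) \<in> set F" and
      zz: "z = (\<lambda>y. \<psi> (e k \<otimes> y), K(k := Suc (K k))) \<or> z = (\<lambda>y. \<psi> ((\<one> \<ominus> e k) \<otimes> y), K)"
      unfolding U_def D_def set_append set_map by fast
    have "K(k := Suc (K k)) \<le> c" "K \<le> c" using le[OF F] by (auto simp: c le_fun_def le_SucI)
    thus "case z of (\<psi>, K) \<Rightarrow> posfun \<psi> \<and> K \<le> c"
      using zz posmult_posfun[OF e(1) pos[OF F]] posmult_posfun[OF e(2) pos[OF F]] by auto
  next
    fix y assume y: "y \<in> carrier M"
    have "(\<Sum>(\<psi>, K)\<leftarrow>U @ D. \<psi> y) = (\<Sum>(\<psi>, K)\<leftarrow>F. \<psi> (e k \<otimes> y) + \<psi> ((\<one> \<ominus> e k) \<otimes> y))"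
      by (subst sum_UD) (simp add: case_prod_unfold)
    also have "\<dots> = (\<Sum>(\<psi>, K)\<leftarrow>F. \<psi> y)"
      using merge[OF pos y] by (intro arg_cong[of _ _ sum_list] map_cong) auto
    finally show "(\<Sum>(\<psi>, K)\<leftarrow>U @ D. \<psi> y) = \<phi> y" using tot y by simp
  next
    fix j
    let ?d = "\<lambda>K. dev (c' j) (K j) (e j)"
    have "(\<Sum>(\<psi>, K)\<leftarrow>U @ D. \<psi> (dev (c j) (K j) (e j) \<otimes> dev (c j) (K j) (e j))) =
      (\<Sum>(\<psi>, K)\<leftarrow>F. \<psi> (?d K \<otimes> ?d K) + (if j = k then \<psi> (e k \<otimes> (\<one> \<ominus> e k)) else 0))"
    proof (subst sum_UD, intro arg_cong[of _ _ sum_list] map_cong refl)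
      fix z assume "z \<in> set F"
      then obtain \<psi> K where z: "z = (\<psi>, K)" "posfun \<psi>" using pos by (metis surj_pair)
      have "\<psi> (e k \<otimes> (dev (c j) ((K(k := Suc (K k))) j) (e j) \<otimes> dev (c j) ((K(k := Suc (K k))) j) (e j))) +
            \<psi> ((\<one> \<ominus> e k) \<otimes> (dev (c j) (K j) (e j) \<otimes> dev (c j) (K j) (e j))) =
            \<psi> (?d K \<otimes> ?d K) + (if j = k then \<psi> (e k \<otimes> (\<one> \<ominus> e k)) else 0)"
      \<comment> \<open>Only the count at \<open>k\<close> gains variance, by
        \<open>bernoulli_step\<close>; at every other index the two branches merge into the old
        value.\<close>
      proof (cases "j = k")
        case True
        have "\<psi> (e k \<otimes> ((?d K \<oplus> e k \<ominus> \<one>) \<otimes> (?d K \<oplus> e k \<ominus> \<one>))) + 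
              \<psi> ((\<one> \<ominus> e k) \<otimes> ((?d K \<oplus> e k) \<otimes> (?d K \<oplus> e k))) =
              \<psi> (?d K \<otimes> ?d K) + \<psi> (e k \<otimes> (\<one> \<ominus> e k))"
          using bernoulli_step[of "e k" "?d K"] z(2)
          by (simp add: posfun_add[symmetric])
        thus ?thesis unfolding True c fun_upd_same dev_Suc_Suc[OF \<open>e k \<in> carrier M\<close>]
          by (simp add: dev_Suc)
      next
        case False
        thus ?thesis using merge[OF z(2), of "?d K \<otimes> ?d K"] by (simp add: c)
      qed
      thus "(case z of (\<psi>, K) \<Rightarrow> (case (\<lambda>y. \<psi> (e k \<otimes> y), K(k := Suc (K k))) of (\<psi>, K) \<Rightarrow>
            \<psi> (dev (c j) (K j) (e j) \<otimes> dev (c j) (K j) (e j))) + 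
          (case (\<lambda>y. \<psi> ((\<one> \<ominus> e k) \<otimes> y), K) of (\<psi>, K) \<Rightarrow>
            \<psi> (dev (c j) (K j) (e j) \<otimes> dev (c j) (K j) (e j)))) =
        (case z of (\<psi>, K) \<Rightarrow> \<psi> (?d K \<otimes> ?d K) + (if j = k then \<psi> (e k \<otimes> (\<one> \<ominus> e k)) else 0))"
        using z by simp
    qed
    also have "\<dots> = (\<Sum>(\<psi>, K)\<leftarrow>F. \<psi> (?d K \<otimes> ?d K)) +
        (if j = k then (\<Sum>(\<psi>, K)\<leftarrow>F. \<psi> (e k \<otimes> (\<one> \<ominus> e k))) else 0)"
      by (simp add: case_prod_unfold sum_list_addf)
    also have "\<dots> = of_nat (c j) * \<phi> (e j \<otimes> (\<one> \<ominus> e j))"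
      using var tot by (simp add: c algebra_simps)
    finally show "(\<Sum>(\<psi>, K)\<leftarrow>U @ D. \<psi> (dev (c j) (K j) (e j) \<otimes> dev (c j) (K j) (e j))) =
      of_nat (c j) * \<phi> (e j \<otimes> (\<one> \<ominus> e j))" .
  qed
qed

end

section \<open>Moments of unitary matrices with commuting entries\<close>

context comm_star_algebra begin

text \<open>Positivity at c p + q with c of modulus \<open>t\<close> and optimal phase. The
  arithmetic-mean form makes the bound additive in \<phi>, so that it can be summed over a family of
  functionals without Hoelder-type estimates.\<close>

lemma posfun_cauchy_schwarz:
  assumes \<phi>: "posfun \<phi>" and p: "p \<in> carrier M" and q: "q \<in> carrier M" and t: "t > 0"
  shows "norm (\<phi> (star p \<otimes> q)) \<le> (t * Re (\<phi> (star p \<otimes> p)) + Re (\<phi> (star q \<otimes> q)) / t) / 2"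
proof -
  define A where "A = \<phi> (star p \<otimes> p)"
  define B where "B = \<phi> (star q \<otimes> q)"
  define z where "z = \<phi> (star p \<otimes> q)"
  define z' where "z' = \<phi> (star q \<otimes> p)"
  have AB: "A \<in> \<real>\<^sub>\<ge>\<^sub>0" "B \<in> \<real>\<^sub>\<ge>\<^sub>0"
    using \<phi> p q by (auto simp: A_def B_def posfun_square)
  have *: "c * cnj c * A + cnj c * z + c * z' + B \<in> \<real>\<^sub>\<ge>\<^sub>0" for c
  proof -
    have "star (c \<odot> p \<oplus> q) \<otimes> (c \<odot> p \<oplus> q) =
      ((c * cnj c) \<odot> (star p \<otimes> p) \<oplus> cnj c \<odot> (star p \<otimes> q)) \<oplus> (c \<odot> (star q \<otimes> p) \<oplus> star q \<otimes> q)"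
      using p q by (simp add: star_add star_smult l_distr r_distr smult_r_distr smult_assoc2 smult_assoc3 smult_assoc1[symmetric] mult.commute a_ac)
    hence "\<phi> (star (c \<odot> p \<oplus> q) \<otimes> (c \<odot> p \<oplus> q)) = c * cnj c * A + cnj c * z + c * z' + B"
      using p q by (simp add: A_def B_def z_def z'_def posfun_add[OF \<phi>] posfun_smult[OF \<phi>])
    thus ?thesis using posfun_square[OF \<phi>, of "c \<odot> p \<oplus> q"] p q by simp
  qed
  \<comment> \<open>The values c = 1 and c = \<i> make z + z' and \<i> (z' - z) real, which
    identifies z' as the conjugate of z.\<close>
  have "Im z' = - Im z" "Re z' = Re z"
    using *[of 1] *[of \<i>] AB by (auto simp: complex_nonneg_Reals_iff)
  hence z': "z' = cnj z" by (simp add: complex_eq_iff)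
  show ?thesis
  proof (cases "z = 0")
    case True
    thus ?thesis using AB t
      by (auto simp: complex_nonneg_Reals_iff z_def[symmetric] A_def[symmetric] B_def[symmetric])
  next
    case False
    \<comment> \<open>This phase turns both cross terms into - t |z|, the smallest value possible
      for modulus \<open>t\<close>.\<close>
    define c where "c = - (complex_of_real (t / norm z) * z)"
    have zz: "z * cnj z = complex_of_real ((norm z)\<^sup>2)" by (rule complex_norm_square[symmetric])
    have 1: "cnj c * z = - complex_of_real (t * norm z)" "c * cnj z = - complex_of_real (t * norm z)"
      using False zz by (simp_all add: c_def mult.assoc mult.commute[of "cnj z"] power2_eq_square)
    have "c * cnj c = complex_of_real ((norm c)\<^sup>2)" by (rule complex_norm_square[symmetric])
    moreover have "norm c = t" using False t by (simp add: c_def norm_mult norm_divide)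
    ultimately have 2: "c * cnj c = complex_of_real (t\<^sup>2)" by simp
    have "0 \<le> t\<^sup>2 * Re A - 2 * t * norm z + Re B"
      using *[of c] unfolding z' 1 2 by (auto simp: complex_nonneg_Reals_iff)
    hence "2 * norm z * t \<le> (t * Re A + Re B / t) * t"
      using t by (simp add: power2_eq_square algebra_simps)
    hence "2 * norm z \<le> t * Re A + Re B / t" using t by (simp only: mult_le_cancel_right_pos)
    thus ?thesis by (simp add: z_def A_def B_def)
  qed
qed

text \<open>Elements of the span of 1, \<open>u\<close> and \<open>star u\<close> are handled
  through their coefficients, which reduces identities between them to complex arithmetic.\<close>

definition lin :: "'a \<Rightarrow> complex \<Rightarrow> complex \<Rightarrow> complex \<Rightarrow> 'a" where
  "lin u a b c = a \<odot> \<one> \<oplus> b \<odot> u \<oplus> c \<odot> star u"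

lemma lin_closed [simp]: "u \<in> carrier M \<Longrightarrow> lin u a b c \<in> carrier M"
  by (simp add: lin_def)

lemma lin_add: "u \<in> carrier M \<Longrightarrow> lin u a b c \<oplus> lin u a' b' c' = lin u (a + a') (b + b') (c + c')"
  by (simp add: lin_def smult_l_distr a_ac)

lemma lin_smult: "u \<in> carrier M \<Longrightarrow> k \<odot> lin u a b c = lin u (k * a) (k * b) (k * c)"
  by (simp add: lin_def smult_r_distr smult_assoc1)

lemma lin_star: "u \<in> carrier M \<Longrightarrow> star (lin u a b c) = lin u (cnj a) (cnj c) (cnj b)"
  by (simp add: lin_def star_add star_smult a_ac)

lemma lin_one: "u \<in> carrier M \<Longrightarrow> \<one> = lin u 1 0 0"
  and lin_self: "u \<in> carrier M \<Longrightarrow> u = lin u 0 1 0"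
  by (simp_all add: lin_def)

text \<open>For |c| = 1 this is (1 + Re (c u)) / 2, the real part of \<open>c u\<close> moved from
  [-1, 1] into [0, 1]. The choices c = 1 and c = -\<i> yield the real and the imaginary part of
  \<open>u\<close>.\<close>

definition unit_part :: "complex \<Rightarrow> 'a \<Rightarrow> 'a" where
  "unit_part c u = lin u (1/2) (c/4) (cnj c/4)"

lemma unit_part_closed [simp]: "u \<in> carrier M \<Longrightarrow> unit_part c u \<in> carrier M"
  by (simp add: unit_part_def)

lemma star_unit_part: "u \<in> carrier M \<Longrightarrow> star (unit_part c u) = unit_part c u"
  by (simp add: unit_part_def lin_star)

lemma one_minus_unit_part: "u \<in> carrier M \<Longrightarrow> \<one> \<ominus> unit_part c u = unit_part (- c) u"
proof -
  assume u: "u \<in> carrier M"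
  have "\<one> \<ominus> unit_part c u = lin u 1 0 0 \<oplus> (-1) \<odot> unit_part c u"
    using u by (simp add: minus_eq minus_eq_smult lin_one[symmetric])
  thus ?thesis using u by (simp add: unit_part_def lin_add lin_smult)
qed

text \<open>Four times the element is 2 + c u + star (c u), the sum of the square of 1 + c u and of
  1 - star u u.\<close>

lemma posmult_unit_part:
  assumes u: "u \<in> carrier M" and le: "posmult (\<one> \<ominus> star u \<otimes> u)" and c: "c * cnj c = 1"
  shows "posmult (unit_part c u)"
proof -
  have cancel: "(\<one> \<oplus> x \<oplus> y \<oplus> z) \<oplus> (\<one> \<ominus> z) = \<one> \<oplus> \<one> \<oplus> x \<oplus> y"
    if "x \<in> carrier M" "y \<in> carrier M" "z \<in> carrier M" for x y z
    using that by algebra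
  have "star (\<one> \<oplus> c \<odot> u) \<otimes> (\<one> \<oplus> c \<odot> u) \<oplus> (\<one> \<ominus> star u \<otimes> u) =
    (\<one> \<oplus> c \<odot> u \<oplus> cnj c \<odot> star u \<oplus> star u \<otimes> u) \<oplus> (\<one> \<ominus> star u \<otimes> u)"
    using u c by (simp add: star_add star_smult l_distr r_distr smult_r_distr smult_assoc2 smult_assoc3
        smult_assoc1[symmetric] mult.commute a_ac)
  also have "\<dots> = \<one> \<oplus> \<one> \<oplus> c \<odot> u \<oplus> cnj c \<odot> star u"
    using cancel[of "c \<odot> u" "cnj c \<odot> star u" "star u \<otimes> u"] u by simp
  also have "\<dots> = lin u 2 c (cnj c)"
    using u smult_l_distr[of \<one> 1 1] by (simp add: lin_def)
  finally have "posmult (lin u 2 c (cnj c))"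
    using posmult_add[OF posmult_square le] u by (metis a_closed one_closed smult_closed)
  from posmult_smult[OF this, of "1/4"] show ?thesis
    using u by (simp add: unit_part_def lin_smult)
qed

section \<open>Approximation by point masses, after Bernstein\<close>

text \<open>Undoes the map x \<mapsto> (1 + x) / 2 at the success frequencies j/D and k/D, read as
  estimates for the real and the imaginary part.\<close>

definition approx_val :: "nat \<Rightarrow> nat \<Rightarrow> nat \<Rightarrow> complex" where
  "approx_val D j k = Complex (2 * real j / real D - 1) (2 * real k / real D - 1)"

lemma dev_lin: "u \<in> carrier M \<Longrightarrow>
    dev D j (lin u a b c) = lin u (of_nat D * a - of_nat j) (of_nat D * b) (of_nat D * c)"
proof -
  assume u: "u \<in> carrier M"
  have "dev D j (lin u a b c) = of_nat D \<odot> lin u a b c \<oplus> (- of_nat j) \<odot> lin u 1 0 0"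
    using u by (simp add: dev_def lin_one[symmetric])
  thus ?thesis using u by (simp add: lin_add lin_smult)
qed

text \<open>Since u = (2 e - 1) + \<i> (2 f - 1) for the two unit parts e and f, the error at the
  point mass is a multiple of the two deviations. This is how the variance bound reaches
  \<open>u\<close>.\<close>

lemma sub_approx_val:
  assumes u: "u \<in> carrier M" and D: "D > 0"
  shows "u \<oplus> (- approx_val D j k) \<odot> \<one> =
    of_real (2 / real D) \<odot> (dev D j (unit_part 1 u) \<oplus> \<i> \<odot> dev D k (unit_part (-\<i>) u))"
proof -
  have "u \<oplus> (- approx_val D j k) \<odot> \<one> = lin u 0 1 0 \<oplus> (- approx_val D j k) \<odot> lin u 1 0 0"
    using u by (simp add: lin_one[symmetric] lin_self[symmetric])
  also have "\<dots> = lin u (- approx_val D j k) 1 0"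
    using u by (simp add: lin_smult lin_add)
  also have "\<dots> = lin u (of_real (2 / real D) * (of_nat D * (1/2) - of_nat j + \<i> * (of_nat D * (1/2) - of_nat k)))
     (of_real (2 / real D) * (of_nat D * (1/4) + \<i> * (of_nat D * (-\<i>/4))))
     (of_real (2 / real D) * (of_nat D * (1/4) + \<i> * (of_nat D * (\<i>/4))))"
    using D by (intro arg_cong3[of _ _ _ _ _ _ "lin u"])
      (auto simp: approx_val_def complex_eq_iff field_simps)
  finally show ?thesis using u by (simp add: unit_part_def dev_lin lin_smult lin_add)
qed

text \<open>The value lies in the square with sides [-1, 1]; 2 bounds |Re| + |Im|. A bound
  independent of D is what later gives compactness.\<close>

lemma norm_approx_val:
  assumes "j \<le> D" "k \<le> D" "D > 0"
  shows "norm (approx_val D j k) \<le> 2"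
proof -
  have "\<bar>2 * real j / real D - 1\<bar> \<le> 1" "\<bar>2 * real k / real D - 1\<bar> \<le> 1"
    using assms by (auto simp: abs_le_iff field_simps)
  thus ?thesis using cmod_le[of "approx_val D j k"] by (simp add: approx_val_def)
qed

text \<open>As for |a + \<i> b|^2, the cross terms \<i> a b and - \<i> b a cancel, because
  \<open>a\<close> and \<open>b\<close> commute.\<close>

lemma square_selfadjoint_pair:
  assumes "a \<in> carrier M" "b \<in> carrier M" "star a = a" "star b = b"
  shows "star (of_real r \<odot> (a \<oplus> \<i> \<odot> b)) \<otimes> (of_real r \<odot> (a \<oplus> \<i> \<odot> b)) =
    of_real (r\<^sup>2) \<odot> (a \<otimes> a \<oplus> b \<otimes> b)"
proof -
  have "(a \<oplus> (- \<i>) \<odot> b) \<otimes> (a \<oplus> \<i> \<odot> b) =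
     a \<otimes> a \<oplus> (\<i> \<odot> (a \<otimes> b) \<oplus> (- \<i>) \<odot> (a \<otimes> b)) \<oplus> b \<otimes> b"
    using assms(1,2) by (simp add: l_distr r_distr smult_r_distr smult_assoc2 smult_assoc3 smult_assoc1[symmetric]
        m_comm[of b a] a_ac)
  also have "\<i> \<odot> (a \<otimes> b) \<oplus> (- \<i>) \<odot> (a \<otimes> b) = \<zero>"
    using assms(1,2) smult_l_distr[of "a \<otimes> b" \<i> "- \<i>"] by simp
  finally have "(a \<oplus> (- \<i>) \<odot> b) \<otimes> (a \<oplus> \<i> \<odot> b) = a \<otimes> a \<oplus> b \<otimes> b"
    using assms by simp
  thus ?thesis using assms
    by (simp add: star_add star_smult smult_assoc2 smult_assoc3 smult_assoc1[symmetric] power2_eq_square)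
qed

lemma star_dev: "e \<in> carrier M \<Longrightarrow> star e = e \<Longrightarrow> star (dev D j e) = dev D j e"
  by (simp add: dev_def star_add star_smult)

text \<open>The difference 1 - e (1 - e) equals (1 - e) + e e, a sum of positive
  multipliers.\<close>

lemma posmult_variance_le:
  assumes \<phi>: "posfun \<phi>" and e: "posmult e" "posmult (\<one> \<ominus> e)"
  shows "Re (\<phi> (e \<otimes> (\<one> \<ominus> e))) \<le> Re (\<phi> \<one>)"
proof -
  have "\<one> \<ominus> e \<otimes> (\<one> \<ominus> e) = (\<one> \<ominus> e) \<oplus> e \<otimes> e"
    using posmult_closed[OF e(1)] by algebra
  hence "posmult (\<one> \<ominus> e \<otimes> (\<one> \<ominus> e))" using e by (simp add: posmult_add posmult_mult)
  from posmult_nonneg[OF this \<phi>] show ?thesis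
    using e by (simp add: posfun_minus[OF \<phi>] complex_nonneg_Reals_iff)
qed

text \<open>The Bernoulli splitting with D trials for each real and each imaginary part;
  \<open>g m\<close> collects the observed frequencies. The error 8/D is (2/D)^2 times the variances
  of the two parts, each at most D.\<close>

lemma approximate_point_masses:
  fixes u :: "'v::finite \<Rightarrow> 'a"
  assumes \<phi>: "posfun \<phi>" and one: "\<phi> \<one> = 1"
    and u: "\<And>v. u v \<in> carrier M" and le: "\<And>v. posmult (\<one> \<ominus> star (u v) \<otimes> u v)"
    and D: "D > 0"
  obtains N :: nat and \<psi> g where "\<And>m. m < N \<Longrightarrow> posfun (\<psi> m)" "\<And>m v. m < N \<Longrightarrow> norm (g m v) \<le> 2"
    "\<And>y. y \<in> carrier M \<Longrightarrow> (\<Sum>m<N. \<psi> m y) = \<phi> y"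
    "\<And>v. (\<Sum>m<N. Re (\<psi> m (star (u v \<oplus> (- g m v) \<odot> \<one>) \<otimes> (u v \<oplus> (- g m v) \<odot> \<one>)))) \<le> 8 / real D"
proof -
  \<comment> \<open>The flag \<open>True\<close> marks the real part of \<open>u v\<close>,
    \<open>False\<close> the imaginary part.\<close>
  define e :: "'v \<times> bool \<Rightarrow> 'a" where "e = (\<lambda>(v, b). unit_part (if b then 1 else - \<i>) (u v))"
  have [simp]: "e k \<in> carrier M" for k by (cases k) (simp add: e_def u)
  have e: "posmult (e k)" "posmult (\<one> \<ominus> e k)" for k
    using u le by (cases k; auto simp: e_def one_minus_unit_part intro!: posmult_unit_part)+
  obtain F :: "(('a \<Rightarrow> complex) \<times> ('v \<times> bool \<Rightarrow> nat)) list" where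
    F: "\<forall>(\<psi>, K)\<in>set F. posfun \<psi> \<and> K \<le> (\<lambda>_. D)" and
    tot: "\<forall>y\<in>carrier M. (\<Sum>(\<psi>, K)\<leftarrow>F. \<psi> y) = \<phi> y" and
    var: "\<forall>k. (\<Sum>(\<psi>, K)\<leftarrow>F. \<psi> (dev D (K k) (e k) \<otimes> dev D (K k) (e k))) =
        of_nat D * \<phi> (e k \<otimes> (\<one> \<ominus> e k))"
    using bernoulli_family[where e = e and c = "\<lambda>_. D", OF \<phi> e]
    by - (elim exE conjE; rule that; assumption)
  define \<psi> where "\<psi> m = fst (F ! m)" for m
  define K where "K m = snd (F ! m)" for m
  define g where "g m v = approx_val D (K m (v, True)) (K m (v, False))" for m v
  have sum_F: "(\<Sum>(\<psi>, K)\<leftarrow>F. h \<psi> K) = (\<Sum>m<length F. h (\<psi> m) (K m))" for h :: "_ \<Rightarrow> _ \<Rightarrow> complex"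
    by (simp add: sum_list_sum_nth \<psi>_def K_def case_prod_unfold lessThan_atLeast0)
  have FK: "posfun (\<psi> m)" "K m k \<le> D" if "m < length F" for m k
  proof -
    have "posfun (fst (F ! m)) \<and> snd (F ! m) \<le> (\<lambda>_. D)"
      using F nth_mem[OF that] by (auto simp: case_prod_unfold)
    thus "posfun (\<psi> m)" "K m k \<le> D" by (auto simp: \<psi>_def K_def dest: le_funD)
  qed
  show ?thesis
  proof (rule that[of "length F" \<psi> g])
    show "posfun (\<psi> m)" if "m < length F" for m using FK that by blast
    show "norm (g m v) \<le> 2" if "m < length F" for m v
      unfolding g_def using FK(2)[OF that] D by (intro norm_approx_val)
    show "(\<Sum>m<length F. \<psi> m y) = \<phi> y" if "y \<in> carrier M" for y
      using tot that sum_F[of "\<lambda>\<psi> K. \<psi> y"] by simp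
    show "(\<Sum>m<length F. Re (\<psi> m (star (u v \<oplus> (- g m v) \<odot> \<one>) \<otimes> (u v \<oplus> (- g m v) \<odot> \<one>)))) \<le> 8 / real D" for v
    proof -
      let ?sq = "\<lambda>m b. \<psi> m (dev D (K m (v, b)) (e (v, b)) \<otimes> dev D (K m (v, b)) (e (v, b)))"
      have sq: "(\<Sum>m<length F. ?sq m b) = of_nat D * \<phi> (e (v, b) \<otimes> (\<one> \<ominus> e (v, b)))" for b
        using spec[OF var, of "(v, b)"]
          sum_F[of "\<lambda>\<psi> K. \<psi> (dev D (K (v, b)) (e (v, b)) \<otimes> dev D (K (v, b)) (e (v, b)))"] by simp
      have "\<psi> m (star (u v \<oplus> (- g m v) \<odot> \<one>) \<otimes> (u v \<oplus> (- g m v) \<odot> \<one>)) =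
        of_real ((2 / real D)\<^sup>2) * (?sq m True + ?sq m False)" if m: "m < length F" for m
      proof -
        have "u v \<oplus> (- g m v) \<odot> \<one> = of_real (2 / real D) \<odot>
            (dev D (K m (v, True)) (e (v, True)) \<oplus> \<i> \<odot> dev D (K m (v, False)) (e (v, False)))"
          unfolding g_def e_def using sub_approx_val[OF u D] by simp
        moreover have "star (e (v, b)) = e (v, b)" for b
          by (simp add: e_def u star_unit_part)
        ultimately show ?thesis
          using FK(1)[OF m] by (simp add: square_selfadjoint_pair star_dev posfun_add posfun_smult del: of_real_divide of_real_power)
      qed
      hence "(\<Sum>m<length F. Re (\<psi> m (star (u v \<oplus> (- g m v) \<odot> \<one>) \<otimes> (u v \<oplus> (- g m v) \<odot> \<one>)))) =
        (\<Sum>m<length F. Re (of_real ((2 / real D)\<^sup>2) * (?sq m True + ?sq m False)))"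
        by (intro sum.cong) simp_all
      also have "\<dots> = Re (of_real ((2 / real D)\<^sup>2) * ((\<Sum>m<length F. ?sq m True) + (\<Sum>m<length F. ?sq m False)))"
        by (simp only: Re_sum[symmetric] sum_distrib_left[symmetric] sum.distrib)
      also have "\<dots> = (2 / real D)\<^sup>2 * (D * Re (\<phi> (e (v, True) \<otimes> (\<one> \<ominus> e (v, True)))) +
          D * Re (\<phi> (e (v, False) \<otimes> (\<one> \<ominus> e (v, False)))))"
        unfolding sq by simp
      also have "\<dots> \<le> (2 / real D)\<^sup>2 * (real D * 1 + real D * 1)"
      proof (rule mult_left_mono)
        have "real D * Re (\<phi> (e k \<otimes> (\<one> \<ominus> e k))) \<le> real D * 1" for k
          using posmult_variance_le[OF \<phi> e] one by (intro mult_left_mono) auto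
        thus "D * Re (\<phi> (e (v, True) \<otimes> (\<one> \<ominus> e (v, True)))) +
          D * Re (\<phi> (e (v, False) \<otimes> (\<one> \<ominus> e (v, False)))) \<le> real D * 1 + real D * 1"
          by (intro add_mono) auto
      qed simp
      also have "\<dots> = 8 / real D" using D by (simp add: power2_eq_square field_simps)
      finally show ?thesis .
    qed
  qed
qed

text \<open>With conjugation written cnj, star u v - cnj g h splits as star (u - g) v + cnj g (v -
  h). Cauchy-Schwarz handles the first term by star v v \<le> 1 and the second by pairing with 1;
  the bound 2 on |g| cancels the 1/2 in the second.\<close>

lemma point_mass_error:
  assumes \<psi>: "posfun \<psi>" and uv: "u \<in> carrier M" "v \<in> carrier M" "posmult (\<one> \<ominus> star v \<otimes> v)"
    and g: "norm g \<le> 2" and t: "t > 0"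
  defines "P \<equiv> \<lambda>x c. Re (\<psi> (star (x \<oplus> (- c) \<odot> \<one>) \<otimes> (x \<oplus> (- c) \<odot> \<one>)))"
  shows "norm (\<psi> (star u \<otimes> v) - \<psi> \<one> * (cnj g * h)) \<le>
    (t * P u g + Re (\<psi> \<one>) / t) / 2 + (t * P v h + Re (\<psi> \<one>) / t)"
proof -
  define p where "p = u \<oplus> (- g) \<odot> \<one>"
  define q where "q = v \<oplus> (- h) \<odot> \<one>"
  have pq [simp]: "p \<in> carrier M" "q \<in> carrier M" using uv by (auto simp: p_def q_def)
  have cancel: "x \<oplus> (- c) \<odot> \<one> \<oplus> c \<odot> \<one> = x" if "x \<in> carrier M" for x c
    using that smult_l_distr[of \<one> "- c" c] by (simp add: a_assoc)
  have u: "u = p \<oplus> g \<odot> \<one>" and v: "v = q \<oplus> h \<odot> \<one>" using uv cancel by (simp_all add: p_def q_def)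
  have "star u \<otimes> v = star p \<otimes> v \<oplus> cnj g \<odot> v"
    using uv by (simp add: u star_add star_smult l_distr smult_assoc2)
  hence "\<psi> (star u \<otimes> v) = \<psi> (star p \<otimes> v) + cnj g * \<psi> v"
    using uv by (simp add: posfun_add[OF \<psi>] posfun_smult[OF \<psi>])
  moreover have "\<psi> v = \<psi> q + h * \<psi> \<one>"
    by (subst v) (simp add: posfun_add[OF \<psi>] posfun_smult[OF \<psi>])
  ultimately have "\<psi> (star u \<otimes> v) - \<psi> \<one> * (cnj g * h) = \<psi> (star p \<otimes> v) + cnj g * \<psi> (star \<one> \<otimes> q)"
    by (simp add: algebra_simps)
  hence "norm (\<psi> (star u \<otimes> v) - \<psi> \<one> * (cnj g * h)) \<le> norm (\<psi> (star p \<otimes> v)) + norm g * norm (\<psi> (star \<one> \<otimes> q))"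
    by (metis norm_triangle_ineq norm_mult complex_mod_cnj)
  also have "\<dots> \<le> (t * P u g + Re (\<psi> \<one>) / t) / 2 + 2 * ((Re (\<psi> \<one>) / t + t * P v h) / 2)"
  proof (intro add_mono mult_mono g)
    have "Re (\<psi> (star v \<otimes> v)) \<le> Re (\<psi> \<one>)"
      using posmult_nonneg[OF uv(3) \<psi>] uv by (simp add: posfun_minus[OF \<psi>] complex_nonneg_Reals_iff)
    hence "Re (\<psi> (star v \<otimes> v)) / t \<le> Re (\<psi> \<one>) / t" using t by (simp add: divide_right_mono)
    thus "norm (\<psi> (star p \<otimes> v)) \<le> (t * P u g + Re (\<psi> \<one>) / t) / 2"
      using posfun_cauchy_schwarz[OF \<psi> pq(1) uv(2) t] by (simp add: P_def p_def)
    \<comment> \<open>Here the error is the second argument of Cauchy-Schwarz, hence the parameter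
      1/t: the squared error is again multiplied by \<open>t\<close> and the mass divided by
      it.\<close>
    show "norm (\<psi> (star \<one> \<otimes> q)) \<le> (Re (\<psi> \<one>) / t + t * P v h) / 2"
      using posfun_cauchy_schwarz[OF \<psi> one_closed pq(2), of "1 / t"] t by (simp add: P_def q_def mult.commute)
  qed auto
  also have "2 * ((Re (\<psi> \<one>) / t + t * P v h) / 2) = t * P v h + Re (\<psi> \<one>) / t" by simp
  finally show ?thesis .
qed


text \<open>The choice t = sqrt D balances the two parts of \<open>point_mass_error\<close>: squared
  errors contribute 8/t and the total mass 1/t, so the sum is 9/(2t) + 9/t = 27/(2t).\<close>

lemma unitary_point_mass_error:
  fixes u :: "'a^'n^'n"
  assumes \<phi>: "posfun \<phi>" and one: "\<phi> \<one> = 1"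
    and u: "\<And>i j. u $ i $ j \<in> carrier M" and le: "\<And>i j. posmult (\<one> \<ominus> star (u $ i $ j) \<otimes> u $ i $ j)"
    and D: "D > 0"
  obtains N :: nat and \<psi> and g :: "nat \<Rightarrow> complex^'n^'n"
  where "\<And>m. m < N \<Longrightarrow> posfun (\<psi> m)" "\<And>m i j. m < N \<Longrightarrow> norm (g m $ i $ j) \<le> 2"
    "\<And>y. y \<in> carrier M \<Longrightarrow> (\<Sum>m<N. \<psi> m y) = \<phi> y"
    "\<And>i j k l. (\<Sum>m<N. norm (\<psi> m (star (u $ i $ j) \<otimes> u $ k $ l) - \<psi> m \<one> * (cnj (g m $ i $ j) * g m $ k $ l)))
       \<le> 27 / (2 * sqrt (real D))"
proof -
  let ?u = "\<lambda>(i, j). u $ i $ j"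
  have "?u v \<in> carrier M" "posmult (\<one> \<ominus> star (?u v) \<otimes> ?u v)" for v :: "'n \<times> 'n"
    using u le by (cases v; simp)+
  thus ?thesis
  proof (rule approximate_point_masses[where u = ?u, OF \<phi> one _ _ D])
    fix N :: nat and \<psi> and g :: "nat \<Rightarrow> 'n \<times> 'n \<Rightarrow> complex"
    assume \<psi>: "\<And>m. m < N \<Longrightarrow> posfun (\<psi> m)"
    and g: "\<And>m v. m < N \<Longrightarrow> norm (g m v) \<le> 2"
    and tot: "\<And>y. y \<in> carrier M \<Longrightarrow> (\<Sum>m<N. \<psi> m y) = \<phi> y"
    and var: "\<And>v. (\<Sum>m<N. Re (\<psi> m (star (?u v \<oplus> (- g m v) \<odot> \<one>) \<otimes> (?u v \<oplus> (- g m v) \<odot> \<one>)))) \<le> 8 / real D"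
  define t where "t = sqrt (real D)"
  have t: "t > 0" "real D = t * t" using D by (auto simp: t_def)
  show ?thesis
  proof (rule that[of N \<psi> "\<lambda>m. \<chi> i j. g m (i, j)"])
    fix i j k l
    define P where "P m v = Re (\<psi> m (star (?u v \<oplus> (- g m v) \<odot> \<one>) \<otimes> (?u v \<oplus> (- g m v) \<odot> \<one>)))" for m v
    have P: "(\<Sum>m<N. t * P m v) \<le> 8 / t" for v
      using mult_left_mono[OF var[of v], of t] t by (simp add: P_def sum_distrib_left)
    have w: "(\<Sum>m<N. Re (\<psi> m \<one>) / t) = 1 / t"
      using tot[of \<one>] one by (simp add: sum_divide_distrib[symmetric] Re_sum[symmetric] del: Re_sum)
    have "(\<Sum>m<N. norm (\<psi> m (star (u $ i $ j) \<otimes> u $ k $ l) - \<psi> m \<one> * (cnj (g m (i, j)) * g m (k, l)))) \<le>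
      (\<Sum>m<N. (t * P m (i, j) + Re (\<psi> m \<one>) / t) / 2 + (t * P m (k, l) + Re (\<psi> m \<one>) / t))"
      using point_mass_error[OF \<psi> u u le g t(1)] by (intro sum_mono) (simp add: P_def)
    also have "\<dots> = ((\<Sum>m<N. t * P m (i, j)) + (\<Sum>m<N. Re (\<psi> m \<one>) / t)) / 2 +
        ((\<Sum>m<N. t * P m (k, l)) + (\<Sum>m<N. Re (\<psi> m \<one>) / t))"
      by (simp only: sum.distrib sum_divide_distrib[symmetric])
    also have "\<dots> \<le> (8 / t + 1 / t) / 2 + (8 / t + 1 / t)"
      unfolding w using P t(1) by (intro add_mono divide_right_mono) auto
    also have "\<dots> = 27 / (2 * sqrt (real D))" by (simp add: t_def[symmetric] field_simps)
    finally show "(\<Sum>m<N. norm (\<psi> m (star (u $ i $ j) \<otimes> u $ k $ l) -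
        \<psi> m \<one> * (cnj ((\<chi> i j. g m (i, j)) $ i $ j) * (\<chi> i j. g m (i, j)) $ k $ l))) \<le> 27 / (2 * sqrt (real D))"
      by simp
  qed (use \<psi> g tot in auto)
  qed
qed

end

section \<open>Second moments paired with the defect from unitarity\<close>

definition unitarity_defect :: "complex^'n^'n \<Rightarrow> real" where
  "unitarity_defect g = (\<Sum>i\<in>UNIV. \<Sum>j\<in>UNIV. norm ((\<Sum>k\<in>UNIV. cnj (g $ k $ i) * g $ k $ j) - (if i = j then 1 else 0)))"

lemma unitarity_defect_nonneg: "unitarity_defect g \<ge> 0"
  by (simp add: unitarity_defect_def sum_nonneg)

lemma mstar_nth [simp]: "mstar g $ i $ j = cnj (g $ j $ i)"
  by (simp add: mstar_def map_matrix_def transpose_def)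

lemma unitarity_defect_eq_0: "unitarity_defect g = 0 \<Longrightarrow> mstar g ** g = mat 1"
  by (simp add: unitarity_defect_def sum_nonneg_eq_0_iff sum_nonneg vec_eq_iff matrix_matrix_mult_def mat_def)

text \<open>Carrying the defect along in the same vector lets one convex combination control the
  moments and the average defect at once.\<close>

definition moment_data :: "complex^'n^'n \<Rightarrow> (complex^'n^'n^'n^'n) \<times> real" where
  "moment_data g = ((\<chi> i j k l. cnj (g $ i $ j) * g $ k $ l), unitarity_defect g)"

text \<open>The convex hull of a compact set in finite dimension is compact. Limits therefore stay
  in the hull although the number of point masses grows with D.\<close>

lemma compact_convex_hull_moment_data:
  "compact (convex hull (moment_data ` {g :: complex^'n^'n. \<forall>i j. norm (g $ i $ j) \<le> 2}))"
proof (intro compact_convex_hull compact_continuous_image)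
  show "continuous_on {g :: complex^'n^'n. \<forall>i j. norm (g $ i $ j) \<le> 2} moment_data"
    unfolding moment_data_def unitarity_defect_def by (intro continuous_intros)
  have "closed {g :: complex^'n^'n. \<forall>i j. norm (g $ i $ j) \<le> 2}"
    by (intro closed_Collect_all closed_Collect_le continuous_intros)
  moreover have "bounded {g :: complex^'n^'n. \<forall>i j. norm (g $ i $ j) \<le> 2}"
  proof (rule boundedI)
    fix g :: "complex^'n^'n" assume g: "g \<in> {g. \<forall>i j. norm (g $ i $ j) \<le> 2}"
    have "norm g \<le> (\<Sum>i\<in>UNIV. norm (g $ i))" unfolding norm_vec_def by (rule L2_set_le_sum) simp
    also have "\<dots> \<le> (\<Sum>i\<in>UNIV. \<Sum>j\<in>UNIV. norm (g $ i $ j))"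
    proof (rule sum_mono)
      show "norm (g $ i) \<le> (\<Sum>j\<in>UNIV. norm (g $ i $ j))" for i
        unfolding norm_vec_def[of "g $ i"] by (rule L2_set_le_sum) simp
    qed
    also have "\<dots> \<le> (\<Sum>i\<in>(UNIV :: 'n set). \<Sum>j\<in>(UNIV :: 'n set). 2)"
      using g by (intro sum_mono) auto
    finally show "norm g \<le> (\<Sum>i\<in>(UNIV :: 'n set). \<Sum>j\<in>(UNIV :: 'n set). 2)" .
  qed
  ultimately show "compact {g :: complex^'n^'n. \<forall>i j. norm (g $ i $ j) \<le> 2}"
    by (simp add: compact_eq_bounded_closed)
qed

section \<open>Passage to the limit in the moments\<close>

context comm_star_algebra begin

text \<open>Replaces a representation of the entries as functions on a probability space: only the
  second moments are reproduced, which is all that a conjugation by \<open>u\<close> followed by the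
  state can see.\<close>

theorem commuting_unitary_moments:
  fixes u :: "'a^'n^'n"
  assumes \<phi>: "posfun \<phi>" and one: "\<phi> \<one> = 1" and u: "\<And>i j. u $ i $ j \<in> carrier M"
    and unitary: "\<And>i j. (\<Oplus>k\<in>UNIV. star (u $ k $ i) \<otimes> u $ k $ j) = (if i = j then \<one> else \<zero>)"
  obtains S :: "(complex^'n^'n) set" and w where "finite S" "\<And>g. g \<in> S \<Longrightarrow> mstar g ** g = mat 1"
    "\<And>g. g \<in> S \<Longrightarrow> w g \<ge> 0" "sum w S = 1"
    "\<And>i j k l. \<phi> (star (u $ i $ j) \<otimes> u $ k $ l) = (\<Sum>g\<in>S. of_real (w g) * (cnj (g $ i $ j) * g $ k $ l))"
proof -
  define K where "K = moment_data ` {g :: complex^'n^'n. \<forall>i j. norm (g $ i $ j) \<le> 2}"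
  define t :: "complex^'n^'n^'n^'n" where "t = (\<chi> i j k l. \<phi> (star (u $ i $ j) \<otimes> u $ k $ l))"
  \<comment> \<open>By the (j, j) entry of the unitarity relation, 1 minus one square of column j is
    the sum of the other squares in that column.\<close>
  have le: "posmult (\<one> \<ominus> star (u $ i $ j) \<otimes> u $ i $ j)" for i j
  proof -
    let ?f = "\<lambda>k. star (u $ k $ j) \<otimes> u $ k $ j"
    have "\<one> = (\<Oplus>k\<in>insert i (UNIV - {i}). ?f k)" using unitary[of j j] by (simp add: insert_UNIV)
    also have "\<dots> = ?f i \<oplus> (\<Oplus>k\<in>UNIV - {i}. ?f k)"
      using u by (subst finsum_insert) auto
    finally have "\<one> \<ominus> ?f i = (\<Oplus>k\<in>UNIV - {i}. ?f k)"
      using u by (simp add: minus_eq a_comm[of "?f i"] a_assoc r_neg finsum_closed)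
    thus ?thesis using u by (simp add: posmult_finsum posmult_square)
  qed
  \<comment> \<open>The error of \<open>unitary_point_mass_error\<close> for \<open>Suc D\<close>
    trials, which keeps the number of trials positive.\<close>
  define \<epsilon> where "\<epsilon> D = 27 / (2 * sqrt (real (Suc D)))" for D
  have "\<exists>z\<in>convex hull K. (\<forall>i j k l. norm (t $ i $ j $ k $ l - fst z $ i $ j $ k $ l) \<le> \<epsilon> D) \<and>
       norm (snd z) \<le> (real CARD('n))^3 * \<epsilon> D" for D
  proof -
    obtain N :: nat and \<psi> and g :: "nat \<Rightarrow> complex^'n^'n"
      where \<psi>: "\<And>m. m < N \<Longrightarrow> posfun (\<psi> m)" and g: "\<And>m i j. m < N \<Longrightarrow> norm (g m $ i $ j) \<le> 2"
        and tot: "\<And>y. y \<in> carrier M \<Longrightarrow> (\<Sum>m<N. \<psi> m y) = \<phi> y"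
        and err: "\<And>i j k l. (\<Sum>m<N. norm (\<psi> m (star (u $ i $ j) \<otimes> u $ k $ l) - \<psi> m \<one> * (cnj (g m $ i $ j) * g m $ k $ l))) \<le> \<epsilon> D"
      by (rule unitary_point_mass_error[OF \<phi> one u le zero_less_Suc[of D], folded \<epsilon>_def], rule that)
    \<comment> \<open>The masses of the functionals are nonnegative with sum \<phi> 1 = 1 and become
      the convex weights.\<close>
    define w where "w m = Re (\<psi> m \<one>)" for m
    have w: "\<psi> m \<one> = of_real (w m)" "w m \<ge> 0" if "m < N" for m
      using posmult_nonneg[OF posmult_one \<psi>[OF that]]
      by (auto simp: w_def complex_nonneg_Reals_iff complex_eq_iff)
    have "(\<Sum>m<N. w m) = 1" using tot[of \<one>] one by (simp add: w_def Re_sum[symmetric] del: Re_sum)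
    define z where "z = (\<Sum>m<N. w m *\<^sub>R moment_data (g m))"
    have zK: "z \<in> convex hull K" unfolding z_def
    proof (rule convex_sum)
      show "moment_data (g m) \<in> convex hull K" if "m \<in> {..<N}" for m
        using g that by (intro hull_inc) (auto simp: K_def)
    qed (use w \<open>(\<Sum>m<N. w m) = 1\<close> in \<open>auto simp: convex_convex_hull\<close>)
    have "norm (t $ i $ j $ k $ l - fst z $ i $ j $ k $ l) \<le> \<epsilon> D" for i j k l
    proof -
      have "fst z $ i $ j $ k $ l = (\<Sum>m<N. \<psi> m \<one> * (cnj (g m $ i $ j) * g m $ k $ l))"
        unfolding z_def using w by (simp add: fst_sum moment_data_def sum_component scaleR_conv_of_real[where 'a = complex])
      moreover have "t $ i $ j $ k $ l = (\<Sum>m<N. \<psi> m (star (u $ i $ j) \<otimes> u $ k $ l))"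
        using u by (simp add: t_def tot)
      ultimately show ?thesis
        by (simp add: sum_subtractf[symmetric]) (rule order_trans[OF norm_sum err])
    qed
    moreover have "norm (snd z) \<le> (real CARD('n))^3 * \<epsilon> D"
    proof -
      let ?e = "\<lambda>m i j k. norm (\<psi> m (star (u $ k $ i) \<otimes> u $ k $ j) - \<psi> m \<one> * (cnj (g m $ k $ i) * g m $ k $ j))"
      \<comment> \<open>Applying \<open>\<psi> m\<close> to the unitarity relation of
        \<open>u\<close> replaces the identity matrix in the defect by moments of
        \<open>\<psi> m\<close>, so the weighted defect is bounded by moment errors. There is one
        error for each triple i, j, k, hence the cube of the dimension.\<close>
      have "w m * unitarity_defect (g m) \<le> (\<Sum>i\<in>UNIV. \<Sum>j\<in>UNIV. \<Sum>k\<in>UNIV. ?e m i j k)" if m: "m < N" for m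
      proof -
        have "w m * norm ((\<Sum>k\<in>UNIV. cnj (g m $ k $ i) * g m $ k $ j) - (if i = j then 1 else 0)) \<le>
          (\<Sum>k\<in>UNIV. ?e m i j k)" for i j
        proof -
          have "\<psi> m \<one> * (if i = j then 1 else 0) = \<psi> m (\<Oplus>k\<in>UNIV. star (u $ k $ i) \<otimes> u $ k $ j)"
            unfolding unitary using \<psi>[OF m] by (simp add: posfun_zero)
          also have "\<dots> = (\<Sum>k\<in>UNIV. \<psi> m (star (u $ k $ i) \<otimes> u $ k $ j))"
            using u by (intro posfun_finsum[OF \<psi>[OF m]]) auto
          finally have unit: "\<psi> m \<one> * (if i = j then 1 else 0) = (\<Sum>k\<in>UNIV. \<psi> m (star (u $ k $ i) \<otimes> u $ k $ j))" .
          have "of_real (w m) * ((if i = j then 1 else 0) - (\<Sum>k\<in>UNIV. cnj (g m $ k $ i) * g m $ k $ j)) =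
            \<psi> m \<one> * (if i = j then 1 else 0) - (\<Sum>k\<in>UNIV. \<psi> m \<one> * (cnj (g m $ k $ i) * g m $ k $ j))"
            unfolding w(1)[OF m] right_diff_distrib sum_distrib_left ..
          also have "\<dots> = (\<Sum>k\<in>UNIV. \<psi> m (star (u $ k $ i) \<otimes> u $ k $ j) - \<psi> m \<one> * (cnj (g m $ k $ i) * g m $ k $ j))"
            unfolding unit sum_subtractf ..
          finally have "of_real (w m) * ((if i = j then 1 else 0) - (\<Sum>k\<in>UNIV. cnj (g m $ k $ i) * g m $ k $ j)) =
            (\<Sum>k\<in>UNIV. \<psi> m (star (u $ k $ i) \<otimes> u $ k $ j) - \<psi> m \<one> * (cnj (g m $ k $ i) * g m $ k $ j))" .
          hence "norm (of_real (w m) * ((if i = j then 1 else 0) - (\<Sum>k\<in>UNIV. cnj (g m $ k $ i) * g m $ k $ j))) \<le>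
            (\<Sum>k\<in>UNIV. ?e m i j k)"
            by (simp only: norm_sum)
          thus ?thesis
            unfolding norm_mult norm_minus_commute[of "if i = j then 1 else 0"] norm_of_real
            using w(2)[OF m] by simp
        qed
        thus ?thesis unfolding unitarity_defect_def sum_distrib_left by (intro sum_mono)
      qed
      hence "(\<Sum>m<N. w m * unitarity_defect (g m)) \<le> (\<Sum>m<N. \<Sum>i\<in>UNIV. \<Sum>j\<in>UNIV. \<Sum>k\<in>UNIV. ?e m i j k)"
        by (intro sum_mono) auto
      also have "\<dots> = (\<Sum>i\<in>UNIV. \<Sum>j\<in>UNIV. \<Sum>k\<in>UNIV. \<Sum>m<N. ?e m i j k)"
        by (subst sum.swap, intro sum.cong refl, subst sum.swap, intro sum.cong refl, rule sum.swap)
      also have "\<dots> \<le> (\<Sum>i\<in>(UNIV :: 'n set). \<Sum>j\<in>(UNIV :: 'n set). \<Sum>k\<in>(UNIV :: 'n set). \<epsilon> D)"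
        by (intro sum_mono err)
      also have "\<dots> = (real CARD('n))^3 * \<epsilon> D" by (simp add: power3_eq_cube)
      finally have "(\<Sum>m<N. w m * unitarity_defect (g m)) \<le> (real CARD('n))^3 * \<epsilon> D" .
      moreover have "snd z = (\<Sum>m<N. w m * unitarity_defect (g m))"
        unfolding z_def by (simp add: snd_sum moment_data_def)
      moreover have "(\<Sum>m<N. w m * unitarity_defect (g m)) \<ge> 0"
        using w by (intro sum_nonneg) (auto simp: unitarity_defect_nonneg)
      ultimately show ?thesis by simp
    qed
    ultimately show ?thesis using zK by blast
  qed
  hence "\<forall>D. \<exists>z. z \<in> convex hull K \<and> (\<forall>i j k l. norm (t $ i $ j $ k $ l - fst z $ i $ j $ k $ l) \<le> \<epsilon> D) \<and>
       norm (snd z) \<le> (real CARD('n))^3 * \<epsilon> D" by blast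
  from choice[OF this] obtain z where
    z: "\<forall>D. z D \<in> convex hull K \<and> (\<forall>i j k l. norm (t $ i $ j $ k $ l - fst (z D) $ i $ j $ k $ l) \<le> \<epsilon> D) \<and>
       norm (snd (z D)) \<le> (real CARD('n))^3 * \<epsilon> D" by (rule exE)
  have zK: "z D \<in> convex hull K" for D using spec[OF z] by (rule conjunct1)
  have z1: "norm (t $ i $ j $ k $ l - fst (z D) $ i $ j $ k $ l) \<le> \<epsilon> D" for D i j k l
    using conjunct1[OF conjunct2[OF spec[OF z, of D]]] by (elim allE)
  have z2: "norm (snd (z D)) \<le> (real CARD('n))^3 * \<epsilon> D" for D
    using conjunct2[OF conjunct2[OF spec[OF z, of D]]] .
  have "27 / (2 * s) = 27 / 2 * inverse s" for s :: real by (cases "s = 0") (simp_all add: field_simps)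
  hence "\<epsilon> = (\<lambda>D. 27 / 2 * sqrt (inverse (real (Suc D))))" by (simp only: \<epsilon>_def[abs_def] real_sqrt_inverse)
  moreover have "(\<lambda>D. 27 / 2 * sqrt (inverse (real (Suc D)))) \<longlonglongrightarrow> 27 / 2 * sqrt 0"
    by (intro tendsto_mult_left tendsto_real_sqrt LIMSEQ_inverse_real_of_nat)
  ultimately have \<epsilon>: "\<epsilon> \<longlonglongrightarrow> 0" by (simp only: real_sqrt_zero mult_zero_right)
  have "(\<lambda>D. fst (z D)) \<longlonglongrightarrow> t"
  proof (intro vec_tendstoI)
    fix i j k l
    show "(\<lambda>D. fst (z D) $ i $ j $ k $ l) \<longlonglongrightarrow> t $ i $ j $ k $ l"
      by (intro Lim_transform_bound[OF _ \<epsilon>, THEN LIM_zero_cancel] always_eventually)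
        (use order_trans[OF z1 abs_ge_self] in \<open>simp add: norm_minus_commute\<close>)
  qed
  moreover have "(\<lambda>D. snd (z D)) \<longlonglongrightarrow> 0"
  proof (rule tendsto_norm_zero_cancel, rule tendsto_sandwich[of "\<lambda>_. 0"])
    show "(\<lambda>D. (real CARD('n))^3 * \<epsilon> D) \<longlonglongrightarrow> 0" using tendsto_mult_right_zero[OF \<epsilon>] by simp
  qed (use z2 in auto)
  ultimately have "z \<longlonglongrightarrow> (t, 0)" using tendsto_Pair[of "\<lambda>D. fst (z D)" t _ "\<lambda>D. snd (z D)" 0] by simp
  hence "(t, 0) \<in> convex hull K"
    using closed_sequentially[OF compact_imp_closed[OF compact_convex_hull_moment_data]] zK unfolding K_def by blast
  then obtain S w where S: "finite S" "S \<subseteq> K" "\<And>x. x \<in> S \<Longrightarrow> w x \<ge> 0" "sum w S = 1"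
    and tS: "(\<Sum>x\<in>S. w x *\<^sub>R x) = (t, 0)"
    unfolding convex_hull_explicit by blast
  \<comment> \<open>A vanishing average defect says nothing about points of weight 0, so these are
    dropped first.\<close>
  define S' where "S' = {x \<in> S. w x \<noteq> 0}"
  have sumS': "(\<Sum>x\<in>S. w x *\<^sub>R f x) = (\<Sum>x\<in>S'. w x *\<^sub>R f x)" for f :: "_ \<Rightarrow> 'b::real_vector"
    unfolding S'_def using S(1) by (intro sum.mono_neutral_right) auto
  \<comment> \<open>Chooses a matrix for each point of the hull combination. Since
    \<open>moment_data\<close> undoes \<open>h\<close>, the choice is injective and the sums can be
    reindexed by matrices.\<close>
  define h where "h x = (SOME g. moment_data g = x)" for x :: "(complex^'n^'n^'n^'n) \<times> real"
  have h: "moment_data (h x) = x" if "x \<in> S'" for x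
    unfolding h_def using that S(2) by (intro someI_ex[of "\<lambda>g. moment_data g = x"]) (auto simp: S'_def K_def)
  have h_fst: "fst x $ i $ j $ k $ l = cnj (h x $ i $ j) * h x $ k $ l"
    and h_snd: "snd x = unitarity_defect (h x)" if "x \<in> S'" for x i j k l
    using arg_cong[OF h[OF that, symmetric], of fst] arg_cong[OF h[OF that, symmetric], of snd]
    by (simp_all add: moment_data_def)
  have inj: "inj_on h S'" by (metis h inj_onI)
  have "(\<Sum>x\<in>S. w x * snd x) = 0" using arg_cong[OF tS, of snd] by (simp add: snd_sum)
  hence "(\<Sum>x\<in>S'. w x * unitarity_defect (h x)) = 0"
    using sumS'[of snd] by (simp add: h_snd)
  hence zero: "\<forall>x\<in>S'. w x * unitarity_defect (h x) = 0"
    using S by (subst (asm) sum_nonneg_eq_0_iff) (auto simp: S'_def unitarity_defect_nonneg)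
  show ?thesis
  proof (rule that[of "h ` S'" "\<lambda>g. w (moment_data g)"])
    show "finite (h ` S')" using S(1) by (simp add: S'_def)
    show "mstar g ** g = mat 1" if "g \<in> h ` S'" for g
      using that zero by (auto intro!: unitarity_defect_eq_0 simp: S'_def)
    show "w (moment_data g) \<ge> 0" if "g \<in> h ` S'" for g
      using that S h by (auto simp: S'_def)
    have "sum w S = sum w S'" unfolding S'_def using S(1) by (intro sum.mono_neutral_right) auto
    thus "(\<Sum>g\<in>h ` S'. w (moment_data g)) = 1"
      using S(4) by (simp add: sum.reindex[OF inj] h)
    fix i j k l
    have "\<phi> (star (u $ i $ j) \<otimes> u $ k $ l) = (\<Sum>x\<in>S. w x *\<^sub>R fst x) $ i $ j $ k $ l"
      using arg_cong[OF tS, of fst] by (simp add: fst_sum t_def)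
    also have "\<dots> = (\<Sum>x\<in>S'. of_real (w x) * fst x $ i $ j $ k $ l)"
      unfolding sumS' by (simp add: sum_component scaleR_conv_of_real[where 'a = complex])
    also have "\<dots> = (\<Sum>x\<in>S'. of_real (w x) * (cnj (h x $ i $ j) * h x $ k $ l))"
      by (intro sum.cong refl) (simp add: h_fst)
    also have "\<dots> = (\<Sum>g\<in>h ` S'. of_real (w (moment_data g)) * (cnj (g $ i $ j) * g $ k $ l))"
      by (simp add: sum.reindex[OF inj] h)
    finally show "\<phi> (star (u $ i $ j) \<otimes> u $ k $ l) =
      (\<Sum>g\<in>h ` S'. of_real (w (moment_data g)) * (cnj (g $ i $ j) * g $ k $ l))" .
  qed
qed

end

section \<open>Abelian von Neumann algebras as commutative \<open>*\<close>-algebras\<close>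

locale hilbert_operators =
  fixes H :: "'h hilbert"
  assumes hilb: "complex_hilbert_space H"
begin

lemma is_module: "Module.module (ring_of_type_algebra :: complex ring) H"
  using hilb by (simp add: complex_hilbert_space_def)

sublocale V: Module.module "ring_of_type_algebra :: complex ring" H
  by (rule is_module)

lemma hsmult_closed [simp, intro]: "x \<in> carrier H \<Longrightarrow> c \<odot>\<^bsub>H\<^esub> x \<in> carrier H"
  using V.smult_closed[of c x] by (simp add: ring_of_type_algebra_def)

lemma hsmult_l_distr: "x \<in> carrier H \<Longrightarrow> (b + c) \<odot>\<^bsub>H\<^esub> x = b \<odot>\<^bsub>H\<^esub> x \<oplus>\<^bsub>H\<^esub> c \<odot>\<^bsub>H\<^esub> x"
  using V.smult_l_distr[of b c x] by (simp add: ring_of_type_algebra_def)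

lemma hsmult_r_distr: "x \<in> carrier H \<Longrightarrow> y \<in> carrier H \<Longrightarrow>
    c \<odot>\<^bsub>H\<^esub> (x \<oplus>\<^bsub>H\<^esub> y) = c \<odot>\<^bsub>H\<^esub> x \<oplus>\<^bsub>H\<^esub> c \<odot>\<^bsub>H\<^esub> y"
  using V.smult_r_distr[of c x y] by (simp add: ring_of_type_algebra_def)

lemma hsmult_assoc: "x \<in> carrier H \<Longrightarrow> (b * c) \<odot>\<^bsub>H\<^esub> x = b \<odot>\<^bsub>H\<^esub> (c \<odot>\<^bsub>H\<^esub> x)"
  using V.smult_assoc1[of b c x] by (simp add: ring_of_type_algebra_def)

lemma hsmult_one [simp]: "x \<in> carrier H \<Longrightarrow> 1 \<odot>\<^bsub>H\<^esub> x = x"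
  using V.smult_one[of x] by (simp add: ring_of_type_algebra_def)

lemma hsmult_zero_left [simp]: "x \<in> carrier H \<Longrightarrow> 0 \<odot>\<^bsub>H\<^esub> x = \<zero>\<^bsub>H\<^esub>"
  using V.smult_l_null[of x] by (simp add: ring_of_type_algebra_def)

lemma hsmult_zero_right [simp]: "c \<odot>\<^bsub>H\<^esub> \<zero>\<^bsub>H\<^esub> = \<zero>\<^bsub>H\<^esub>"
  using V.smult_r_null[of c] by (simp add: ring_of_type_algebra_def)

lemma hsmult_add_neg: "x \<in> carrier H \<Longrightarrow> (-1) \<odot>\<^bsub>H\<^esub> x \<oplus>\<^bsub>H\<^esub> x = \<zero>\<^bsub>H\<^esub>"
  using hsmult_l_distr[of x "-1" 1] by simp

lemma ip_add_left: "\<xi> \<in> carrier H \<Longrightarrow> \<eta> \<in> carrier H \<Longrightarrow> \<zeta> \<in> carrier H \<Longrightarrow>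
    inprod H (\<xi> \<oplus>\<^bsub>H\<^esub> \<eta>) \<zeta> = inprod H \<xi> \<zeta> + inprod H \<eta> \<zeta>"
  and ip_smult_left: "\<xi> \<in> carrier H \<Longrightarrow> \<eta> \<in> carrier H \<Longrightarrow> inprod H (c \<odot>\<^bsub>H\<^esub> \<xi>) \<eta> = c * inprod H \<xi> \<eta>"
  and ip_sym: "\<xi> \<in> carrier H \<Longrightarrow> \<eta> \<in> carrier H \<Longrightarrow> inprod H \<eta> \<xi> = cnj (inprod H \<xi> \<eta>)"
  and ip_nonneg: "\<xi> \<in> carrier H \<Longrightarrow> inprod H \<xi> \<xi> \<in> \<real>\<^sub>\<ge>\<^sub>0"
  and ip_definite: "\<xi> \<in> carrier H \<Longrightarrow> inprod H \<xi> \<xi> = 0 \<Longrightarrow> \<xi> = \<zero>\<^bsub>H\<^esub>"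
  using hilb unfolding complex_hilbert_space_def by blast+

lemma ip_add_right: "\<xi> \<in> carrier H \<Longrightarrow> \<eta> \<in> carrier H \<Longrightarrow> \<zeta> \<in> carrier H \<Longrightarrow>
    inprod H \<zeta> (\<xi> \<oplus>\<^bsub>H\<^esub> \<eta>) = inprod H \<zeta> \<xi> + inprod H \<zeta> \<eta>"
  by (simp add: ip_sym[of _ \<zeta>] ip_add_left)

lemma ip_smult_right: "\<xi> \<in> carrier H \<Longrightarrow> \<eta> \<in> carrier H \<Longrightarrow> inprod H \<eta> (c \<odot>\<^bsub>H\<^esub> \<xi>) = cnj c * inprod H \<eta> \<xi>"
  by (simp add: ip_sym[of _ \<eta>] ip_smult_left)

lemma ip_zero_left [simp]: "\<eta> \<in> carrier H \<Longrightarrow> inprod H \<zero>\<^bsub>H\<^esub> \<eta> = 0"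
  using ip_smult_left[of "\<zero>\<^bsub>H\<^esub>" \<eta> 0] by simp

lemma hnorm_sq: "\<xi> \<in> carrier H \<Longrightarrow> (hnorm H \<xi>)\<^sup>2 = Re (inprod H \<xi> \<xi>)"
  using ip_nonneg[of \<xi>] by (simp add: hnorm_def complex_nonneg_Reals_iff)

lemma hnorm_nonneg [simp]: "\<xi> \<in> carrier H \<Longrightarrow> 0 \<le> hnorm H \<xi>"
  using ip_nonneg[of \<xi>] by (simp add: hnorm_def complex_nonneg_Reals_iff)

lemma hnorm_smult: "\<xi> \<in> carrier H \<Longrightarrow> hnorm H (c \<odot>\<^bsub>H\<^esub> \<xi>) = norm c * hnorm H \<xi>"
proof -
  assume \<xi>: "\<xi> \<in> carrier H"
  have "inprod H (c \<odot>\<^bsub>H\<^esub> \<xi>) (c \<odot>\<^bsub>H\<^esub> \<xi>) = (c * cnj c) * inprod H \<xi> \<xi>"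
    using \<xi> by (simp add: ip_smult_left ip_smult_right)
  also have "c * cnj c = of_real ((norm c)\<^sup>2)" by (rule complex_norm_square[symmetric])
  finally have "(hnorm H (c \<odot>\<^bsub>H\<^esub> \<xi>))\<^sup>2 = (norm c * hnorm H \<xi>)\<^sup>2"
    using \<xi> by (simp add: hnorm_sq power_mult_distrib del: of_real_power)
  thus ?thesis using \<xi> by (subst (asm) power2_eq_iff_nonneg) auto
qed

text \<open>The parallelogram law with one square dropped; it takes the place of the triangle
  inequality when sums of bounded operators are estimated.\<close>

lemma hnorm_add_sq_le:
  assumes "\<xi> \<in> carrier H" "\<eta> \<in> carrier H"
  shows "(hnorm H (\<xi> \<oplus>\<^bsub>H\<^esub> \<eta>))\<^sup>2 \<le> 2 * (hnorm H \<xi>)\<^sup>2 + 2 * (hnorm H \<eta>)\<^sup>2"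
proof -
  have "(hnorm H (\<xi> \<oplus>\<^bsub>H\<^esub> \<eta>))\<^sup>2 + (hnorm H (\<xi> \<oplus>\<^bsub>H\<^esub> (-1) \<odot>\<^bsub>H\<^esub> \<eta>))\<^sup>2 = 2 * (hnorm H \<xi>)\<^sup>2 + 2 * (hnorm H \<eta>)\<^sup>2"
    using assms by (simp add: hnorm_sq ip_add_left ip_add_right ip_smult_left ip_smult_right)
  thus ?thesis using zero_le_power2[of "hnorm H (\<xi> \<oplus>\<^bsub>H\<^esub> (-1) \<odot>\<^bsub>H\<^esub> \<eta>)"] by linarith
qed

section \<open>The ring of bounded operators\<close>

lemma B_carrier [simp]: "carrier (B H) = bounded_operators H"
  by (simp add: B_def)

lemma B_ops:
  "x \<otimes>\<^bsub>B H\<^esub> y = compose (carrier H) x y"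
  "\<one>\<^bsub>B H\<^esub> = (\<lambda>\<xi>\<in>carrier H. \<xi>)"
  "\<zero>\<^bsub>B H\<^esub> = (\<lambda>\<xi>\<in>carrier H. \<zero>\<^bsub>H\<^esub>)"
  "x \<oplus>\<^bsub>B H\<^esub> y = (\<lambda>\<xi>\<in>carrier H. x \<xi> \<oplus>\<^bsub>H\<^esub> y \<xi>)"
  "c \<odot>\<^bsub>B H\<^esub> x = (\<lambda>\<xi>\<in>carrier H. c \<odot>\<^bsub>H\<^esub> x \<xi>)"
  by (simp_all add: B_def)

lemma B_apply [simp]:
  assumes "\<xi> \<in> carrier H"
  shows "(x \<otimes>\<^bsub>B H\<^esub> y) \<xi> = x (y \<xi>)" "\<one>\<^bsub>B H\<^esub> \<xi> = \<xi>" "\<zero>\<^bsub>B H\<^esub> \<xi> = \<zero>\<^bsub>H\<^esub>"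
    "(x \<oplus>\<^bsub>B H\<^esub> y) \<xi> = x \<xi> \<oplus>\<^bsub>H\<^esub> y \<xi>" "(c \<odot>\<^bsub>B H\<^esub> x) \<xi> = c \<odot>\<^bsub>H\<^esub> x \<xi>"
  using assms by (simp_all add: B_ops compose_eq)

lemma
  assumes "x \<in> bounded_operators H"
  shows bop_closed [simp]: "\<xi> \<in> carrier H \<Longrightarrow> x \<xi> \<in> carrier H"
    and bop_add: "\<xi> \<in> carrier H \<Longrightarrow> \<eta> \<in> carrier H \<Longrightarrow> x (\<xi> \<oplus>\<^bsub>H\<^esub> \<eta>) = x \<xi> \<oplus>\<^bsub>H\<^esub> x \<eta>"
    and bop_smult: "\<xi> \<in> carrier H \<Longrightarrow> x (c \<odot>\<^bsub>H\<^esub> \<xi>) = c \<odot>\<^bsub>H\<^esub> x \<xi>"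
    and bop_ext: "x \<in> extensional (carrier H)"
  using assms by (auto simp: bounded_operators_def PiE_def)

lemma bop_eqI:
  "x \<in> bounded_operators H \<Longrightarrow> y \<in> bounded_operators H \<Longrightarrow>
    (\<And>\<xi>. \<xi> \<in> carrier H \<Longrightarrow> x \<xi> = y \<xi>) \<Longrightarrow> x = y"
  by (rule extensionalityI[OF bop_ext bop_ext])

lemma bop_bound:
  assumes "x \<in> bounded_operators H"
  obtains K where "K \<ge> 0" "\<And>\<xi>. \<xi> \<in> carrier H \<Longrightarrow> hnorm H (x \<xi>) \<le> K * hnorm H \<xi>"
proof -
  obtain K where K: "\<And>\<xi>. \<xi> \<in> carrier H \<Longrightarrow> hnorm H (x \<xi>) \<le> K * hnorm H \<xi>"
    using assms unfolding bounded_operators_def by blast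
  show ?thesis
  proof (rule that[of "max K 0"])
    show "hnorm H (x \<xi>) \<le> max K 0 * hnorm H \<xi>" if "\<xi> \<in> carrier H" for \<xi>
      using K[OF that] mult_right_mono[of K "max K 0" "hnorm H \<xi>"] that by simp
  qed simp
qed

lemma bopI:
  assumes "\<And>\<xi>. \<xi> \<in> carrier H \<Longrightarrow> f \<xi> \<in> carrier H"
    and "\<And>\<xi> \<eta>. \<xi> \<in> carrier H \<Longrightarrow> \<eta> \<in> carrier H \<Longrightarrow> f (\<xi> \<oplus>\<^bsub>H\<^esub> \<eta>) = f \<xi> \<oplus>\<^bsub>H\<^esub> f \<eta>"
    and "\<And>c \<xi>. \<xi> \<in> carrier H \<Longrightarrow> f (c \<odot>\<^bsub>H\<^esub> \<xi>) = c \<odot>\<^bsub>H\<^esub> f \<xi>"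
    and "\<And>\<xi>. \<xi> \<in> carrier H \<Longrightarrow> hnorm H (f \<xi>) \<le> K * hnorm H \<xi>"
  shows "(\<lambda>\<xi>\<in>carrier H. f \<xi>) \<in> bounded_operators H"
  using assms by (auto simp: bounded_operators_def intro!: exI[of _ K])

lemma bop_one [simp]: "\<one>\<^bsub>B H\<^esub> \<in> bounded_operators H"
  unfolding B_ops by (rule bopI[where K = 1]) auto

lemma bop_zero [simp]: "\<zero>\<^bsub>B H\<^esub> \<in> bounded_operators H"
  unfolding B_ops by (rule bopI[where K = 0]) (auto simp: hnorm_def)

lemma bop_smult_closed [simp]:
  assumes x: "x \<in> bounded_operators H"
  shows "c \<odot>\<^bsub>B H\<^esub> x \<in> bounded_operators H"
proof -
  obtain K where K: "\<And>\<xi>. \<xi> \<in> carrier H \<Longrightarrow> hnorm H (x \<xi>) \<le> K * hnorm H \<xi>"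
    using bop_bound[OF x] by blast
  show ?thesis unfolding B_ops
  proof (rule bopI[where K = "norm c * K"])
    show "hnorm H (c \<odot>\<^bsub>H\<^esub> x \<xi>) \<le> norm c * K * hnorm H \<xi>" if "\<xi> \<in> carrier H" for \<xi>
      using mult_left_mono[OF K[OF that], of "norm c"] x that by (simp add: hnorm_smult mult.assoc)
    show "c \<odot>\<^bsub>H\<^esub> x (b \<odot>\<^bsub>H\<^esub> \<xi>) = b \<odot>\<^bsub>H\<^esub> (c \<odot>\<^bsub>H\<^esub> x \<xi>)" if "\<xi> \<in> carrier H" for b \<xi>
      using x that by (simp add: bop_smult hsmult_assoc[symmetric] mult.commute)
  qed (use x in \<open>auto simp: bop_add hsmult_r_distr\<close>)
qed

lemma bop_add_closed [simp]:
  assumes x: "x \<in> bounded_operators H" and y: "y \<in> bounded_operators H"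
  shows "x \<oplus>\<^bsub>B H\<^esub> y \<in> bounded_operators H"
proof -
  obtain K where K: "K \<ge> 0" "\<And>\<xi>. \<xi> \<in> carrier H \<Longrightarrow> hnorm H (x \<xi>) \<le> K * hnorm H \<xi>"
    using bop_bound[OF x] by blast
  obtain L where L: "L \<ge> 0" "\<And>\<xi>. \<xi> \<in> carrier H \<Longrightarrow> hnorm H (y \<xi>) \<le> L * hnorm H \<xi>"
    using bop_bound[OF y] by blast
  show ?thesis unfolding B_ops
  \<comment> \<open>The squared estimate gives 2 K^2 + 2 L^2, which is at most (2 (K +
    L))^2.\<close>
  proof (rule bopI[where K = "2 * (K + L)"])
    fix \<xi> assume \<xi>: "\<xi> \<in> carrier H"
    have "(hnorm H (x \<xi> \<oplus>\<^bsub>H\<^esub> y \<xi>))\<^sup>2 \<le> 2 * (hnorm H (x \<xi>))\<^sup>2 + 2 * (hnorm H (y \<xi>))\<^sup>2"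
      using x y \<xi> by (intro hnorm_add_sq_le) auto
    also have "\<dots> \<le> 2 * (K * hnorm H \<xi>)\<^sup>2 + 2 * (L * hnorm H \<xi>)\<^sup>2"
      using K L x y \<xi> by (intro add_mono mult_left_mono power_mono) auto
    also have "\<dots> \<le> (2 * (K + L) * hnorm H \<xi>)\<^sup>2"
      using K(1) L(1) by (simp add: power_mult_distrib power2_sum algebra_simps mult_nonneg_nonneg)
    finally show "hnorm H (x \<xi> \<oplus>\<^bsub>H\<^esub> y \<xi>) \<le> 2 * (K + L) * hnorm H \<xi>"
      by (rule power2_le_imp_le) (use K L \<xi> in simp)
  qed (use x y in \<open>auto simp: bop_add bop_smult hsmult_r_distr V.a_ac\<close>)
qed

lemma bop_compose [simp]:
  assumes x: "x \<in> bounded_operators H" and y: "y \<in> bounded_operators H"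
  shows "x \<otimes>\<^bsub>B H\<^esub> y \<in> bounded_operators H"
proof -
  obtain K where K: "K \<ge> 0" "\<And>\<xi>. \<xi> \<in> carrier H \<Longrightarrow> hnorm H (x \<xi>) \<le> K * hnorm H \<xi>"
    using bop_bound[OF x] by blast
  obtain L where L: "L \<ge> 0" "\<And>\<xi>. \<xi> \<in> carrier H \<Longrightarrow> hnorm H (y \<xi>) \<le> L * hnorm H \<xi>"
    using bop_bound[OF y] by blast
  show ?thesis unfolding B_ops compose_def
  proof (rule bopI[where K = "K * L"])
    fix \<xi> assume \<xi>: "\<xi> \<in> carrier H"
    show "hnorm H (x (y \<xi>)) \<le> K * L * hnorm H \<xi>"
      using K(2)[of "y \<xi>"] mult_left_mono[OF L(2)[OF \<xi>] K(1)] y \<xi> by simp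
  qed (use x y in \<open>auto simp: bop_add bop_smult\<close>)
qed

lemma bop_add_neg: "x \<in> bounded_operators H \<Longrightarrow> ((-1) \<odot>\<^bsub>B H\<^esub> x) \<oplus>\<^bsub>B H\<^esub> x = \<zero>\<^bsub>B H\<^esub>"
  by (rule bop_eqI) (simp_all add: hsmult_add_neg)

lemma ring_B: "ring (B H)"
proof (rule ringI)
  show "abelian_group (B H)"
  proof (rule abelian_groupI)
    fix x assume x: "x \<in> carrier (B H)"
    show "\<exists>y\<in>carrier (B H). y \<oplus>\<^bsub>B H\<^esub> x = \<zero>\<^bsub>B H\<^esub>"
      using x bop_add_neg[of x] by (intro bexI[of _ "(-1) \<odot>\<^bsub>B H\<^esub> x"]) simp_all
  qed (auto intro!: bop_eqI simp: V.a_ac)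
  show "monoid (B H)"
    by (rule monoidI) (auto intro!: bop_eqI)
qed (auto intro!: bop_eqI simp: bop_add)

section \<open>Adjoints and commutants\<close>

text \<open>The difference d of the two values at \<eta> is orthogonal to itself, since pairing it
  with either value gives the same number.\<close>

lemma is_adjoint_unique:
  assumes "is_adjoint H x y" "is_adjoint H x z" "x \<in> bounded_operators H"
  shows "y = z"
proof (rule bop_eqI)
  fix \<eta> assume \<eta>: "\<eta> \<in> carrier H"
  have yz [simp]: "y \<in> bounded_operators H" "z \<in> bounded_operators H"
    using assms by (auto simp: is_adjoint_def)
  define d where "d = y \<eta> \<oplus>\<^bsub>H\<^esub> (-1) \<odot>\<^bsub>H\<^esub> z \<eta>"
  have d: "d \<in> carrier H" using \<eta> by (simp add: d_def)
  have "inprod H d (y \<eta>) = inprod H d (z \<eta>)"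
    using assms(1,2) d \<eta> unfolding is_adjoint_def by metis
  hence "inprod H d d = 0"
    using \<eta> d by (subst (2) d_def) (simp add: ip_add_right ip_smult_right)
  hence "d = \<zero>\<^bsub>H\<^esub>" by (rule ip_definite[OF d])
  hence "d \<oplus>\<^bsub>H\<^esub> z \<eta> = z \<eta>" using \<eta> by simp
  thus "y \<eta> = z \<eta>" using \<eta> by (simp add: d_def V.a_assoc hsmult_add_neg)
qed (use assms in \<open>auto simp: is_adjoint_def\<close>)

lemma op_star_eq:
  "is_adjoint H x y \<Longrightarrow> x \<in> bounded_operators H \<Longrightarrow> op_star H x = y"
  unfolding op_star_def using is_adjoint_unique by (intro the_equality) blast+

lemma is_adjoint_sym: "is_adjoint H x y \<Longrightarrow> x \<in> bounded_operators H \<Longrightarrow> is_adjoint H y x"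
  by (auto simp: is_adjoint_def ip_sym[of "y _"]) (metis bop_closed ip_sym)

lemma is_adjoint_add:
  "is_adjoint H x x' \<Longrightarrow> is_adjoint H y y' \<Longrightarrow> x \<in> bounded_operators H \<Longrightarrow> y \<in> bounded_operators H \<Longrightarrow>
    is_adjoint H (x \<oplus>\<^bsub>B H\<^esub> y) (x' \<oplus>\<^bsub>B H\<^esub> y')"
  by (auto simp: is_adjoint_def ip_add_left ip_add_right)

lemma is_adjoint_smult:
  "is_adjoint H x x' \<Longrightarrow> x \<in> bounded_operators H \<Longrightarrow> is_adjoint H (c \<odot>\<^bsub>B H\<^esub> x) (cnj c \<odot>\<^bsub>B H\<^esub> x')"
  by (auto simp: is_adjoint_def ip_smult_left ip_smult_right)

lemma is_adjoint_mult:
  "is_adjoint H x x' \<Longrightarrow> is_adjoint H y y' \<Longrightarrow> x \<in> bounded_operators H \<Longrightarrow> y \<in> bounded_operators H \<Longrightarrow>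
    is_adjoint H (x \<otimes>\<^bsub>B H\<^esub> y) (y' \<otimes>\<^bsub>B H\<^esub> x')"
  by (auto simp: is_adjoint_def)

lemma is_adjoint_one: "is_adjoint H \<one>\<^bsub>B H\<^esub> \<one>\<^bsub>B H\<^esub>"
  by (auto simp: is_adjoint_def)

text \<open>A commutant is a unital subalgebra. A von Neumann algebra equals its double commutant
  and thereby inherits these closure properties.\<close>

lemma
  assumes "S \<subseteq> bounded_operators H"
  shows commutant_one: "\<one>\<^bsub>B H\<^esub> \<in> commutant H S"
    and commutant_zero: "\<zero>\<^bsub>B H\<^esub> \<in> commutant H S"
    and commutant_add: "x \<in> commutant H S \<Longrightarrow> y \<in> commutant H S \<Longrightarrow> x \<oplus>\<^bsub>B H\<^esub> y \<in> commutant H S"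
    and commutant_mult: "x \<in> commutant H S \<Longrightarrow> y \<in> commutant H S \<Longrightarrow> x \<otimes>\<^bsub>B H\<^esub> y \<in> commutant H S"
    and commutant_smult: "x \<in> commutant H S \<Longrightarrow> c \<odot>\<^bsub>B H\<^esub> x \<in> commutant H S"
proof -
  interpret R: ring "B H" by (rule ring_B)
  have S: "y \<in> carrier (B H)" if "y \<in> S" for y using assms that by auto
  note [simp del] = B_carrier
  show "\<one>\<^bsub>B H\<^esub> \<in> commutant H S" "\<zero>\<^bsub>B H\<^esub> \<in> commutant H S"
    using S by (auto simp: commutant_def)
  show "x \<oplus>\<^bsub>B H\<^esub> y \<in> commutant H S" if "x \<in> commutant H S" "y \<in> commutant H S" for x y
    using that S by (auto simp: commutant_def R.l_distr R.r_distr)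
  show "x \<otimes>\<^bsub>B H\<^esub> y \<in> commutant H S" if "x \<in> commutant H S" "y \<in> commutant H S" for x y
    using that S by (auto simp: commutant_def) (metis R.m_assoc)
  have "(c \<odot>\<^bsub>B H\<^esub> x) \<otimes>\<^bsub>B H\<^esub> y = c \<odot>\<^bsub>B H\<^esub> (x \<otimes>\<^bsub>B H\<^esub> y)"
    "y \<otimes>\<^bsub>B H\<^esub> (c \<odot>\<^bsub>B H\<^esub> x) = c \<odot>\<^bsub>B H\<^esub> (y \<otimes>\<^bsub>B H\<^esub> x)" "c \<odot>\<^bsub>B H\<^esub> x \<in> carrier (B H)"
    if "x \<in> carrier (B H)" "y \<in> carrier (B H)" for x y
    using that by (auto intro!: bop_eqI simp: B_carrier bop_smult)
  thus "c \<odot>\<^bsub>B H\<^esub> x \<in> commutant H S" if "x \<in> commutant H S" for x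
    using that S R.one_closed by (auto simp: commutant_def)
qed

end

section \<open>The algebra N with the adjoint as its star\<close>

locale abelian_vn = hilbert_operators H for H :: "'h hilbert" +
  fixes N :: "('h \<Rightarrow> 'h) set"
  assumes abelian: "abelian_von_neumann_algebra H N"
begin

lemma vn: "von_neumann_algebra H N" using abelian by (simp add: abelian_von_neumann_algebra_def)

lemma N_subset: "N \<subseteq> bounded_operators H" using vn by (simp add: von_neumann_algebra_def)

lemma N_bop [simp]: "x \<in> N \<Longrightarrow> x \<in> bounded_operators H" using N_subset by blast

lemma N_comm: "x \<in> N \<Longrightarrow> y \<in> N \<Longrightarrow> x \<otimes>\<^bsub>B H\<^esub> y = y \<otimes>\<^bsub>B H\<^esub> x"
  using abelian by (simp add: abelian_von_neumann_algebra_def)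

lemma N_commutant: "commutant H (commutant H N) = N"
  using vn by (simp add: von_neumann_algebra_def)

lemma commutant_subset: "commutant H N \<subseteq> bounded_operators H" by (auto simp: commutant_def)

lemma N_one: "\<one>\<^bsub>B H\<^esub> \<in> N" and N_zero: "\<zero>\<^bsub>B H\<^esub> \<in> N"
  and N_add: "x \<in> N \<Longrightarrow> y \<in> N \<Longrightarrow> x \<oplus>\<^bsub>B H\<^esub> y \<in> N"
  and N_mult: "x \<in> N \<Longrightarrow> y \<in> N \<Longrightarrow> x \<otimes>\<^bsub>B H\<^esub> y \<in> N"
  and N_smult: "x \<in> N \<Longrightarrow> c \<odot>\<^bsub>B H\<^esub> x \<in> N"
  using commutant_one[OF commutant_subset] commutant_zero[OF commutant_subset]
    commutant_add[OF commutant_subset] commutant_mult[OF commutant_subset]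
    commutant_smult[OF commutant_subset]
  unfolding N_commutant by blast+

lemma N_star: "x \<in> N \<Longrightarrow> is_adjoint H x (op_star H x)" and N_star_closed: "x \<in> N \<Longrightarrow> op_star H x \<in> N"
proof -
  assume x: "x \<in> N"
  then obtain y where y: "y \<in> N" "is_adjoint H x y" using vn by (auto simp: von_neumann_algebra_def)
  with x have "op_star H x = y" by (intro op_star_eq) auto
  with y show "is_adjoint H x (op_star H x)" "op_star H x \<in> N" by auto
qed

text \<open>Only the carrier of \<open>B H\<close> is replaced, so the operations of
  \<open>NA\<close> simplify to those of \<open>B H\<close>.\<close>

abbreviation "NA \<equiv> (B H)\<lparr>carrier := N\<rparr>"

sublocale A: comm_star_algebra NA "op_star H"
proof -
  interpret R: ring "B H" by (rule ring_B)
  have [simp]: "x \<in> carrier (B H)" if "x \<in> N" for x using that by simp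
  note [simp del] = B_carrier
  have abel: "abelian_group NA"
  proof (rule abelian_groupI)
    fix x assume x: "x \<in> carrier NA"
    have "(-1) \<odot>\<^bsub>B H\<^esub> x \<oplus>\<^bsub>B H\<^esub> x = \<zero>\<^bsub>B H\<^esub>"
      using x by (simp add: bop_add_neg)
    thus "\<exists>y\<in>carrier NA. y \<oplus>\<^bsub>NA\<^esub> x = \<zero>\<^bsub>NA\<^esub>"
      using x N_smult by (intro bexI[of _ "(-1) \<odot>\<^bsub>B H\<^esub> x"]) auto
  qed (auto simp: N_add N_zero R.a_ac)
  have "cring NA"
    by (intro cringI abel comm_monoidI)
      (auto simp: N_mult N_one R.m_assoc R.l_distr intro: N_comm)
  thus "comm_star_algebra NA (op_star H)"
  proof (intro comm_star_algebra.intro comm_star_algebra_axioms.intro)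
    fix x y c b
    show "x \<in> carrier NA \<Longrightarrow> c \<odot>\<^bsub>NA\<^esub> x \<in> carrier NA" by (simp add: N_smult)
    show "x \<in> carrier NA \<Longrightarrow> (b + c) \<odot>\<^bsub>NA\<^esub> x = b \<odot>\<^bsub>NA\<^esub> x \<oplus>\<^bsub>NA\<^esub> c \<odot>\<^bsub>NA\<^esub> x"
      by (auto intro!: bop_eqI simp: hsmult_l_distr)
    show "x \<in> carrier NA \<Longrightarrow> y \<in> carrier NA \<Longrightarrow> c \<odot>\<^bsub>NA\<^esub> (x \<oplus>\<^bsub>NA\<^esub> y) = c \<odot>\<^bsub>NA\<^esub> x \<oplus>\<^bsub>NA\<^esub> c \<odot>\<^bsub>NA\<^esub> y"
      by (auto intro!: bop_eqI simp: hsmult_r_distr)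
    show "x \<in> carrier NA \<Longrightarrow> (b * c) \<odot>\<^bsub>NA\<^esub> x = b \<odot>\<^bsub>NA\<^esub> (c \<odot>\<^bsub>NA\<^esub> x)"
      by (auto intro!: bop_eqI simp: hsmult_assoc)
    show "x \<in> carrier NA \<Longrightarrow> 1 \<odot>\<^bsub>NA\<^esub> x = x"
      by (auto intro!: bop_eqI)
    show "x \<in> carrier NA \<Longrightarrow> y \<in> carrier NA \<Longrightarrow> (c \<odot>\<^bsub>NA\<^esub> x) \<otimes>\<^bsub>NA\<^esub> y = c \<odot>\<^bsub>NA\<^esub> (x \<otimes>\<^bsub>NA\<^esub> y)"
      by (auto intro!: bop_eqI)
    show "x \<in> carrier NA \<Longrightarrow> op_star H x \<in> carrier NA" by (simp add: N_star_closed)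
    show "x \<in> carrier NA \<Longrightarrow> y \<in> carrier NA \<Longrightarrow> op_star H (x \<oplus>\<^bsub>NA\<^esub> y) = op_star H x \<oplus>\<^bsub>NA\<^esub> op_star H y"
      using op_star_eq[OF is_adjoint_add[OF N_star N_star]] N_add by simp
    show "x \<in> carrier NA \<Longrightarrow> op_star H (c \<odot>\<^bsub>NA\<^esub> x) = cnj c \<odot>\<^bsub>NA\<^esub> op_star H x"
      using op_star_eq[OF is_adjoint_smult[OF N_star]] N_smult by simp
    show "x \<in> carrier NA \<Longrightarrow> y \<in> carrier NA \<Longrightarrow> op_star H (x \<otimes>\<^bsub>NA\<^esub> y) = op_star H x \<otimes>\<^bsub>NA\<^esub> op_star H y"
      using op_star_eq[OF is_adjoint_mult[OF N_star N_star]] N_mult N_comm N_star_closed by simp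
    show "x \<in> carrier NA \<Longrightarrow> op_star H (op_star H x) = x"
      using op_star_eq[OF is_adjoint_sym[OF N_star]] N_star_closed by simp
    show "op_star H \<one>\<^bsub>NA\<^esub> = \<one>\<^bsub>NA\<^esub>"
      using op_star_eq[OF is_adjoint_one] N_one by simp
  qed
qed

text \<open>A square is a positive operator, because pairing \<open>op_star H q (q \<xi>)\<close>
  with \<xi> gives the squared norm of \<open>q \<xi>\<close>. Order positivity of the state thus
  implies positivity on squares.\<close>

lemma state_posfun:
  assumes \<tau>: "state_on H N \<tau>"
  shows "A.posfun \<tau>"
  unfolding A.posfun_def
proof (intro conjI ballI allI)
  fix q assume q: "q \<in> carrier NA"
  have "op_le H \<zero>\<^bsub>B H\<^esub> (op_star H q \<otimes>\<^bsub>B H\<^esub> q)"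
    unfolding op_le_def
  proof
    fix \<xi> assume \<xi>: "\<xi> \<in> carrier H"
    have "inprod H (op_star H q (q \<xi>)) \<xi> = inprod H (q \<xi>) (q \<xi>)"
      using is_adjoint_sym[OF N_star[of q]] q \<xi> by (auto simp: is_adjoint_def)
    thus "inprod H ((op_star H q \<otimes>\<^bsub>B H\<^esub> q) \<xi>) \<xi> - inprod H (\<zero>\<^bsub>B H\<^esub> \<xi>) \<xi> \<in> \<real>\<^sub>\<ge>\<^sub>0"
      using q \<xi> by (simp add: ip_nonneg)
  qed
  moreover have "op_star H q \<otimes>\<^bsub>B H\<^esub> q \<in> N" using q N_mult N_star_closed by simp
  ultimately have "\<tau> (op_star H q \<otimes>\<^bsub>B H\<^esub> q) \<in> \<real>\<^sub>\<ge>\<^sub>0"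
    using \<tau> unfolding state_on_def by blast
  thus "\<tau> (op_star H q \<otimes>\<^bsub>NA\<^esub> q) \<in> \<real>\<^sub>\<ge>\<^sub>0" by simp
qed (use \<tau> in \<open>auto simp: state_on_def \<close>)

text \<open>The product in \<open>matrix_tensor\<close> sums in \<open>B H\<close>, while the
  algebraic results sum in \<open>NA\<close>; this allows changing between them.\<close>

lemma finsum_B:
  assumes "finite I" "f \<in> I \<rightarrow> N"
  shows "finsum (B H) f I = finsum NA f I"
proof -
  interpret R: ring "B H" by (rule ring_B)
  have B: "x \<in> carrier (B H)" if "x \<in> N" for x using that by simp
  from assms show ?thesis
  proof (induction I rule: finite_induct)
    case (insert i I)
    have f: "f \<in> I \<rightarrow> N" "f i \<in> N" using insert.prems by auto
    hence "f \<in> I \<rightarrow> carrier (B H)" "f i \<in> carrier (B H)" "f \<in> I \<rightarrow> carrier NA" "f i \<in> carrier NA"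
      by (auto simp: Pi_iff)
    hence "finsum (B H) f (insert i I) = f i \<oplus>\<^bsub>B H\<^esub> finsum (B H) f I"
      "finsum NA f (insert i I) = f i \<oplus>\<^bsub>NA\<^esub> finsum NA f I"
      using insert.hyps by (blast intro: R.finsum_insert A.finsum_insert)+
    thus ?case using insert.IH[OF f(1)] by simp
  qed (simp add: R.finsum_empty A.finsum_empty)
qed

end

section \<open>Dilations\<close>

context comm_star_algebra begin

lemma star_finsum:
  assumes "finite I" "f \<in> I \<rightarrow> carrier M"
  shows "star (finsum M f I) = finsum M (\<lambda>i. star (f i)) I"
  using assms
proof (induction I rule: finite_induct)
  case empty
  have "star \<zero> = star (0 \<odot> \<zero>)" by simp
  also have "\<dots> = \<zero>" by (subst star_smult) auto
  finally show ?case by simp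
next
  case (insert i I)
  have f: "f \<in> I \<rightarrow> carrier M" "f i \<in> carrier M" using insert.prems by auto
  hence "(\<lambda>i. star (f i)) \<in> I \<rightarrow> carrier M" by auto
  with f insert.hyps insert.IH show ?case by (simp add: star_add finsum_closed)
qed

lemma mult_scalar_mult:
  "x \<in> carrier M \<Longrightarrow> y \<in> carrier M \<Longrightarrow> x \<otimes> (c \<odot> \<one>) \<otimes> y = c \<odot> (x \<otimes> y)"
  by (simp add: smult_assoc2 smult_assoc3)

text \<open>Moments of linear combinations of the \<open>v i\<close> become moments of the
  \<open>v i\<close> themselves, where orthonormality can be inserted.\<close>

lemma posfun_star_finsum_mult:
  assumes \<phi>: "posfun \<phi>" and "finite I" "v \<in> I \<rightarrow> carrier M"
  shows "\<phi> (star (\<Oplus>i\<in>I. b i \<odot> v i) \<otimes> (\<Oplus>j\<in>I. c j \<odot> v j)) =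
    (\<Sum>i\<in>I. \<Sum>j\<in>I. cnj (b i) * c j * \<phi> (star (v i) \<otimes> v j))"
proof -
  have v: "\<And>i. i \<in> I \<Longrightarrow> v i \<in> carrier M" using assms by auto
  have "star (\<Oplus>i\<in>I. b i \<odot> v i) = (\<Oplus>i\<in>I. cnj (b i) \<odot> star (v i))"
    using v by (subst star_finsum[OF assms(2)]) (auto simp: star_smult intro!: finsum_cong')
  also have "\<dots> \<otimes> (\<Oplus>j\<in>I. c j \<odot> v j) = (\<Oplus>i\<in>I. (cnj (b i) \<odot> star (v i)) \<otimes> (\<Oplus>j\<in>I. c j \<odot> v j))"
    using v assms(2) by (intro finsum_ldistr) (auto intro!: finsum_closed)
  also have "\<phi> \<dots> = (\<Sum>i\<in>I. \<phi> ((cnj (b i) \<odot> star (v i)) \<otimes> (\<Oplus>j\<in>I. c j \<odot> v j)))"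
    using v assms(2) by (intro posfun_finsum[OF \<phi>]) (auto intro!: finsum_closed)
  also have "\<dots> = (\<Sum>i\<in>I. \<Sum>j\<in>I. cnj (b i) * c j * \<phi> (star (v i) \<otimes> v j))"
  proof (intro sum.cong refl)
    fix i assume i: "i \<in> I"
    have "(cnj (b i) \<odot> star (v i)) \<otimes> (\<Oplus>j\<in>I. c j \<odot> v j) =
        (\<Oplus>j\<in>I. (cnj (b i) \<odot> star (v i)) \<otimes> (c j \<odot> v j))"
      using v i assms(2) by (intro finsum_rdistr) auto
    also have "\<phi> \<dots> = (\<Sum>j\<in>I. \<phi> ((cnj (b i) \<odot> star (v i)) \<otimes> (c j \<odot> v j)))"
      using v i assms(2) by (intro posfun_finsum[OF \<phi>]) auto
    also have "\<dots> = (\<Sum>j\<in>I. cnj (b i) * c j * \<phi> (star (v i) \<otimes> v j))"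
      using v i by (intro sum.cong refl) (simp add: smult_assoc2 smult_assoc3 posfun_smult[OF \<phi>])
    finally show "\<phi> ((cnj (b i) \<odot> star (v i)) \<otimes> (\<Oplus>j\<in>I. c j \<odot> v j)) =
      (\<Sum>j\<in>I. cnj (b i) * c j * \<phi> (star (v i) \<otimes> v j))" .
  qed
  finally show ?thesis .
qed

end

section \<open>Matrices over N\<close>

context abelian_vn begin

lemma carrier_matrix_tensor: "u \<in> carrier (matrix_tensor H N) \<longleftrightarrow> (\<forall>i j. u $ i $ j \<in> N)"
  by (simp add: matrix_tensor_def)

lemma mult_matrix_tensor:
  fixes u w :: "('h \<Rightarrow> 'h)^'n^'n"
  assumes "u \<in> carrier (matrix_tensor H N)" "w \<in> carrier (matrix_tensor H N)"
  shows "(u \<otimes>\<^bsub>matrix_tensor H N\<^esub> w) $ i $ j = (\<Oplus>\<^bsub>NA\<^esub>k\<in>UNIV. u $ i $ k \<otimes>\<^bsub>NA\<^esub> w $ k $ j)"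
  using assms finsum_B[of "UNIV :: 'n set" "\<lambda>k. u $ i $ k \<otimes>\<^bsub>B H\<^esub> w $ k $ j"] N_mult
  by (simp add: matrix_tensor_def)

lemma mult_matrix_tensor_closed:
  assumes "u \<in> carrier (matrix_tensor H N)" "w \<in> carrier (matrix_tensor H N)"
  shows "u \<otimes>\<^bsub>matrix_tensor H N\<^esub> w \<in> carrier (matrix_tensor H N)"
  unfolding carrier_matrix_tensor mult_matrix_tensor[OF assms]
  using A.finsum_closed[of "\<lambda>k. u $ i $ k \<otimes>\<^bsub>NA\<^esub> w $ k $ j" UNIV for i j] assms N_mult
  by (auto simp: carrier_matrix_tensor)

text \<open>Provides the recursion for \<open>finsum\<close> over \<open>matrix_tensor H N\<close>,
  by which the sum of the elementary tensors is computed entrywise.\<close>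

lemma abelian_monoid_matrix_tensor: "abelian_monoid (matrix_tensor H N :: (complex, ('h \<Rightarrow> 'h)^'n^'n) module)"
proof (rule abelian_monoidI)
  fix x y z :: "('h \<Rightarrow> 'h)^'n^'n"
  let ?M = "matrix_tensor H N :: (complex, ('h \<Rightarrow> 'h)^'n^'n) module"
  show "x \<in> carrier ?M \<Longrightarrow> y \<in> carrier ?M \<Longrightarrow> x \<oplus>\<^bsub>?M\<^esub> y \<in> carrier ?M"
    by (simp add: matrix_tensor_def N_add)
  show "\<zero>\<^bsub>?M\<^esub> \<in> carrier ?M" by (simp add: matrix_tensor_def N_zero)
  show "x \<in> carrier ?M \<Longrightarrow> y \<in> carrier ?M \<Longrightarrow> z \<in> carrier ?M \<Longrightarrow>
      x \<oplus>\<^bsub>?M\<^esub> y \<oplus>\<^bsub>?M\<^esub> z = x \<oplus>\<^bsub>?M\<^esub> (y \<oplus>\<^bsub>?M\<^esub> z)"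
    using A.a_assoc by (simp add: matrix_tensor_def vec_eq_iff)
  show "x \<in> carrier ?M \<Longrightarrow> \<zero>\<^bsub>?M\<^esub> \<oplus>\<^bsub>?M\<^esub> x = x"
    using A.l_zero by (simp add: matrix_tensor_def vec_eq_iff)
  show "x \<in> carrier ?M \<Longrightarrow> y \<in> carrier ?M \<Longrightarrow> x \<oplus>\<^bsub>?M\<^esub> y = y \<oplus>\<^bsub>?M\<^esub> x"
    using A.a_comm by (simp add: matrix_tensor_def vec_eq_iff)
qed

lemma finsum_matrix_tensor:
  fixes f :: "'i \<Rightarrow> ('h \<Rightarrow> 'h)^'n^'n"
  assumes "finite I" "f \<in> I \<rightarrow> carrier (matrix_tensor H N)"
  shows "finsum (matrix_tensor H N) f I $ i $ j = (\<Oplus>\<^bsub>NA\<^esub>m\<in>I. f m $ i $ j)"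
  using assms
proof (induction I rule: finite_induct)
  interpret MT: abelian_monoid "matrix_tensor H N :: (complex, ('h \<Rightarrow> 'h)^'n^'n) module"
    by (rule abelian_monoid_matrix_tensor)
  case empty
  have "\<zero>\<^bsub>matrix_tensor H N\<^esub> $ i $ j = \<zero>\<^bsub>NA\<^esub>" by (simp add: matrix_tensor_def)
  thus ?case by simp
next
  interpret MT: abelian_monoid "matrix_tensor H N :: (complex, ('h \<Rightarrow> 'h)^'n^'n) module"
    by (rule abelian_monoid_matrix_tensor)
  case (insert m I)
  have f: "f \<in> I \<rightarrow> carrier (matrix_tensor H N)" "f m \<in> carrier (matrix_tensor H N)"
    using insert.prems by auto
  have "finsum (matrix_tensor H N) f (insert m I) = f m \<oplus>\<^bsub>matrix_tensor H N\<^esub> finsum (matrix_tensor H N) f I"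
    using insert.hyps f by (rule MT.finsum_insert)
  moreover have "(\<Oplus>\<^bsub>NA\<^esub>m\<in>insert m I. f m $ i $ j) = f m $ i $ j \<oplus>\<^bsub>NA\<^esub> (\<Oplus>\<^bsub>NA\<^esub>m\<in>I. f m $ i $ j)"
    using insert.hyps f by (intro A.finsum_insert) (auto simp: carrier_matrix_tensor Pi_iff)
  moreover have "(x \<oplus>\<^bsub>matrix_tensor H N\<^esub> y) $ i $ j = x $ i $ j \<oplus>\<^bsub>NA\<^esub> y $ i $ j" for x y
    by (simp add: matrix_tensor_def)
  ultimately show ?case using insert.IH[OF f(1)] by simp
qed

text \<open>Shows that the dilated map depends on \<open>u\<close> and \<tau> only through the
  second moments of the entries; commutativity moves the scalar entries of \<open>x\<close>
  out.\<close>

lemma id_tensor_conjugation: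
  fixes u :: "('h \<Rightarrow> 'h)^'n^'n"
  assumes \<tau>: "state_on H N \<tau>" and u: "u \<in> carrier (matrix_tensor H N)"
  shows "id_tensor \<tau> (tensor_star H u \<otimes>\<^bsub>matrix_tensor H N\<^esub> elem_tensor H x \<one>\<^bsub>B H\<^esub>
      \<otimes>\<^bsub>matrix_tensor H N\<^esub> u) $ i $ j =
    (\<Sum>k\<in>UNIV. \<Sum>l\<in>UNIV. x $ k $ l * \<tau> (op_star H (u $ k $ i) \<otimes>\<^bsub>NA\<^esub> u $ l $ j))"
proof -
  note \<phi> = state_posfun[OF \<tau>]
  have uN: "u $ i $ j \<in> carrier NA" for i j using u by (simp add: carrier_matrix_tensor)
  have star: "tensor_star H u \<in> carrier (matrix_tensor H N)"
    using u by (simp add: carrier_matrix_tensor tensor_star_def N_star_closed)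
  have elem: "elem_tensor H x \<one>\<^bsub>B H\<^esub> \<in> carrier (matrix_tensor H N)"
    by (simp add: carrier_matrix_tensor elem_tensor_def N_smult N_one)
  have "(tensor_star H u \<otimes>\<^bsub>matrix_tensor H N\<^esub> elem_tensor H x \<one>\<^bsub>B H\<^esub> \<otimes>\<^bsub>matrix_tensor H N\<^esub> u) $ i $ j =
    (\<Oplus>\<^bsub>NA\<^esub>l\<in>UNIV. (\<Oplus>\<^bsub>NA\<^esub>k\<in>UNIV. op_star H (u $ k $ i) \<otimes>\<^bsub>NA\<^esub> (x $ k $ l \<odot>\<^bsub>NA\<^esub> \<one>\<^bsub>NA\<^esub>)) \<otimes>\<^bsub>NA\<^esub> u $ l $ j)"
    unfolding mult_matrix_tensor[OF mult_matrix_tensor_closed[OF star elem] u] mult_matrix_tensor[OF star elem]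
    by (simp add: tensor_star_def elem_tensor_def)
  also have "\<dots> = (\<Oplus>\<^bsub>NA\<^esub>l\<in>UNIV. \<Oplus>\<^bsub>NA\<^esub>k\<in>UNIV. x $ k $ l \<odot>\<^bsub>NA\<^esub> (op_star H (u $ k $ i) \<otimes>\<^bsub>NA\<^esub> u $ l $ j))"
  proof (intro A.finsum_cong' refl)
    fix l
    have "(\<Oplus>\<^bsub>NA\<^esub>k\<in>UNIV. op_star H (u $ k $ i) \<otimes>\<^bsub>NA\<^esub> (x $ k $ l \<odot>\<^bsub>NA\<^esub> \<one>\<^bsub>NA\<^esub>)) \<otimes>\<^bsub>NA\<^esub> u $ l $ j =
      (\<Oplus>\<^bsub>NA\<^esub>k\<in>UNIV. op_star H (u $ k $ i) \<otimes>\<^bsub>NA\<^esub> (x $ k $ l \<odot>\<^bsub>NA\<^esub> \<one>\<^bsub>NA\<^esub>) \<otimes>\<^bsub>NA\<^esub> u $ l $ j)"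
      using uN by (intro A.finsum_ldistr) (auto intro!: N_mult N_smult N_star_closed N_one)
    also have "\<dots> = (\<Oplus>\<^bsub>NA\<^esub>k\<in>UNIV. x $ k $ l \<odot>\<^bsub>NA\<^esub> (op_star H (u $ k $ i) \<otimes>\<^bsub>NA\<^esub> u $ l $ j))"
    proof (intro A.finsum_cong' refl)
      show "op_star H (u $ k $ i) \<otimes>\<^bsub>NA\<^esub> (x $ k $ l \<odot>\<^bsub>NA\<^esub> \<one>\<^bsub>NA\<^esub>) \<otimes>\<^bsub>NA\<^esub> u $ l $ j =
        x $ k $ l \<odot>\<^bsub>NA\<^esub> (op_star H (u $ k $ i) \<otimes>\<^bsub>NA\<^esub> u $ l $ j)" for k
        by (rule A.mult_scalar_mult[OF A.star_closed[OF uN] uN])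
    qed (use uN in \<open>auto intro!: N_mult N_smult N_star_closed\<close>)
    finally show "(\<Oplus>\<^bsub>NA\<^esub>k\<in>UNIV. op_star H (u $ k $ i) \<otimes>\<^bsub>NA\<^esub> (x $ k $ l \<odot>\<^bsub>NA\<^esub> \<one>\<^bsub>NA\<^esub>)) \<otimes>\<^bsub>NA\<^esub> u $ l $ j =
      (\<Oplus>\<^bsub>NA\<^esub>k\<in>UNIV. x $ k $ l \<odot>\<^bsub>NA\<^esub> (op_star H (u $ k $ i) \<otimes>\<^bsub>NA\<^esub> u $ l $ j))" .
  qed (use A.finsum_closed[of "\<lambda>k. x $ k $ l \<odot>\<^bsub>NA\<^esub> (op_star H (u $ k $ i) \<otimes>\<^bsub>NA\<^esub> u $ l $ j)" UNIV for l] uN in \<open>auto intro!: N_mult N_smult N_star_closed\<close>)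
  finally have *: "(tensor_star H u \<otimes>\<^bsub>matrix_tensor H N\<^esub> elem_tensor H x \<one>\<^bsub>B H\<^esub> \<otimes>\<^bsub>matrix_tensor H N\<^esub> u) $ i $ j =
    (\<Oplus>\<^bsub>NA\<^esub>l\<in>UNIV. \<Oplus>\<^bsub>NA\<^esub>k\<in>UNIV. x $ k $ l \<odot>\<^bsub>NA\<^esub> (op_star H (u $ k $ i) \<otimes>\<^bsub>NA\<^esub> u $ l $ j))" .
  have c: "x $ k $ l \<odot>\<^bsub>NA\<^esub> (op_star H (u $ k $ i) \<otimes>\<^bsub>NA\<^esub> u $ l $ j) \<in> carrier NA" for k l
    using uN by (intro A.m_closed A.smult_closed A.star_closed)
  have m: "\<tau> (x $ k $ l \<odot>\<^bsub>NA\<^esub> (op_star H (u $ k $ i) \<otimes>\<^bsub>NA\<^esub> u $ l $ j)) =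
      x $ k $ l * \<tau> (op_star H (u $ k $ i) \<otimes>\<^bsub>NA\<^esub> u $ l $ j)" for k l
    by (rule A.posfun_smult[OF \<phi> A.m_closed[OF A.star_closed[OF uN] uN]])
  have "\<tau> ((tensor_star H u \<otimes>\<^bsub>matrix_tensor H N\<^esub> elem_tensor H x \<one>\<^bsub>B H\<^esub> \<otimes>\<^bsub>matrix_tensor H N\<^esub> u) $ i $ j) =
    (\<Sum>l\<in>UNIV. \<Sum>k\<in>UNIV. x $ k $ l * \<tau> (op_star H (u $ k $ i) \<otimes>\<^bsub>NA\<^esub> u $ l $ j))"
    unfolding * using c m
    by (subst A.posfun_finsum[OF \<phi>], simp, blast intro: A.finsum_closed)
      (intro sum.cong refl, subst A.posfun_finsum[OF \<phi>],
        auto)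
  also have "\<dots> = (\<Sum>k\<in>UNIV. \<Sum>l\<in>UNIV. x $ k $ l * \<tau> (op_star H (u $ k $ i) \<otimes>\<^bsub>NA\<^esub> u $ l $ j))"
    by (rule sum.swap)
  finally show ?thesis by (simp add: id_tensor_def map_matrix_def)
qed

end

section \<open>Conjugation by scalar unitary matrices\<close>

lemma mstar_mult: "mstar (x ** y) = mstar y ** mstar x"
  by (simp add: vec_eq_iff matrix_matrix_mult_def mult.commute)

lemma mstar_mstar [simp]: "mstar (mstar A) = A"
  by (simp add: vec_eq_iff)

lemma mscale_nth [simp]: "mscale c A $ i $ j = c * A $ i $ j"
  by (simp add: mscale_def map_matrix_def)

lemma mscale_mult_left: "mscale c x ** y = mscale c (x ** y)"
  and mscale_mult_right: "x ** mscale c y = mscale c (x ** y)"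
  by (simp_all add: vec_eq_iff matrix_matrix_mult_def sum_distrib_left mult_ac)

text \<open>Has the same shape as \<open>id_tensor_conjugation\<close>, so that comparing maps
  amounts to comparing moments.\<close>

lemma conjugation_nth:
  "(mstar g ** x ** h) $ i $ j = (\<Sum>k\<in>UNIV. \<Sum>l\<in>UNIV. x $ k $ l * (cnj (g $ k $ i) * h $ l $ j))"
  by (subst sum.swap) (simp add: matrix_matrix_mult_def sum_distrib_left sum_distrib_right mult_ac)

lemma unitary_right: "mstar g ** g = mat 1 \<Longrightarrow> g ** mstar g = mat 1"
  by (rule iffD1[OF matrix_left_right_inverse])

lemma conjugation_Aut:
  fixes g :: "complex^'n^'n"
  assumes g: "mstar g ** g = mat 1"
  obtains \<phi> where "\<phi> \<in> Aut_matrices" "\<And>x. blinfun_apply \<phi> x = mstar g ** x ** g"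
proof -
  let ?c = "\<lambda>x. mstar g ** x ** g"
  have "linear ?c"
    by (rule linearI) (simp_all add: vec_eq_iff matrix_matrix_mult_def sum.distrib sum_distrib_left
        sum_distrib_right scaleR_conv_of_real[where 'a = complex] algebra_simps)
  hence bl: "bounded_linear ?c" by (simp add: linear_conv_bounded_linear)
  have g': "g ** mstar g = mat 1" using g by (rule unitary_right)
  have inv1: "?c (g ** x ** mstar g) = x" for x
    using g by (metis matrix_mul_assoc matrix_mul_lid matrix_mul_rid)
  have inv2: "g ** ?c x ** mstar g = x" for x
    using g' by (metis matrix_mul_assoc matrix_mul_lid matrix_mul_rid)
  have "bij ?c" by (rule o_bij[of "\<lambda>x. g ** x ** mstar g"]) (simp_all add: fun_eq_iff inv1 inv2)
  moreover have "?c (x ** y) = ?c x ** ?c y" for x y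
    using g' by (metis matrix_mul_assoc matrix_mul_lid matrix_mul_rid)
  ultimately have "Blinfun ?c \<in> Aut_matrices"
    by (simp add: Aut_matrices_def bounded_linear_Blinfun_apply[OF bl] mscale_mult_left mscale_mult_right
        mstar_mult matrix_mul_assoc)
  thus ?thesis by (rule that) (simp add: bounded_linear_Blinfun_apply[OF bl])
qed

section \<open>The implications from (2) to (1) and from (3) to (2)\<close>

text \<open>The moments of \<open>u\<close> in \<open>id_tensor_conjugation\<close> are replaced by
  averages over scalar unitaries from \<open>commuting_unitary_moments\<close>; exchanging the sums
  exhibits \<open>T\<close> as the average of the conjugations.\<close>

lemma abelian_dilation_imp_convex_hull:
  fixes T :: "(complex^'n^'n) \<Rightarrow>\<^sub>L (complex^'n^'n)"
  assumes "abelian_dilation TYPE('i::infinite) T"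
  shows "T \<in> convex hull Aut_matrices"
proof -
  from assms obtain H :: "('i \<Rightarrow> complex) hilbert" and N \<tau> and u :: "(('i \<Rightarrow> complex) \<Rightarrow> ('i \<Rightarrow> complex))^'n^'n" where
    N: "abelian_von_neumann_algebra H N" and \<tau>: "normal_faithful_tracial_state H N \<tau>"
    and u: "unitary_in_tensor H N u"
    and T: "\<And>x. T x = id_tensor \<tau> (tensor_star H u \<otimes>\<^bsub>matrix_tensor H N\<^esub> elem_tensor H x \<one>\<^bsub>B H\<^esub>
              \<otimes>\<^bsub>matrix_tensor H N\<^esub> u)"
    unfolding abelian_dilation_def by blast
  interpret abelian_vn H N
    using N by (intro abelian_vn.intro hilbert_operators.intro abelian_vn_axioms.intro)
      (simp_all add: abelian_von_neumann_algebra_def von_neumann_algebra_def)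
  have st: "state_on H N \<tau>" using \<tau> by (simp add: normal_faithful_tracial_state_def)
  have one: "\<tau> \<one>\<^bsub>NA\<^esub> = 1" using st by (simp add: state_on_def)
  have uc: "u \<in> carrier (matrix_tensor H N)" using u by (simp add: unitary_in_tensor_def)
  have us: "tensor_star H u \<in> carrier (matrix_tensor H N)"
    using uc by (simp add: carrier_matrix_tensor tensor_star_def N_star_closed)
  have uN: "u $ i $ j \<in> carrier NA" for i j using uc by (simp add: carrier_matrix_tensor)
  have unit: "(\<Oplus>\<^bsub>NA\<^esub>k\<in>UNIV. op_star H (u $ k $ i) \<otimes>\<^bsub>NA\<^esub> u $ k $ j) = (if i = j then \<one>\<^bsub>NA\<^esub> else \<zero>\<^bsub>NA\<^esub>)" for i j
  proof -
    have "(\<Oplus>\<^bsub>NA\<^esub>k\<in>UNIV. op_star H (u $ k $ i) \<otimes>\<^bsub>NA\<^esub> u $ k $ j) = (tensor_star H u \<otimes>\<^bsub>matrix_tensor H N\<^esub> u) $ i $ j"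
      unfolding mult_matrix_tensor[OF us uc] by (simp add: tensor_star_def)
    also have "\<dots> = \<one>\<^bsub>matrix_tensor H N\<^esub> $ i $ j" using u by (simp add: unitary_in_tensor_def)
    finally show ?thesis by (simp add: matrix_tensor_def)
  qed
  obtain S :: "(complex^'n^'n) set" and w where S: "finite S" "\<And>g. g \<in> S \<Longrightarrow> mstar g ** g = mat 1"
    "\<And>g. g \<in> S \<Longrightarrow> w g \<ge> 0" "sum w S = 1"
    and mom: "\<And>i j k l. \<tau> (op_star H (u $ i $ j) \<otimes>\<^bsub>NA\<^esub> u $ k $ l) = (\<Sum>g\<in>S. of_real (w g) * (cnj (g $ i $ j) * g $ k $ l))"
    by (rule A.commuting_unitary_moments[OF state_posfun[OF st] one uN unit]) (rule that)
  have "\<exists>\<phi>. \<phi> \<in> Aut_matrices \<and> (\<forall>x. blinfun_apply \<phi> x = mstar g ** x ** g)" if "g \<in> S" for g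
    using conjugation_Aut[OF S(2)[OF that]] by metis
  then obtain \<phi> where \<phi>: "\<And>g. g \<in> S \<Longrightarrow> \<phi> g \<in> Aut_matrices"
    "\<And>g x. g \<in> S \<Longrightarrow> blinfun_apply (\<phi> g) x = mstar g ** x ** g" by metis
  have "T = (\<Sum>g\<in>S. w g *\<^sub>R \<phi> g)"
  proof (rule blinfun_eqI)
    fix x
    have "T x $ i $ j = (\<Sum>g\<in>S. w g *\<^sub>R (mstar g ** x ** g)) $ i $ j" for i j
    proof -
      have "T x $ i $ j = (\<Sum>k\<in>UNIV. \<Sum>l\<in>UNIV. \<Sum>g\<in>S. x $ k $ l * (of_real (w g) * (cnj (g $ k $ i) * g $ l $ j)))"
        unfolding T id_tensor_conjugation[OF st uc] mom sum_distrib_left ..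
      also have "\<dots> = (\<Sum>k\<in>UNIV. \<Sum>g\<in>S. \<Sum>l\<in>UNIV. x $ k $ l * (of_real (w g) * (cnj (g $ k $ i) * g $ l $ j)))"
        by (intro sum.cong refl) (rule sum.swap)
      also have "\<dots> = (\<Sum>g\<in>S. \<Sum>k\<in>UNIV. \<Sum>l\<in>UNIV. x $ k $ l * (of_real (w g) * (cnj (g $ k $ i) * g $ l $ j)))"
        by (rule sum.swap)
      also have "\<dots> = (\<Sum>g\<in>S. w g *\<^sub>R (mstar g ** x ** g)) $ i $ j"
        unfolding sum_component vector_scaleR_component conjugation_nth
        by (simp add: scaleR_conv_of_real[where 'a = complex] sum_distrib_left mult_ac)
      finally show ?thesis .
    qed
    hence "T x = (\<Sum>g\<in>S. w g *\<^sub>R (mstar g ** x ** g))" by (simp only: vec_eq_iff) simp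
    also have "\<dots> = (\<Sum>g\<in>S. w g *\<^sub>R \<phi> g) x"
      by (simp add: blinfun.sum_left blinfun.scaleR_left \<phi>(2))
    finally show "T x = (\<Sum>g\<in>S. w g *\<^sub>R \<phi> g) x" .
  qed
  also have "\<dots> \<in> convex hull Aut_matrices"
    using S \<phi>(1) by (intro convex_sum) (auto simp: hull_inc)
  finally show ?thesis .
qed

text \<open>The same algebra, state and unitary serve. Orthonormality collapses the double sum in
  the moments of \<open>u\<close> to the moments of the Kraus operators.\<close>

lemma orthonormal_imp_dilation:
  fixes T :: "(complex^'n^'n) \<Rightarrow>\<^sub>L (complex^'n^'n)"
  assumes T: "\<And>x. T x = (\<Sum>i=1..d. mstar (a i) ** x ** a i)"
    and "orthonormal_abelian_unitary TYPE('i::infinite) d a"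
  shows "abelian_dilation TYPE('i) T"
proof -
  from assms(2) obtain H :: "('i \<Rightarrow> complex) hilbert" and N \<tau> v where
    N: "abelian_von_neumann_algebra H N" and \<tau>: "normal_faithful_tracial_state H N \<tau>"
    and v: "\<forall>i\<in>{1..d}. v i \<in> N"
    and u: "unitary_in_tensor H N (\<Oplus>\<^bsub>matrix_tensor H N\<^esub>i\<in>{1..d}. elem_tensor H (a i) (v i))"
    and orth: "\<And>i j. i\<in>{1..d} \<Longrightarrow> j\<in>{1..d} \<Longrightarrow> \<tau> (op_star H (v i) \<otimes>\<^bsub>B H\<^esub> v j) = (if i = j then 1 else 0)"
    unfolding orthonormal_abelian_unitary_def by blast
  interpret abelian_vn H N
    using N by (intro abelian_vn.intro hilbert_operators.intro abelian_vn_axioms.intro)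
      (simp_all add: abelian_von_neumann_algebra_def von_neumann_algebra_def)
  have st: "state_on H N \<tau>" using \<tau> by (simp add: normal_faithful_tracial_state_def)
  define u where "u = (\<Oplus>\<^bsub>matrix_tensor H N\<^esub>i\<in>{1..d}. elem_tensor H (a i) (v i))"
  have uc: "u \<in> carrier (matrix_tensor H N)" using u by (simp add: unitary_in_tensor_def u_def)
  have u_nth: "u $ k $ l = (\<Oplus>\<^bsub>NA\<^esub>i\<in>{1..d}. a i $ k $ l \<odot>\<^bsub>NA\<^esub> v i)" for k l
    unfolding u_def using v
    by (subst finsum_matrix_tensor) (auto simp: carrier_matrix_tensor elem_tensor_def N_smult)
  have mom: "\<tau> (op_star H (u $ k $ i) \<otimes>\<^bsub>NA\<^esub> u $ l $ j) = (\<Sum>m=1..d. cnj (a m $ k $ i) * a m $ l $ j)" for i j k l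
  proof -
    have "\<tau> (op_star H (u $ k $ i) \<otimes>\<^bsub>NA\<^esub> u $ l $ j) =
      (\<Sum>m=1..d. \<Sum>m'=1..d. cnj (a m $ k $ i) * a m' $ l $ j * \<tau> (op_star H (v m) \<otimes>\<^bsub>NA\<^esub> v m'))"
      unfolding u_nth using v by (intro A.posfun_star_finsum_mult[OF state_posfun[OF st]]) auto
    also have "\<dots> = (\<Sum>m=1..d. \<Sum>m'=1..d. if m = m' then cnj (a m $ k $ i) * a m $ l $ j else 0)"
      by (intro sum.cong refl) (auto simp: orth)
    also have "\<dots> = (\<Sum>m=1..d. cnj (a m $ k $ i) * a m $ l $ j)"
      by (intro sum.cong refl) simp
    finally show ?thesis .
  qed
  have "T x = id_tensor \<tau> (tensor_star H u \<otimes>\<^bsub>matrix_tensor H N\<^esub> elem_tensor H x \<one>\<^bsub>B H\<^esub>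
              \<otimes>\<^bsub>matrix_tensor H N\<^esub> u)" for x
  proof -
    have "T x $ i $ j = id_tensor \<tau> (tensor_star H u \<otimes>\<^bsub>matrix_tensor H N\<^esub> elem_tensor H x \<one>\<^bsub>B H\<^esub>
              \<otimes>\<^bsub>matrix_tensor H N\<^esub> u) $ i $ j" for i j
    proof -
      have "T x $ i $ j = (\<Sum>m=1..d. \<Sum>k\<in>UNIV. \<Sum>l\<in>UNIV. x $ k $ l * (cnj (a m $ k $ i) * a m $ l $ j))"
        unfolding T sum_component conjugation_nth ..
      also have "\<dots> = (\<Sum>k\<in>UNIV. \<Sum>m=1..d. \<Sum>l\<in>UNIV. x $ k $ l * (cnj (a m $ k $ i) * a m $ l $ j))"
        by (rule sum.swap)
      also have "\<dots> = (\<Sum>k\<in>UNIV. \<Sum>l\<in>UNIV. \<Sum>m=1..d. x $ k $ l * (cnj (a m $ k $ i) * a m $ l $ j))"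
        by (intro sum.cong refl) (rule sum.swap)
      finally show ?thesis unfolding id_tensor_conjugation[OF st uc] mom sum_distrib_left .
    qed
    thus ?thesis by (simp add: vec_eq_iff)
  qed
  thus ?thesis unfolding abelian_dilation_def using N \<tau> u[folded u_def] by blast
qed

section \<open>Inner automorphisms and Kraus operators\<close>

definition matrix_unit :: "'n \<Rightarrow> 'n \<Rightarrow> complex^'n^'n" where
  "matrix_unit i j = (\<chi> r s. if r = i \<and> s = j then 1 else 0)"

lemma matrix_unit_nth [simp]: "matrix_unit i j $ r $ s = (if r = i \<and> s = j then 1 else 0)"
  by (simp add: matrix_unit_def)

lemma mstar_matrix_unit: "mstar (matrix_unit i j) = matrix_unit j i"
  by (simp add: vec_eq_iff conj_commute)

lemma matrix_unit_mult: "matrix_unit i j ** matrix_unit k l = (if j = k then matrix_unit i l else 0)"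
  by (auto simp: vec_eq_iff matrix_matrix_mult_def if_distrib[of "\<lambda>z. z * _"] sum.If_cases if_distrib[of "(*) _"]
      cong: if_cong conj_cong intro!: sum.neutral)

lemma mult_matrix_unit: "x ** matrix_unit i j = (\<Sum>k\<in>UNIV. mscale (x $ k $ i) (matrix_unit k j))"
proof -
  have "(x ** matrix_unit i j) $ r $ s = (\<Sum>k\<in>UNIV. mscale (x $ k $ i) (matrix_unit k j)) $ r $ s" for r s
    by (cases "s = j") (simp_all add: matrix_matrix_mult_def sum_component if_distrib[of "\<lambda>z. _ * z"] cong: if_cong)
  thus ?thesis by (simp add: vec_eq_iff)
qed

lemma adjoint_matrix_vector:
  "(\<Sum>r\<in>UNIV. cnj ((A *v \<xi>) $ r) * \<zeta> $ r) = (\<Sum>t\<in>UNIV. cnj (\<xi> $ t) * (mstar A *v \<zeta>) $ t)"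
  unfolding matrix_vector_mult_def vec_lambda_beta cnj_sum sum_distrib_left sum_distrib_right
  by (subst sum.swap) (simp add: mult_ac)

text \<open>With matrix units E i j and a fixed index o, take a nonzero vector \<xi> in the range of
  the projection \<phi> (E o o). The vectors \<phi> (E i o) \<xi> are orthogonal and of equal
  length, and the matrix with these columns intertwines \<phi> with the identity. Normalizing it
  gives a unitary.\<close>

lemma Aut_is_conjugation:
  fixes \<phi> :: "(complex^'n^'n) \<Rightarrow>\<^sub>L (complex^'n^'n)"
  assumes "\<phi> \<in> Aut_matrices"
  obtains g where "mstar g ** g = mat 1" "\<And>x. \<phi> x = mstar g ** x ** g"
proof -
  have inj: "inj (blinfun_apply \<phi>)" and sc: "\<And>c x. \<phi> (mscale c x) = mscale c (\<phi> x)"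
    and mul: "\<And>x y. \<phi> (x ** y) = \<phi> x ** \<phi> y" and st: "\<And>x. \<phi> (mstar x) = mstar (\<phi> x)"
    using assms by (auto simp: Aut_matrices_def bij_def)
  \<comment> \<open>Any index will do.\<close>
  define o' :: 'n where "o' = undefined"
  define p where "p = \<phi> (matrix_unit o' o')"
  have pp: "p ** p = p" by (simp add: p_def mul[symmetric] matrix_unit_mult)
  have "p \<noteq> 0"
  proof
    assume "p = 0"
    hence "\<phi> (matrix_unit o' o') = \<phi> 0" by (simp add: p_def blinfun.zero_right)
    hence "matrix_unit o' o' = (0 :: complex^'n^'n)" by (rule injD[OF inj])
    hence "matrix_unit o' o' $ o' $ o' = 0" by (simp only: zero_index)
    thus False by simp
  qed
  then obtain r s where rs: "p $ r $ s \<noteq> 0" by (auto simp: vec_eq_iff)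
  define \<xi> where "\<xi> = p *v axis s 1"
  have p\<xi>: "p *v \<xi> = \<xi>" by (simp add: \<xi>_def matrix_vector_mul_assoc pp)
  have "\<xi> $ r = p $ r $ s"
    by (simp add: \<xi>_def matrix_vector_mult_def axis_def if_distrib[of "\<lambda>z. _ * z"] cong: if_cong)
  hence \<xi>r: "\<xi> $ r \<noteq> 0" using rs by simp
  define c where "c = (\<Sum>t\<in>UNIV. (norm (\<xi> $ t))\<^sup>2)"
  have "c > 0" unfolding c_def using \<xi>r by (intro sum_pos2[of _ r]) auto
  \<comment> \<open>Column \<open>i\<close> is \<phi> (E i o) \<xi>. Inner products of columns
    reduce by the matrix unit relations to \<phi> (E o o) \<xi> = \<xi> or to 0.\<close>
  define U :: "complex^'n^'n" where "U = (\<chi> r i. (\<phi> (matrix_unit i o') *v \<xi>) $ r)"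
  have UU: "mstar U ** U = mscale (of_real c) (mat 1)"
  proof -
    have "(mstar U ** U) $ i $ j = mscale (of_real c) (mat 1) $ i $ j" for i j
    proof -
      have "(mstar U ** U) $ i $ j =
        (\<Sum>r\<in>UNIV. cnj ((\<phi> (matrix_unit i o') *v \<xi>) $ r) * (\<phi> (matrix_unit j o') *v \<xi>) $ r)"
        by (simp add: matrix_matrix_mult_def U_def)
      also have "\<dots> = (\<Sum>t\<in>UNIV. cnj (\<xi> $ t) * (\<phi> (matrix_unit o' i ** matrix_unit j o') *v \<xi>) $ t)"
        unfolding adjoint_matrix_vector matrix_vector_mul_assoc st[symmetric] mul mstar_matrix_unit ..
      also have "\<dots> = (if i = j then (\<Sum>t\<in>UNIV. cnj (\<xi> $ t) * \<xi> $ t) else 0)"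
        using p\<xi> by (simp add: matrix_unit_mult p_def[symmetric] blinfun.zero_right)
      also have "(\<Sum>t\<in>UNIV. cnj (\<xi> $ t) * \<xi> $ t) = of_real c"
        unfolding c_def of_real_sum by (intro sum.cong refl) (metis complex_norm_square mult.commute)
      finally show ?thesis by (simp add: mat_def)
    qed
    thus ?thesis by (simp add: vec_eq_iff)
  qed
  \<comment> \<open>Column \<open>i\<close> of x E i o spreads into the matrix units E k o with
    coefficients x k i, and \<phi> is complex linear.\<close>
  have \<phi>U: "\<phi> x ** U = U ** x" for x
  proof -
    have "(\<phi> x ** U) $ r $ i = (U ** x) $ r $ i" for r i
    proof -
      have "(\<phi> x ** U) $ r $ i = (\<phi> x *v (\<phi> (matrix_unit i o') *v \<xi>)) $ r"
        by (simp add: matrix_matrix_mult_def matrix_vector_mult_def U_def)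
      also have "\<dots> = (\<phi> (\<Sum>k\<in>UNIV. mscale (x $ k $ i) (matrix_unit k o')) *v \<xi>) $ r"
        by (simp only: matrix_vector_mul_assoc mul[symmetric] mult_matrix_unit)
      also have "\<dots> = (\<Sum>t\<in>UNIV. \<Sum>k\<in>UNIV. x $ k $ i * \<phi> (matrix_unit k o') $ r $ t * \<xi> $ t)"
        by (simp add: blinfun.sum_right sc matrix_vector_mult_def sum_component sum_distrib_right)
      also have "\<dots> = (\<Sum>k\<in>UNIV. \<Sum>t\<in>UNIV. x $ k $ i * \<phi> (matrix_unit k o') $ r $ t * \<xi> $ t)"
        by (rule sum.swap)
      also have "\<dots> = (U ** x) $ r $ i"
        by (simp add: matrix_matrix_mult_def matrix_vector_mult_def U_def sum_distrib_left sum_distrib_right mult_ac)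
      finally show ?thesis .
    qed
    thus ?thesis by (simp add: vec_eq_iff)
  qed
  define V where "V = mscale (of_real (1 / sqrt c)) U"
  have sq: "complex_of_real (1 / sqrt c) * of_real (1 / sqrt c) * of_real c = 1"
    using \<open>c > 0\<close> by (simp only: of_real_mult[symmetric]) simp
  have "mstar V ** V = mscale (of_real (1 / sqrt c) * of_real (1 / sqrt c)) (mstar U ** U)"
    by (simp add: V_def vec_eq_iff matrix_matrix_mult_def sum_distrib_left mult_ac)
  also have "\<dots> = mat 1" unfolding UU using sq by (simp add: vec_eq_iff mat_def mult.assoc)
  finally have V: "mstar V ** V = mat 1" .
  have V': "V ** mstar V = mat 1" by (rule unitary_right[OF V])
  have "\<phi> x ** V = V ** x" for x by (simp add: V_def mscale_mult_left mscale_mult_right \<phi>U)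
  hence "\<phi> x = V ** x ** mstar V" for x using V' by (metis matrix_mul_assoc matrix_mul_rid)
  \<comment> \<open>The conjugations have the form \<open>mstar g ** x ** g\<close>, hence the
    adjoint of \<open>V\<close> as witness.\<close>
  thus ?thesis by (intro that[of "mstar V"]) (simp_all add: V')
qed

section \<open>Functionals dual to a linearly independent family\<close>

lemma inner_eq_Re: "inner (x :: complex^'n^'n) y = Re (\<Sum>i\<in>UNIV. \<Sum>j\<in>UNIV. cnj (y $ i $ j) * x $ i $ j)"
  by (simp add: inner_vec_def inner_complex_def mult.commute)

text \<open>The complex-linear functional with coefficient matrix \<open>f\<close>, without
  conjugation. Summing over pairs makes it a single sum when summations are exchanged.\<close>

definition pairing :: "complex^'n^'n \<Rightarrow> complex^'n^'n \<Rightarrow> complex" where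
  "pairing f x = (\<Sum>p\<in>UNIV. f $ fst p $ snd p * x $ fst p $ snd p)"

lemma pairing_alt: "pairing f x = (\<Sum>i\<in>UNIV. \<Sum>j\<in>UNIV. f $ i $ j * x $ i $ j)"
  by (simp add: pairing_def sum.cartesian_product case_prod_unfold)

lemma pairing_add_right: "pairing f (x + y) = pairing f x + pairing f y"
  by (simp add: pairing_def sum.distrib ring_distribs)

text \<open>Split \<open>a j\<close> into a part in the complex span of the other matrices and a
  part z orthogonal to it. Independence gives z \<noteq> 0, and pairing with the conjugate of z,
  divided by its squared norm, is the functional sought.\<close>

lemma dual_functionals:
  fixes a :: "nat \<Rightarrow> complex^'n^'n" and I :: "nat set"
  assumes I: "finite I"
    and indep: "\<And>c. (\<Sum>i\<in>I. mscale (c i) (a i)) = 0 \<Longrightarrow> \<forall>i\<in>I. c i = 0"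
  obtains F where "\<And>i j. i \<in> I \<Longrightarrow> j \<in> I \<Longrightarrow> pairing (F i) (a j) = (if i = j then 1 else 0)"
proof -
  have "\<exists>f. \<forall>i\<in>I. pairing f (a i) = (if j = i then 1 else 0)" if j: "j \<in> I" for j
  proof -
    define S where "S = {s. \<exists>c. s = (\<Sum>i\<in>I - {j}. mscale (c i) (a i))}"
    have msum: "mscale k (\<Sum>i\<in>I - {j}. mscale (c i) (a i)) = (\<Sum>i\<in>I - {j}. mscale (k * c i) (a i))" for k c
      by (simp add: vec_eq_iff sum_component sum_distrib_left mult.assoc)
    have Sm: "mscale k s \<in> S" if s: "s \<in> S" for k s
    proof -
      obtain c where "s = (\<Sum>i\<in>I - {j}. mscale (c i) (a i))" using s by (auto simp: S_def)
      thus ?thesis unfolding S_def by (intro CollectI exI[of _ "\<lambda>i. k * c i"]) (simp only: msum)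
    qed
    have sub: "subspace S"
    proof (rule subspaceI)
      show "0 \<in> S" unfolding S_def by (rule CollectI, rule exI[of _ "\<lambda>_. 0"]) (simp add: vec_eq_iff sum_component)
      show "x + y \<in> S" if xy: "x \<in> S" "y \<in> S" for x y
      proof -
        obtain b c where "x = (\<Sum>i\<in>I - {j}. mscale (b i) (a i))" "y = (\<Sum>i\<in>I - {j}. mscale (c i) (a i))"
          using xy by (auto simp: S_def)
        hence "x + y = (\<Sum>i\<in>I - {j}. mscale (b i + c i) (a i))"
          by (simp add: vec_eq_iff sum_component sum.distrib ring_distribs)
        thus ?thesis unfolding S_def by (intro CollectI exI[of _ "\<lambda>i. b i + c i"])
      qed
      show "k *\<^sub>R x \<in> S" if "x \<in> S" for k x
      proof -
        have "k *\<^sub>R x = mscale (of_real k) x" by (simp add: vec_eq_iff scaleR_conv_of_real[where 'a = complex])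
        thus ?thesis using Sm[OF that] by simp
      qed
    qed
    obtain y z where yz: "y \<in> span S" "\<And>w. w \<in> span S \<Longrightarrow> orthogonal z w" "a j = y + z"
      using orthogonal_subspace_decomp_exists[of S "a j"] by blast
    have spS: "span S = S" using sub by (simp add: span_eq_iff)
    define f where "f = mscale (1 / of_real ((norm z)\<^sup>2)) (map_matrix cnj z)"
    have orth: "(\<Sum>i\<in>UNIV. \<Sum>j\<in>UNIV. cnj (z $ i $ j) * w $ i $ j) = 0" if w: "w \<in> S" for w
    proof -
      have in0: "inner v z = 0" if "v \<in> S" for v
        using yz(2)[of v] that spS by (simp add: orthogonal_def inner_commute)
      \<comment> \<open>The decomposition is orthogonal for the real inner product. Since the span
        is complex, -\<i> w is also orthogonal to z, and the two relations give the real and the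
        imaginary part of the complex pairing.\<close>
      have "inner w z = 0" "inner (mscale (-\<i>) w) z = 0"
        using in0[OF w] in0[OF Sm[OF w]] by blast+
      hence "Re (\<Sum>i\<in>UNIV. \<Sum>j\<in>UNIV. cnj (z $ i $ j) * w $ i $ j) = 0"
        "Re (-\<i> * (\<Sum>i\<in>UNIV. \<Sum>j\<in>UNIV. cnj (z $ i $ j) * w $ i $ j)) = 0"
        unfolding inner_eq_Re by (simp_all add: sum_distrib_left mult_ac del: Re_sum)
      thus ?thesis by (simp add: complex_eq_iff)
    qed
    have pf: "pairing f x = 1 / of_real ((norm z)\<^sup>2) * (\<Sum>i\<in>UNIV. \<Sum>j\<in>UNIV. cnj (z $ i $ j) * x $ i $ j)" for x
      by (simp add: pairing_alt f_def map_matrix_def sum_distrib_left mult.assoc)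
    have fS: "pairing f w = 0" if "w \<in> S" for w unfolding pf orth[OF that] by simp
    have "z \<noteq> 0"
    proof
      assume "z = 0"
      hence "a j \<in> S" using yz spS by simp
      then obtain c where c: "a j = (\<Sum>i\<in>I - {j}. mscale (c i) (a i))" by (auto simp: S_def)
      \<comment> \<open>If z vanished, \<open>a j\<close> would be a combination of the others; this
        is the resulting nontrivial relation.\<close>
      define c' where "c' = c(j := -1)"
      have "(\<Sum>i\<in>I. mscale (c' i) (a i)) = mscale (c' j) (a j) + (\<Sum>i\<in>I - {j}. mscale (c' i) (a i))"
        by (rule sum.remove[OF I j])
      also have "(\<Sum>i\<in>I - {j}. mscale (c' i) (a i)) = a j"
        unfolding c by (intro sum.cong) (auto simp: c'_def)
      also have "mscale (c' j) (a j) + a j = 0" by (simp add: c'_def vec_eq_iff)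
      finally have "c' j = 0" using indep j by blast
      thus False by (simp add: c'_def)
    qed
    have "(\<Sum>i\<in>UNIV. \<Sum>j\<in>UNIV. cnj (z $ i $ j) * z $ i $ j) = of_real ((norm z)\<^sup>2)"
    proof (rule complex_eqI)
      show "Re (\<Sum>i\<in>UNIV. \<Sum>j\<in>UNIV. cnj (z $ i $ j) * z $ i $ j) = Re (of_real ((norm z)\<^sup>2))"
        unfolding inner_eq_Re[symmetric] by (simp add: power2_norm_eq_inner)
    qed (simp add: mult.commute)
    hence fz: "pairing f z = 1" unfolding pf using \<open>z \<noteq> 0\<close> by simp
    show ?thesis
    proof (intro exI ballI)
      fix i assume i: "i \<in> I"
      show "pairing f (a i) = (if j = i then 1 else 0)"
      proof (cases "i = j")
        case True
        thus ?thesis using fz fS[of y] yz spS by (simp add: pairing_add_right)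
      next
        case False
        have "a i = (\<Sum>k\<in>I - {j}. if k = i then a i else 0)" using I i False by simp
        also have "\<dots> = (\<Sum>k\<in>I - {j}. mscale (if k = i then 1 else 0) (a k))"
          by (intro sum.cong refl) (auto simp: vec_eq_iff)
        finally have "a i \<in> S" unfolding S_def by (intro CollectI exI[of _ "\<lambda>k. if k = i then 1 else 0"])
        thus ?thesis using fS False by simp
      qed
    qed
  qed
  then obtain F where "\<And>j i. j \<in> I \<Longrightarrow> i \<in> I \<Longrightarrow> pairing (F j) (a i) = (if j = i then 1 else 0)"
    by metis
  thus ?thesis by (rule that)
qed

section \<open>Comparison of two Kraus forms of one map\<close>

lemma pairing_moments:
  fixes g :: "'b \<Rightarrow> complex^'n^'n"
  assumes "finite S"
  shows "(\<Sum>s\<in>S. l s * (cnj (pairing f (g s)) * pairing h (g s))) =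
    (\<Sum>p\<in>UNIV. \<Sum>q\<in>UNIV. cnj (f $ fst p $ snd p) * h $ fst q $ snd q *
       (\<Sum>s\<in>S. l s * (cnj (g s $ fst p $ snd p) * g s $ fst q $ snd q)))"
proof -
  have "(\<Sum>s\<in>S. l s * (cnj (pairing f (g s)) * pairing h (g s))) =
    (\<Sum>s\<in>S. \<Sum>p\<in>UNIV. \<Sum>q\<in>UNIV. cnj (f $ fst p $ snd p) * h $ fst q $ snd q *
      (l s * (cnj (g s $ fst p $ snd p) * g s $ fst q $ snd q)))"
    unfolding pairing_def cnj_sum sum_product unfolding sum_distrib_left by (simp add: mult_ac)
  also have "\<dots> = (\<Sum>p\<in>UNIV. \<Sum>s\<in>S. \<Sum>q\<in>UNIV. cnj (f $ fst p $ snd p) * h $ fst q $ snd q *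
      (l s * (cnj (g s $ fst p $ snd p) * g s $ fst q $ snd q)))"
    by (rule sum.swap)
  also have "\<dots> = (\<Sum>p\<in>UNIV. \<Sum>q\<in>UNIV. \<Sum>s\<in>S. cnj (f $ fst p $ snd p) * h $ fst q $ snd q *
      (l s * (cnj (g s $ fst p $ snd p) * g s $ fst q $ snd q)))"
    by (intro sum.cong refl) (rule sum.swap)
  finally show ?thesis unfolding sum_distrib_left .
qed

text \<open>Evaluating at a matrix unit isolates a single product of two entries in each Kraus term,
  so equal maps have equal second moments.\<close>

lemma kraus_moments:
  fixes g :: "'b \<Rightarrow> complex^'n^'n" and a :: "'c \<Rightarrow> complex^'n^'n"
  assumes "finite S"
    and T: "\<And>x. (\<Sum>s\<in>S. mscale (l s) (mstar (g s) ** x ** g s)) = (\<Sum>m\<in>I. mstar (a m) ** x ** a m)"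
  shows "(\<Sum>s\<in>S. l s * (cnj (g s $ k $ i) * g s $ m $ j)) = (\<Sum>n\<in>I. cnj (a n $ k $ i) * a n $ m $ j)"
proof -
  have unit: "(mstar h ** matrix_unit k m ** h) $ i $ j = cnj (h $ k $ i) * h $ m $ j" for h :: "complex^'n^'n"
    unfolding conjugation_nth
    by (simp add: if_distrib[of "\<lambda>z. z * _"] sum.delta cong: if_cong)
      (subst sum.cong[OF refl, of _ _ "\<lambda>r. if r = k then cnj (h $ k $ i) * h $ m $ j else 0"], auto)
  show ?thesis
    using arg_cong[OF T[of "matrix_unit k m"], of "\<lambda>x. x $ i $ j"]
    by (simp add: sum_component unit)
qed

text \<open>Both Kraus families induce the same sesquilinear form on functionals
  (\<open>mom\<close>). On the dual functionals this is orthonormality of the coefficients. A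
  functional that kills all \<open>a i\<close> has weighted square sum 0 on the \<open>g s\<close>
  and, the weights being positive, kills these as well.\<close>

lemma kraus_unitary_coefficients:
  fixes a :: "nat \<Rightarrow> complex^'n^'n" and g :: "'b \<Rightarrow> complex^'n^'n"
  assumes S: "finite S" "\<And>s. s \<in> S \<Longrightarrow> l s > 0" and I: "finite I"
    and indep: "\<And>c. (\<Sum>i\<in>I. mscale (c i) (a i)) = 0 \<Longrightarrow> \<forall>i\<in>I. c i = 0"
    and T: "\<And>x. (\<Sum>s\<in>S. l s *\<^sub>R (mstar (g s) ** x ** g s)) = (\<Sum>i\<in>I. mstar (a i) ** x ** a i)"
  obtains c where "\<And>s. s \<in> S \<Longrightarrow> g s = (\<Sum>i\<in>I. mscale (c s i) (a i))"
    "\<And>i j. i \<in> I \<Longrightarrow> j \<in> I \<Longrightarrow> (\<Sum>s\<in>S. of_real (l s) * (cnj (c s i) * c s j)) = (if i = j then 1 else 0)"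
proof -
  obtain F where F: "\<And>i j. i \<in> I \<Longrightarrow> j \<in> I \<Longrightarrow> pairing (F i) (a j) = (if i = j then 1 else 0)"
    using dual_functionals[OF I indep] by blast
  have sc: "r *\<^sub>R x = mscale (of_real r) x" for r and x :: "complex^'n^'n"
    by (simp add: vec_eq_iff scaleR_conv_of_real[where 'a = complex])
  note km = kraus_moments[OF S(1) T[unfolded sc]]
  have mom: "(\<Sum>s\<in>S. of_real (l s) * (cnj (pairing f (g s)) * pairing h (g s))) =
    (\<Sum>i\<in>I. cnj (pairing f (a i)) * pairing h (a i))" for f h
    using pairing_moments[OF S(1), of "\<lambda>s. of_real (l s)" f g h] pairing_moments[OF I, of "\<lambda>_. 1" f a h]
    unfolding km by simp
  define c where "c s i = pairing (F i) (g s)" for s i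
  show ?thesis
  proof (rule that[of c])
    fix i j assume ij: "i \<in> I" "j \<in> I"
    have "(\<Sum>s\<in>S. of_real (l s) * (cnj (c s i) * c s j)) = (\<Sum>m\<in>I. cnj (pairing (F i) (a m)) * pairing (F j) (a m))"
      unfolding c_def by (rule mom)
    also have "\<dots> = (\<Sum>m\<in>I. if m = i then (if i = j then 1 else 0) else 0)"
      using ij F by (intro sum.cong refl) auto
    also have "\<dots> = (if i = j then 1 else 0)" using I ij by simp
    finally show "(\<Sum>s\<in>S. of_real (l s) * (cnj (c s i) * c s j)) = (if i = j then 1 else 0)" .
  next
    fix s assume s: "s \<in> S"
    have "g s $ p $ q = (\<Sum>i\<in>I. mscale (c s i) (a i)) $ p $ q" for p q
    proof -
      \<comment> \<open>\<open>pairing h x\<close> is the (p, q) entry of x minus its expansion in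
        the \<open>a i\<close> with the dual coefficients; it vanishes on every
        \<open>a i\<close>.\<close>
      define h where "h = matrix_unit p q - (\<Sum>i\<in>I. mscale (a i $ p $ q) (F i))"
      have ph: "pairing h x = x $ p $ q - (\<Sum>i\<in>I. a i $ p $ q * pairing (F i) x)" for x
      proof -
        have "pairing (matrix_unit p q) x = x $ p $ q"
          unfolding pairing_alt
          by (subst sum.cong[OF refl, of _ _ "\<lambda>r. if r = p then x $ p $ q else 0"])
            (auto simp: if_distrib[of "\<lambda>z. z * _"] cong: if_cong)
        moreover have "pairing (\<Sum>i\<in>I. mscale (a i $ p $ q) (F i)) x = (\<Sum>i\<in>I. a i $ p $ q * pairing (F i) x)"
          unfolding pairing_def sum_component mscale_nth sum_distrib_right sum_distrib_left
          by (subst sum.swap) (simp add: mult.assoc)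
        moreover have "pairing h x = pairing (matrix_unit p q) x - pairing (\<Sum>i\<in>I. mscale (a i $ p $ q) (F i)) x"
          by (simp add: h_def pairing_def sum_subtractf left_diff_distrib)
        ultimately show ?thesis by simp
      qed
      have "pairing h (a m) = 0" if "m \<in> I" for m
      proof -
        have "(\<Sum>i\<in>I. a i $ p $ q * pairing (F i) (a m)) = (\<Sum>i\<in>I. if i = m then a m $ p $ q else 0)"
          using that F by (intro sum.cong refl) auto
        thus ?thesis using that I by (simp add: ph)
      qed
      hence "(\<Sum>s\<in>S. of_real (l s) * (cnj (pairing h (g s)) * pairing h (g s))) = 0"
        unfolding mom by simp
      also have "(\<Sum>s\<in>S. of_real (l s) * (cnj (pairing h (g s)) * pairing h (g s))) =
        of_real (\<Sum>s\<in>S. l s * (norm (pairing h (g s)))\<^sup>2)"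
        unfolding of_real_sum of_real_mult complex_norm_square by (simp add: mult.commute)
      finally have "(\<Sum>s\<in>S. l s * (norm (pairing h (g s)))\<^sup>2) = 0" by (simp only: of_real_eq_0_iff)
      hence "l s * (norm (pairing h (g s)))\<^sup>2 = 0"
        using S s by (subst (asm) sum_nonneg_eq_0_iff) (simp_all add: less_imp_le)
      hence "pairing h (g s) = 0" using S(2)[OF s] by simp
      thus ?thesis by (simp add: ph c_def sum_component mult.commute)
    qed
    thus "g s = (\<Sum>i\<in>I. mscale (c s i) (a i))" by (simp add: vec_eq_iff)
  qed
qed

text \<open>Dropping zero weights makes all weights strictly positive, as the comparison of Kraus
  forms and the faithfulness of the weighted trace require.\<close>

lemma convex_hull_Aut_positive:
  fixes T :: "(complex^'n^'n) \<Rightarrow>\<^sub>L (complex^'n^'n)"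
  assumes "T \<in> convex hull Aut_matrices"
  obtains S :: "((complex^'n^'n) \<Rightarrow>\<^sub>L (complex^'n^'n)) set" and l and g :: "_ \<Rightarrow> complex^'n^'n"
  where "finite S" "\<And>s. s \<in> S \<Longrightarrow> l s > 0" "sum l S = 1" "\<And>s. s \<in> S \<Longrightarrow> mstar (g s) ** g s = mat 1"
    "\<And>x. T x = (\<Sum>s\<in>S. l s *\<^sub>R (mstar (g s) ** x ** g s))"
proof -
  obtain S l where S: "finite S" "S \<subseteq> Aut_matrices" "\<And>s. s \<in> S \<Longrightarrow> l s \<ge> 0" "sum l S = 1"
    and T: "(\<Sum>s\<in>S. l s *\<^sub>R s) = T"
    using assms unfolding convex_hull_explicit by blast
  have "\<forall>s\<in>S. \<exists>g. mstar g ** g = mat 1 \<and> (\<forall>x. blinfun_apply s x = mstar g ** x ** g)"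
    using S(2) by (metis Aut_is_conjugation subsetD)
  then obtain g where g: "\<And>s. s \<in> S \<Longrightarrow> mstar (g s) ** g s = mat 1"
    "\<And>s x. s \<in> S \<Longrightarrow> blinfun_apply s x = mstar (g s) ** x ** g s" by metis
  define S' where "S' = {s \<in> S. l s \<noteq> 0}"
  show ?thesis
  proof (rule that[of S' l g])
    show "finite S'" using S by (simp add: S'_def)
    show "l s > 0" if "s \<in> S'" for s using S(3)[of s] that by (simp add: S'_def)
    have "sum l S' = sum l S" unfolding S'_def using S(1) by (intro sum.mono_neutral_left) auto
    thus "sum l S' = 1" using S by simp
    show "mstar (g s) ** g s = mat 1" if "s \<in> S'" for s using g that by (simp add: S'_def)
    fix x
    have "T x = (\<Sum>s\<in>S. l s *\<^sub>R (mstar (g s) ** x ** g s))"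
      unfolding T[symmetric] by (simp add: blinfun.sum_left blinfun.scaleR_left g(2))
    also have "\<dots> = (\<Sum>s\<in>S'. l s *\<^sub>R (mstar (g s) ** x ** g s))"
      unfolding S'_def using S(1) by (intro sum.mono_neutral_right) auto
    finally show "T x = (\<Sum>s\<in>S'. l s *\<^sub>R (mstar (g s) ** x ** g s))" .
  qed
qed

section \<open>Diagonal operators on a finite-dimensional Hilbert space\<close>

text \<open>The unused ring multiplication and unit are filled with the constant \<open>0\<close>.\<close>

definition fin_hilbert :: "'i set \<Rightarrow> ('i \<Rightarrow> complex) hilbert" where
  "fin_hilbert J = \<lparr>
     carrier = {f. \<forall>i. i \<notin> J \<longrightarrow> f i = 0},
     monoid.mult = (\<lambda>_ _ _. 0), one = (\<lambda>_. 0),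
     zero = (\<lambda>_. 0), add = (\<lambda>f g i. f i + g i), smult = (\<lambda>c f i. c * f i),
     inprod = (\<lambda>f g. \<Sum>j\<in>J. f j * cnj (g j))\<rparr>"

lemma fin_hilbert_simps [simp]:
  "f \<in> carrier (fin_hilbert J) \<longleftrightarrow> (\<forall>i. i \<notin> J \<longrightarrow> f i = 0)"
  "\<zero>\<^bsub>fin_hilbert J\<^esub> = (\<lambda>_. 0)"
  "f \<oplus>\<^bsub>fin_hilbert J\<^esub> g = (\<lambda>i. f i + g i)"
  "c \<odot>\<^bsub>fin_hilbert J\<^esub> f = (\<lambda>i. c * f i)"
  "inprod (fin_hilbert J) f g = (\<Sum>j\<in>J. f j * cnj (g j))"
  by (simp_all add: fin_hilbert_def)

lemma abelian_group_fin_hilbert: "abelian_group (fin_hilbert J)"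
proof (rule abelian_groupI)
  fix f assume "f \<in> carrier (fin_hilbert J)"
  thus "\<exists>g\<in>carrier (fin_hilbert J). g \<oplus>\<^bsub>fin_hilbert J\<^esub> f = \<zero>\<^bsub>fin_hilbert J\<^esub>"
    by (intro bexI[of _ "\<lambda>i. - f i"]) auto
qed (auto simp: add_ac)

lemma minus_fin_hilbert:
  assumes "f \<in> carrier (fin_hilbert J)" "g \<in> carrier (fin_hilbert J)"
  shows "f \<ominus>\<^bsub>fin_hilbert J\<^esub> g = (\<lambda>i. f i - g i)"
proof -
  interpret G: abelian_group "fin_hilbert J" by (rule abelian_group_fin_hilbert)
  have "\<ominus>\<^bsub>fin_hilbert J\<^esub> g = (\<lambda>i. - g i)"
    using assms by (intro G.minus_equality) auto
  thus ?thesis by (simp add: G.minus_eq)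
qed

lemma inprod_fin_hilbert_self: "inprod (fin_hilbert J) f f = of_real (\<Sum>j\<in>J. (norm (f j))\<^sup>2)"
  unfolding of_real_sum complex_norm_square by simp

lemma hnorm_fin_hilbert: "hnorm (fin_hilbert J) f = sqrt (\<Sum>j\<in>J. (norm (f j))\<^sup>2)"
  unfolding hnorm_def inprod_fin_hilbert_self by simp

lemma complex_hilbert_space_fin_hilbert:
  fixes J :: "'i set"
  assumes J: "finite J"
  shows "complex_hilbert_space (fin_hilbert J)"
  unfolding complex_hilbert_space_def
proof (intro conjI ballI allI impI)
  show "Module.module (ring_of_type_algebra :: complex ring) (fin_hilbert J)"
    by (intro moduleI cring_from_type_algebra abelian_group_fin_hilbert)
      (auto simp: ring_of_type_algebra_def ring_distribs)
next
  fix f assume f: "f \<in> carrier (fin_hilbert J)" "inprod (fin_hilbert J) f f = 0"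
  hence "(\<Sum>j\<in>J. (norm (f j))\<^sup>2) = 0" unfolding inprod_fin_hilbert_self by (simp only: of_real_eq_0_iff)
  hence "\<forall>j\<in>J. f j = 0" using J by (simp add: sum_nonneg_eq_0_iff)
  with f(1) show "f = \<zero>\<^bsub>fin_hilbert J\<^esub>" by auto
next
  fix s :: "nat \<Rightarrow> 'i \<Rightarrow> complex"
  assume s: "range s \<subseteq> carrier (fin_hilbert J) \<and>
    (\<forall>e>0. \<exists>M. \<forall>m\<ge>M. \<forall>n\<ge>M. hnorm (fin_hilbert J) (s m \<ominus>\<^bsub>fin_hilbert J\<^esub> s n) < e)"
  have sc: "s n \<in> carrier (fin_hilbert J)" for n using conjunct1[OF s] by blast
  \<comment> \<open>Completeness is checked coordinatewise: each coordinate is dominated by the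
    norm, and finitely many coordinate limits give convergence in norm.\<close>
  have "convergent (\<lambda>n. s n j)" if j: "j \<in> J" for j
  proof (rule Cauchy_convergent, rule CauchyI)
    fix e :: real assume "e > 0"
    with conjunct2[OF s] obtain M where
      M: "\<forall>m\<ge>M. \<forall>n\<ge>M. hnorm (fin_hilbert J) (s m \<ominus>\<^bsub>fin_hilbert J\<^esub> s n) < e" by meson
    have "norm (s m j - s n j) < e" if "m \<ge> M" "n \<ge> M" for m n
    proof -
      have "(norm (s m j - s n j))\<^sup>2 \<le> (\<Sum>j\<in>J. (norm (s m j - s n j))\<^sup>2)"
        using J j by (intro member_le_sum) auto
      hence "norm (s m j - s n j) \<le> hnorm (fin_hilbert J) (s m \<ominus>\<^bsub>fin_hilbert J\<^esub> s n)"
        unfolding minus_fin_hilbert[OF sc sc] hnorm_fin_hilbert by (rule real_le_rsqrt)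
      thus ?thesis using M[rule_format, OF that] by (rule le_less_trans)
    qed
    thus "\<exists>M. \<forall>m\<ge>M. \<forall>n\<ge>M. norm (s m j - s n j) < e" by blast
  qed
  then obtain l where l: "\<And>j. j \<in> J \<Longrightarrow> (\<lambda>n. s n j) \<longlonglongrightarrow> l j" unfolding convergent_def by metis
  define \<xi> where "\<xi> j = (if j \<in> J then l j else 0)" for j
  have \<xi>: "\<xi> \<in> carrier (fin_hilbert J)" by (simp add: \<xi>_def)
  have "(\<lambda>n. sqrt (\<Sum>j\<in>J. (norm (s n j - \<xi> j))\<^sup>2)) \<longlonglongrightarrow> sqrt (\<Sum>j\<in>J. (norm (\<xi> j - \<xi> j))\<^sup>2)"
    using l by (intro tendsto_intros) (simp add: \<xi>_def)
  hence "(\<lambda>n. hnorm (fin_hilbert J) (s n \<ominus>\<^bsub>fin_hilbert J\<^esub> \<xi>)) \<longlonglongrightarrow> 0"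
    unfolding minus_fin_hilbert[OF sc \<xi>] hnorm_fin_hilbert by simp
  with \<xi> show "\<exists>\<xi>\<in>carrier (fin_hilbert J). (\<lambda>n. hnorm (fin_hilbert J) (s n \<ominus>\<^bsub>fin_hilbert J\<^esub> \<xi>)) \<longlonglongrightarrow> 0"
    by blast
next
  show "inprod (fin_hilbert J) f f \<in> \<real>\<^sub>\<ge>\<^sub>0" for f
    unfolding inprod_fin_hilbert_self by (simp only: nonneg_Reals_of_real_iff) (simp add: sum_nonneg)
qed (auto simp: ring_distribs sum.distrib sum_distrib_left mult_ac)

section \<open>Diagonal operators and their order\<close>

definition diag_op :: "'i set \<Rightarrow> ('i \<Rightarrow> complex) \<Rightarrow> ('i \<Rightarrow> complex) \<Rightarrow> 'i \<Rightarrow> complex" where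
  "diag_op J c = (\<lambda>f\<in>carrier (fin_hilbert J). \<lambda>i. c i * f i)"

definition point_mass :: "'i \<Rightarrow> 'i \<Rightarrow> complex" where
  "point_mass j = (\<lambda>i. if i = j then 1 else 0)"

lemma point_mass_carrier [simp]: "j \<in> J \<Longrightarrow> point_mass j \<in> carrier (fin_hilbert J)"
  by (auto simp: point_mass_def)

lemma point_mass_apply [simp]: "point_mass j j = 1" "i \<noteq> j \<Longrightarrow> point_mass j i = 0"
  by (simp_all add: point_mass_def)

definition diag_algebra :: "'i set \<Rightarrow> (('i \<Rightarrow> complex) \<Rightarrow> 'i \<Rightarrow> complex) set" where
  "diag_algebra J = range (diag_op J)"

text \<open>Serves to find one member of a directed family that is nearly maximal at all points of
  \<open>J\<close> at once.\<close>

lemma directed_bound: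
  assumes "finite A" "D \<noteq> {}" "\<And>j. j \<in> A \<Longrightarrow> y j \<in> D"
    and dir: "\<And>y z. y \<in> D \<Longrightarrow> z \<in> D \<Longrightarrow> \<exists>w\<in>D. R y w \<and> R z w"
    and tr: "\<And>x y z. x \<in> D \<Longrightarrow> y \<in> D \<Longrightarrow> z \<in> D \<Longrightarrow> R x y \<Longrightarrow> R y z \<Longrightarrow> R x z"
  shows "\<exists>w\<in>D. \<forall>j\<in>A. R (y j) w"
  using assms(1,3)
proof (induction A rule: finite_induct)
  case empty
  thus ?case using assms(2) by auto
next
  case (insert j A)
  then obtain w where w: "w \<in> D" "\<forall>i\<in>A. R (y i) w" by auto
  obtain w' where w': "w' \<in> D" "R w w'" "R (y j) w'" using dir[of w "y j"] w insert.prems by auto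
  have "R (y i) w'" if "i \<in> A" for i using tr[of "y i" w w'] that w w' insert.prems by auto
  with w' show ?case by (intro bexI[of _ w']) auto
qed

locale finite_diagonal =
  fixes J :: "'i set"
  assumes J: "finite J"
begin

abbreviation "HJ \<equiv> fin_hilbert J"

sublocale O: hilbert_operators HJ
  by unfold_locales (rule complex_hilbert_space_fin_hilbert[OF J])

lemma diag_op_apply [simp]: "f \<in> carrier HJ \<Longrightarrow> diag_op J c f = (\<lambda>i. c i * f i)"
  by (simp add: diag_op_def)

lemma diag_op_point_mass [simp]: "j \<in> J \<Longrightarrow> diag_op J c (point_mass j) i = c i * point_mass j i"
  by (simp only: diag_op_apply[OF point_mass_carrier])

lemma diag_op_bounded [simp]: "diag_op J c \<in> bounded_operators HJ"
  unfolding diag_op_def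
\<comment> \<open>The sum of the moduli dominates each of them and, unlike the maximum, makes sense
  for empty \<open>J\<close>.\<close>
proof (rule O.bopI[where K = "\<Sum>j\<in>J. norm (c j)"])
  fix f :: "'i \<Rightarrow> complex"
  have "(\<Sum>j\<in>J. (norm (c j * f j))\<^sup>2) \<le> (\<Sum>j\<in>J. (\<Sum>j\<in>J. norm (c j))\<^sup>2 * (norm (f j))\<^sup>2)"
    unfolding norm_mult power_mult_distrib using J
    by (intro sum_mono mult_right_mono power_mono member_le_sum) auto
  hence "sqrt (\<Sum>j\<in>J. (norm (c j * f j))\<^sup>2) \<le> sqrt ((\<Sum>j\<in>J. norm (c j))\<^sup>2 * (\<Sum>j\<in>J. (norm (f j))\<^sup>2))"
    by (simp add: sum_distrib_left)
  also have "\<dots> = (\<Sum>j\<in>J. norm (c j)) * sqrt (\<Sum>j\<in>J. (norm (f j))\<^sup>2)"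
    by (simp add: real_sqrt_mult sum_nonneg)
  finally show "hnorm HJ (\<lambda>i. c i * f i) \<le> (\<Sum>j\<in>J. norm (c j)) * hnorm HJ f"
    unfolding hnorm_fin_hilbert .
qed (auto simp: ring_distribs mult_ac)

lemma diag_op_cong: "(\<And>j. j \<in> J \<Longrightarrow> b j = c j) \<Longrightarrow> diag_op J b = diag_op J c"
  by (rule O.bop_eqI) (auto simp: fun_eq_iff)

lemma diag_op_ops:
  "diag_op J b \<otimes>\<^bsub>B HJ\<^esub> diag_op J c = diag_op J (\<lambda>j. b j * c j)"
  "diag_op J b \<oplus>\<^bsub>B HJ\<^esub> diag_op J c = diag_op J (\<lambda>j. b j + c j)"
  "k \<odot>\<^bsub>B HJ\<^esub> diag_op J c = diag_op J (\<lambda>j. k * c j)"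
  "\<one>\<^bsub>B HJ\<^esub> = diag_op J (\<lambda>_. 1)"
  "\<zero>\<^bsub>B HJ\<^esub> = diag_op J (\<lambda>_. 0)"
  by (rule O.bop_eqI; simp add: fun_eq_iff algebra_simps)+

lemma is_adjoint_diag_op: "is_adjoint HJ (diag_op J c) (diag_op J (\<lambda>j. cnj (c j)))"
  by (auto simp: is_adjoint_def mult_ac)

lemma op_star_diag_op: "op_star HJ (diag_op J c) = diag_op J (\<lambda>j. cnj (c j))"
  by (rule O.op_star_eq[OF is_adjoint_diag_op]) simp

text \<open>The diagonal algebra is maximal abelian: commuting with the projections onto the basis
  vectors forces an operator to be diagonal. Being its own commutant, it is also its own double
  commutant.\<close>

lemma commutant_diag_algebra: "commutant HJ (diag_algebra J) = diag_algebra J"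
proof
  show "diag_algebra J \<subseteq> commutant HJ (diag_algebra J)"
    by (auto simp: commutant_def diag_algebra_def diag_op_ops mult.commute)
  show "commutant HJ (diag_algebra J) \<subseteq> diag_algebra J"
  proof
    fix x assume x: "x \<in> commutant HJ (diag_algebra J)"
    hence xb: "x \<in> bounded_operators HJ"
      and xc: "x \<otimes>\<^bsub>B HJ\<^esub> diag_op J c = diag_op J c \<otimes>\<^bsub>B HJ\<^esub> x" for c
      by (auto simp: commutant_def diag_algebra_def)
    have "x = diag_op J (\<lambda>j. x (point_mass j) j)"
    proof (rule O.bop_eqI[OF xb diag_op_bounded])
      fix f assume f: "f \<in> carrier HJ"
      have "x f j = x (point_mass j) j * f j" for j
      proof (cases "j \<in> J")
        case True
        \<comment> \<open>The diagonal operator with symbol \<open>point_mass j\<close> projects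
          onto the basis vector at \<open>j\<close>; commuting with it determines coordinate
          \<open>j\<close> of \<open>x f\<close>.\<close>
        have "(\<lambda>i. point_mass j i * f i) = f j \<odot>\<^bsub>HJ\<^esub> point_mass j"
          by (auto simp: point_mass_def)
        hence "x (diag_op J (point_mass j) f) = f j \<odot>\<^bsub>HJ\<^esub> x (point_mass j)"
          using f True by (simp add: O.bop_smult[OF xb, symmetric] del: fin_hilbert_simps)
        moreover have "x (diag_op J (point_mass j) f) = diag_op J (point_mass j) (x f)"
          using fun_cong[OF xc[of "point_mass j"], of f] f by simp
        moreover have "x f \<in> carrier HJ" by (rule O.bop_closed[OF xb f])
        ultimately have "(\<lambda>i. point_mass j i * x f i) = (\<lambda>i. f j * x (point_mass j) i)"
          by simp
        from fun_cong[OF this, of j] show ?thesis by (simp add: mult.commute)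
      next
        case False
        thus ?thesis using f O.bop_closed[OF xb f] by simp
      qed
      thus "x f = diag_op J (\<lambda>j. x (point_mass j) j) f" using f by (simp add: fun_eq_iff)
    qed
    thus "x \<in> diag_algebra J" by (simp add: diag_algebra_def)
  qed
qed

lemma abelian_diag_algebra: "abelian_von_neumann_algebra HJ (diag_algebra J)"
  unfolding abelian_von_neumann_algebra_def von_neumann_algebra_def commutant_diag_algebra
  using complex_hilbert_space_fin_hilbert[OF J] is_adjoint_diag_op
  by (auto simp: diag_algebra_def diag_op_ops mult.commute)

sublocale V: abelian_vn HJ "diag_algebra J"
  by unfold_locales (rule abelian_diag_algebra)

text \<open>Basis vectors test the single coefficients; conversely the form at f is the sum of the
  differences weighted by |f j|^2.\<close>

lemma op_le_diag_op: "op_le HJ (diag_op J b) (diag_op J c) \<longleftrightarrow> (\<forall>j\<in>J. c j - b j \<in> \<real>\<^sub>\<ge>\<^sub>0)"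
proof
  assume le: "op_le HJ (diag_op J b) (diag_op J c)"
  show "\<forall>j\<in>J. c j - b j \<in> \<real>\<^sub>\<ge>\<^sub>0"
  proof
    fix j assume j: "j \<in> J"
    have "inprod HJ (diag_op J c (point_mass j)) (point_mass j) -
        inprod HJ (diag_op J b (point_mass j)) (point_mass j) \<in> \<real>\<^sub>\<ge>\<^sub>0"
      using le j point_mass_carrier[OF j] unfolding op_le_def by blast
    moreover have "(\<Sum>i\<in>J. k i * point_mass j i * cnj (point_mass j i)) = k j" for k
      using J j by (simp add: point_mass_def if_distrib[of "\<lambda>z. _ * z"] if_distrib[of cnj] cong: if_cong)
    ultimately show "c j - b j \<in> \<real>\<^sub>\<ge>\<^sub>0" using j by simp
  qed
next
  assume nn: "\<forall>j\<in>J. c j - b j \<in> \<real>\<^sub>\<ge>\<^sub>0"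
  show "op_le HJ (diag_op J b) (diag_op J c)"
    unfolding op_le_def
  proof
    fix f assume f: "f \<in> carrier HJ"
    have "inprod HJ (diag_op J c f) f - inprod HJ (diag_op J b f) f =
      (\<Sum>j\<in>J. (c j - b j) * of_real ((norm (f j))\<^sup>2))"
      using f unfolding complex_norm_square by (simp add: sum_subtractf[symmetric] algebra_simps)
    also have "\<dots> \<in> \<real>\<^sub>\<ge>\<^sub>0"
    proof -
      have "(\<Sum>j\<in>J'. (c j - b j) * of_real ((norm (f j))\<^sup>2)) \<in> \<real>\<^sub>\<ge>\<^sub>0" if "J' \<subseteq> J" for J'
        using finite_subset[OF that J] that
        by (induction J' rule: finite_induct)
          (use nn in \<open>auto intro!: nonneg_Reals_add_I nonneg_Reals_mult_I simp del: of_real_power\<close>)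
      thus ?thesis by blast
    qed
    finally show "inprod HJ (diag_op J c f) f - inprod HJ (diag_op J b f) f \<in> \<real>\<^sub>\<ge>\<^sub>0" .
  qed
qed

section \<open>The state given by a probability vector\<close>

text \<open>Integration against the weights \<open>l\<close>. Diagonal entries are read off
  \<open>x\<close> itself, so no symbol has to be chosen.\<close>

definition weighted_trace :: "('i \<Rightarrow> real) \<Rightarrow> (('i \<Rightarrow> complex) \<Rightarrow> 'i \<Rightarrow> complex) \<Rightarrow> complex" where
  "weighted_trace l x = (\<Sum>j\<in>J. of_real (l j) * x (point_mass j) j)"

lemma weighted_trace_diag_op: "weighted_trace l (diag_op J c) = (\<Sum>j\<in>J. of_real (l j) * c j)"
  unfolding weighted_trace_def by (intro sum.cong refl) simp

text \<open>On a finite set the least upper bound of a directed family lies below its pointwise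
  supremum, and a single member approximates that supremum uniformly.\<close>

lemma normal_weighted_trace:
  assumes l: "\<And>j. j \<in> J \<Longrightarrow> l j > 0" "sum l J = 1"
  shows "normal_on HJ (diag_algebra J) (weighted_trace l)"
  unfolding normal_on_def
proof (intro allI impI)
  fix D x
  assume H: "D \<subseteq> diag_algebra J \<and> D \<noteq> {} \<and> (\<forall>y\<in>D. op_le HJ \<zero>\<^bsub>B HJ\<^esub> y) \<and>
    (\<forall>y\<in>D. \<forall>z\<in>D. \<exists>w\<in>D. op_le HJ y w \<and> op_le HJ z w) \<and> x \<in> diag_algebra J \<and>
    (\<forall>y\<in>D. op_le HJ y x) \<and> (\<forall>z\<in>diag_algebra J. (\<forall>y\<in>D. op_le HJ y z) \<longrightarrow> op_le HJ x z)"
  define C where "C = {c. diag_op J c \<in> D}"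
  have DC: "D = diag_op J ` C" using H unfolding C_def diag_algebra_def by auto
  have C0: "C \<noteq> {}" using H DC by auto
  obtain b where x: "x = diag_op J b" using H unfolding diag_algebra_def by auto
  have pos: "c j \<in> \<real>\<^sub>\<ge>\<^sub>0" if "c \<in> C" "j \<in> J" for c j
    using H that unfolding DC diag_op_ops by (auto simp: op_le_diag_op)
  have below: "b j - c j \<in> \<real>\<^sub>\<ge>\<^sub>0" if "c \<in> C" "j \<in> J" for c j
    using H that unfolding DC x by (auto simp: op_le_diag_op)
  have dir: "\<exists>c''\<in>C. (\<forall>j\<in>J. Re (c j) \<le> Re (c'' j)) \<and> (\<forall>j\<in>J. Re (c' j) \<le> Re (c'' j))" if "c \<in> C" "c' \<in> C" for c c'
  proof -
    have "\<exists>w\<in>D. op_le HJ (diag_op J c) w \<and> op_le HJ (diag_op J c') w" using H that DC by blast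
    then obtain c'' where "c'' \<in> C" "op_le HJ (diag_op J c) (diag_op J c'')" "op_le HJ (diag_op J c') (diag_op J c'')"
      unfolding DC by blast
    thus ?thesis by (intro bexI[of _ c'']) (auto simp: op_le_diag_op complex_nonneg_Reals_iff)
  qed
  have tr: "weighted_trace l (diag_op J c) = (\<Sum>j\<in>J. of_real (l j) * c j)" for c
    by (rule weighted_trace_diag_op)
  have bdd: "bdd_above ((\<lambda>c. Re (c j)) ` C)" if "j \<in> J" for j
    using below[OF _ that] by (intro bdd_aboveI[of _ "Re (b j)"]) (auto simp: complex_nonneg_Reals_iff)
  \<comment> \<open>The pointwise supremum is an upper bound within the algebra and hence dominates
    the least upper bound \<open>x\<close>.\<close>
  define s where "s j = (SUP c\<in>C. Re (c j))" for j
  have "op_le HJ (diag_op J c) (diag_op J (\<lambda>j. of_real (s j)))" if c: "c \<in> C" for c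
    unfolding op_le_diag_op
  proof
    fix j assume j: "j \<in> J"
    have "Re (c j) \<le> s j" unfolding s_def by (rule cSUP_upper[OF c bdd[OF j]])
    thus "of_real (s j) - c j \<in> \<real>\<^sub>\<ge>\<^sub>0" using pos[OF c j] by (simp add: complex_nonneg_Reals_iff)
  qed
  hence "op_le HJ x (diag_op J (\<lambda>j. of_real (s j)))" using H unfolding DC diag_algebra_def by blast
  hence bs: "Re (b j) \<le> s j" if "j \<in> J" for j
    using that unfolding x op_le_diag_op by (auto simp: complex_nonneg_Reals_iff)
  have Retr: "Re (weighted_trace l (diag_op J c)) = (\<Sum>j\<in>J. l j * Re (c j))" for c
    unfolding tr by simp
  have up: "Re (weighted_trace l y) \<le> Re (weighted_trace l x)" if y: "y \<in> D" for y
  proof -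
    obtain c where c: "c \<in> C" "y = diag_op J c" using y DC by auto
    show ?thesis unfolding c(2) x Retr
      using below[OF c(1)] l(1) by (intro sum_mono mult_left_mono) (auto simp: complex_nonneg_Reals_iff less_imp_le)
  qed
  have bddD: "bdd_above ((\<lambda>y. Re (weighted_trace l y)) ` D)"
    using up by (intro bdd_aboveI[of _ "Re (weighted_trace l x)"]) auto
  show "Re (weighted_trace l x) = (SUP y\<in>D. Re (weighted_trace l y))"
  proof (rule antisym)
    show "(SUP y\<in>D. Re (weighted_trace l y)) \<le> Re (weighted_trace l x)"
      using H up by (intro cSUP_least) auto
    show "Re (weighted_trace l x) \<le> (SUP y\<in>D. Re (weighted_trace l y))"
    proof (rule field_le_epsilon)
      fix e :: real assume e: "e > 0"
      \<comment> \<open>A member within \<open>e\<close> of the supremum is chosen at each point,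
        and directedness merges these finitely many into one \<open>w\<close>. As the weights sum to
        1, the total error is at most \<open>e\<close>.\<close>
      have "\<exists>c\<in>C. s j - e < Re (c j)" if "j \<in> J" for j
        using less_cSUP_iff[OF C0 bdd[OF that], of "s j - e"] e by (simp add: s_def)
      then obtain y where y: "\<And>j. j \<in> J \<Longrightarrow> y j \<in> C" "\<And>j. j \<in> J \<Longrightarrow> s j - e < Re (y j j)" by metis
      have "\<exists>w\<in>C. \<forall>j\<in>J. \<forall>i\<in>J. Re (y j i) \<le> Re (w i)"
      proof (rule directed_bound[OF J C0, where R = "\<lambda>c c'. \<forall>i\<in>J. Re (c i) \<le> Re (c' i)"])
        show "\<forall>i\<in>J. Re (c i) \<le> Re (c'' i)"
          if "\<forall>i\<in>J. Re (c i) \<le> Re (c' i)" "\<forall>i\<in>J. Re (c' i) \<le> Re (c'' i)" for c c' c'' :: "'i \<Rightarrow> complex"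
          using that order_trans by blast
      qed (use y(1) dir in blast)+
      then obtain w where w: "w \<in> C" "\<forall>j\<in>J. \<forall>i\<in>J. Re (y j i) \<le> Re (w i)" by (elim bexE)
      have "Re (weighted_trace l x) \<le> (\<Sum>j\<in>J. l j * (Re (w j) + e))"
        unfolding x Retr
      proof (intro sum_mono mult_left_mono)
        fix j assume j: "j \<in> J"
        have "Re (y j j) \<le> Re (w j)" using w(2) j by blast
        thus "Re (b j) \<le> Re (w j) + e" using bs[OF j] y(2)[OF j] by linarith
      qed (use l in \<open>auto simp: less_imp_le\<close>)
      also have "\<dots> = Re (weighted_trace l (diag_op J w)) + e"
        unfolding Retr using l(2) by (simp add: ring_distribs sum.distrib sum_distrib_right[symmetric])
      also have "Re (weighted_trace l (diag_op J w)) \<le> (SUP y\<in>D. Re (weighted_trace l y))"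
        using w(1) DC by (intro cSUP_upper[OF _ bddD]) auto
      finally show "Re (weighted_trace l x) \<le> (SUP y\<in>D. Re (weighted_trace l y)) + e" by simp
    qed
  qed
qed

text \<open>Faithfulness comes from the positive weights: the value at a square is the weighted sum
  of |c j|^2.\<close>

lemma normal_faithful_weighted_trace:
  assumes l: "\<And>j. j \<in> J \<Longrightarrow> l j > 0" "sum l J = 1"
  shows "normal_faithful_tracial_state HJ (diag_algebra J) (weighted_trace l)"
  unfolding normal_faithful_tracial_state_def
proof (intro conjI normal_weighted_trace[OF l] ballI impI)
  show "state_on HJ (diag_algebra J) (weighted_trace l)"
    unfolding state_on_def
  proof (intro conjI ballI allI impI)
    fix x assume x: "x \<in> diag_algebra J" "op_le HJ \<zero>\<^bsub>B HJ\<^esub> x"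
    then obtain c where c: "x = diag_op J c" by (auto simp: diag_algebra_def)
    have "\<forall>j\<in>J. c j \<in> \<real>\<^sub>\<ge>\<^sub>0" using x(2) unfolding c diag_op_ops op_le_diag_op by simp
    hence "\<forall>j\<in>J. 0 \<le> Re (c j) \<and> Im (c j) = 0" by (simp add: complex_nonneg_Reals_iff)
    thus "weighted_trace l x \<in> \<real>\<^sub>\<ge>\<^sub>0"
      using l unfolding c weighted_trace_diag_op complex_nonneg_Reals_iff
      by (auto intro!: sum_nonneg mult_nonneg_nonneg simp: less_imp_le)
  next
    show "weighted_trace l \<one>\<^bsub>B HJ\<^esub> = 1"
      unfolding diag_op_ops weighted_trace_diag_op using l(2) by (simp add: of_real_sum[symmetric] del: of_real_sum)
  qed (auto simp: diag_algebra_def diag_op_ops weighted_trace_diag_op ring_distribs sum.distrib sum_distrib_left mult_ac)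
next
  fix x assume x: "x \<in> diag_algebra J" "weighted_trace l (op_star HJ x \<otimes>\<^bsub>B HJ\<^esub> x) = 0"
  then obtain c where c: "x = diag_op J c" by (auto simp: diag_algebra_def)
  have "weighted_trace l (op_star HJ x \<otimes>\<^bsub>B HJ\<^esub> x) = of_real (\<Sum>j\<in>J. l j * (norm (c j))\<^sup>2)"
    unfolding c op_star_diag_op diag_op_ops weighted_trace_diag_op of_real_sum of_real_mult complex_norm_square
    by (simp add: mult.commute)
  hence "complex_of_real (\<Sum>j\<in>J. l j * (norm (c j))\<^sup>2) = 0" by (rule trans[OF sym x(2)])
  hence "(\<Sum>j\<in>J. l j * (norm (c j))\<^sup>2) = 0" by (simp only: of_real_eq_0_iff)
  hence "\<forall>j\<in>J. l j * (norm (c j))\<^sup>2 = 0"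
    using J l by (subst (asm) sum_nonneg_eq_0_iff) (simp_all add: less_imp_le)
  hence "\<forall>j\<in>J. c j = 0" using l(1) by force
  thus "x = \<zero>\<^bsub>B HJ\<^esub>" unfolding c diag_op_ops by (intro diag_op_cong) auto
next
  fix x y assume "x \<in> diag_algebra J" "y \<in> diag_algebra J"
  thus "weighted_trace l (x \<otimes>\<^bsub>B HJ\<^esub> y) = weighted_trace l (y \<otimes>\<^bsub>B HJ\<^esub> x)"
    by (auto simp: diag_algebra_def diag_op_ops mult.commute)
qed

section \<open>Diagonal families of unitary matrices\<close>

lemma finsum_diag_op: "finite I \<Longrightarrow> finsum V.NA (\<lambda>i. diag_op J (f i)) I = diag_op J (\<lambda>j. \<Sum>i\<in>I. f i j)"
proof (induction I rule: finite_induct)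
  case empty
  show ?case by (simp add: diag_op_ops)
next
  case (insert i I)
  have "finsum V.NA (\<lambda>i. diag_op J (f i)) (insert i I) = diag_op J (f i) \<oplus>\<^bsub>V.NA\<^esub> finsum V.NA (\<lambda>i. diag_op J (f i)) I"
    using insert.hyps by (intro V.A.finsum_insert) (auto simp: diag_algebra_def)
  thus ?case using insert by (simp add: diag_op_ops)
qed

text \<open>Matrices over the diagonal algebra are families of scalar matrices indexed by
  \<open>J\<close> and multiply pointwise, so both unitarity relations hold pointwise.\<close>

lemma diag_matrix_unitary:
  fixes g :: "'i \<Rightarrow> complex^'n^'n"
  assumes g: "\<And>j. j \<in> J \<Longrightarrow> mstar (g j) ** g j = mat 1"
  shows "unitary_in_tensor HJ (diag_algebra J) (\<chi> k l. diag_op J (\<lambda>j. g j $ k $ l))"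
proof -
  let ?u = "\<chi> k l. diag_op J (\<lambda>j. g j $ k $ l)"
  have st: "tensor_star HJ ?u = (\<chi> k l. diag_op J (\<lambda>j. mstar (g j) $ k $ l))"
    by (simp add: tensor_star_def op_star_diag_op vec_eq_iff)
  have cl: "(\<chi> k l. diag_op J (h k l)) \<in> carrier (matrix_tensor HJ (diag_algebra J))" for h :: "'n \<Rightarrow> 'n \<Rightarrow> 'i \<Rightarrow> complex"
    unfolding V.carrier_matrix_tensor by (simp add: diag_algebra_def)
  have one: "(\<chi> k l. diag_op J (\<lambda>j. h j $ k $ l)) \<otimes>\<^bsub>matrix_tensor HJ (diag_algebra J)\<^esub> (\<chi> k l. diag_op J (\<lambda>j. h' j $ k $ l)) =
      \<one>\<^bsub>matrix_tensor HJ (diag_algebra J)\<^esub>"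
    if "\<And>j. j \<in> J \<Longrightarrow> h j ** h' j = mat 1" for h h' :: "'i \<Rightarrow> complex^'n^'n"
  proof -
    have "((\<chi> k l. diag_op J (\<lambda>j. h j $ k $ l)) \<otimes>\<^bsub>matrix_tensor HJ (diag_algebra J)\<^esub> (\<chi> k l. diag_op J (\<lambda>j. h' j $ k $ l))) $ k $ l =
      \<one>\<^bsub>matrix_tensor HJ (diag_algebra J)\<^esub> $ k $ l" for k l
    proof -
      have "((\<chi> k l. diag_op J (\<lambda>j. h j $ k $ l)) \<otimes>\<^bsub>matrix_tensor HJ (diag_algebra J)\<^esub> (\<chi> k l. diag_op J (\<lambda>j. h' j $ k $ l))) $ k $ l =
        finsum V.NA (\<lambda>m. diag_op J (\<lambda>j. h j $ k $ m * h' j $ m $ l)) UNIV"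
        unfolding V.mult_matrix_tensor[OF cl cl] by (simp add: diag_op_ops)
      also have "\<dots> = diag_op J (\<lambda>j. (h j ** h' j) $ k $ l)"
        by (simp add: finsum_diag_op matrix_matrix_mult_def)
      also have "\<dots> = diag_op J (\<lambda>j. if k = l then 1 else 0)"
        using that by (intro diag_op_cong) (simp add: mat_def)
      also have "\<dots> = \<one>\<^bsub>matrix_tensor HJ (diag_algebra J)\<^esub> $ k $ l"
        by (simp add: matrix_tensor_def diag_op_ops)
      finally show ?thesis .
    qed
    thus ?thesis by (simp only: vec_eq_iff) simp
  qed
  show ?thesis
    unfolding unitary_in_tensor_def st
    by (intro conjI cl one g unitary_right)
qed

end

section \<open>The implication from (1) to (3)\<close>

text \<open>The points of \<open>J\<close> with weights \<open>l\<close> form a finite probability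
  space on which \<open>g\<close> is a random unitary matrix. The \<open>v i\<close> are its
  coefficients in the \<open>a i\<close>, viewed as functions on that space.\<close>

lemma convex_hull_imp_orthonormal:
  fixes T :: "(complex^'n^'n) \<Rightarrow>\<^sub>L (complex^'n^'n)" and a :: "nat \<Rightarrow> complex^'n^'n"
  assumes T: "T \<in> convex hull Aut_matrices"
    and kraus: "\<And>x. T x = (\<Sum>i=1..d. mstar (a i) ** x ** a i)"
    and indep: "\<And>c. (\<Sum>i=1..d. mscale (c i) (a i)) = 0 \<Longrightarrow> \<forall>i\<in>{1..d}. c i = 0"
  shows "orthonormal_abelian_unitary TYPE('i::infinite) d a"
proof -
  obtain S :: "((complex^'n^'n) \<Rightarrow>\<^sub>L (complex^'n^'n)) set" and l0 and g0 :: "_ \<Rightarrow> complex^'n^'n"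
    where S: "finite S" "\<And>s. s \<in> S \<Longrightarrow> l0 s > 0" "sum l0 S = 1" "\<And>s. s \<in> S \<Longrightarrow> mstar (g0 s) ** g0 s = mat 1"
    and TS: "\<And>x. T x = (\<Sum>s\<in>S. l0 s *\<^sub>R (mstar (g0 s) ** x ** g0 s))"
    by (rule convex_hull_Aut_positive[OF T]) (rule that)
  \<comment> \<open>Because \<open>'i\<close> is infinite it contains a copy of the finite index
    set; weights and unitaries are carried over along a bijection.\<close>
  obtain J :: "'i set" where J: "finite J" "card J = card S"
    using infinite_arbitrarily_large[OF infinite_UNIV] by metis
  obtain \<beta> where \<beta>: "bij_betw \<beta> J S"
    using finite_same_card_bij[OF J(1) S(1) J(2)] by blast
  define l where "l j = l0 (\<beta> j)" for j
  define g where "g j = g0 (\<beta> j)" for j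
  have \<beta>J: "\<beta> j \<in> S" if "j \<in> J" for j using \<beta> that by (auto simp: bij_betw_def)
  have l: "l j > 0" if "j \<in> J" for j using S \<beta>J[OF that] by (simp add: l_def)
  have g: "mstar (g j) ** g j = mat 1" if "j \<in> J" for j using S \<beta>J[OF that] by (simp add: g_def)
  have l1: "sum l J = 1" unfolding l_def using S(3) sum.reindex_bij_betw[OF \<beta>, of l0] by simp
  have TJ: "(\<Sum>j\<in>J. l j *\<^sub>R (mstar (g j) ** x ** g j)) = (\<Sum>i=1..d. mstar (a i) ** x ** a i)" for x
    unfolding l_def g_def kraus[symmetric] TS
    using sum.reindex_bij_betw[OF \<beta>, of "\<lambda>s. l0 s *\<^sub>R (mstar (g0 s) ** x ** g0 s)"] by simp
  obtain c where gc: "\<And>j. j \<in> J \<Longrightarrow> g j = (\<Sum>i=1..d. mscale (c j i) (a i))"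
    and orth: "\<And>i k. i \<in> {1..d} \<Longrightarrow> k \<in> {1..d} \<Longrightarrow> (\<Sum>j\<in>J. of_real (l j) * (cnj (c j i) * c j k)) = (if i = k then 1 else 0)"
    using kraus_unitary_coefficients[OF J(1) l finite_atLeastAtMost indep TJ] by blast
  interpret finite_diagonal J by unfold_locales (rule J(1))
  \<comment> \<open>With these coefficients the fibre of \<open>u\<close> over a point
    \<open>j\<close> is the expansion of \<open>g j\<close> in the \<open>a i\<close>.\<close>
  define v where "v i = diag_op J (\<lambda>j. c j i)" for i
  have vN: "v i \<in> diag_algebra J" for i by (simp add: v_def diag_algebra_def)
  define u where "u = (\<Oplus>\<^bsub>matrix_tensor HJ (diag_algebra J)\<^esub>i\<in>{1..d}. elem_tensor HJ (a i) (v i))"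
  have "u $ k $ m = diag_op J (\<lambda>j. g j $ k $ m)" for k m
  proof -
    have "u $ k $ m = finsum V.NA (\<lambda>i. elem_tensor HJ (a i) (v i) $ k $ m) {1..d}"
      unfolding u_def
      by (intro V.finsum_matrix_tensor Pi_I)
        (simp_all only: V.carrier_matrix_tensor elem_tensor_def vec_lambda_beta V.N_smult vN finite_atLeastAtMost simp_thms)
    also have "\<dots> = finsum V.NA (\<lambda>i. diag_op J (\<lambda>j. a i $ k $ m * c j i)) {1..d}"
      by (simp add: elem_tensor_def v_def diag_op_ops)
    also have "\<dots> = diag_op J (\<lambda>j. \<Sum>i=1..d. a i $ k $ m * c j i)"
      by (rule finsum_diag_op) simp
    also have "\<dots> = diag_op J (\<lambda>j. g j $ k $ m)"
      by (intro diag_op_cong) (simp add: gc sum_component mult.commute)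
    finally show ?thesis .
  qed
  hence "u = (\<chi> k m. diag_op J (\<lambda>j. g j $ k $ m))" by (simp add: vec_eq_iff)
  hence uni: "unitary_in_tensor HJ (diag_algebra J) u" using diag_matrix_unitary[of g] g by simp
  have vo: "weighted_trace l (op_star HJ (v i) \<otimes>\<^bsub>B HJ\<^esub> v k) = (if i = k then 1 else 0)"
    if "i \<in> {1..d}" "k \<in> {1..d}" for i k
    unfolding v_def op_star_diag_op diag_op_ops weighted_trace_diag_op using orth[OF that] by simp
  show ?thesis
    unfolding orthonormal_abelian_unitary_def
    using abelian_diag_algebra normal_faithful_weighted_trace[of l] l l1 vN uni[unfolded u_def] vo
    by (intro exI[of _ HJ] exI[of _ "diag_algebra J"] exI[of _ "weighted_trace l"] exI[of _ v] conjI ballI) auto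
qed

theorem proposition2p4:
  fixes T :: "(complex^'n^'n) \<Rightarrow>\<^sub>L (complex^'n^'n)"
    and a :: "nat \<Rightarrow> complex^'n^'n"
    and d :: nat
  assumes "markov_map T"
    and "\<And>x. T x = (\<Sum>i=1..d. mstar (a i) ** x ** a i)"
    and "\<And>c :: nat \<Rightarrow> complex.
           (\<Sum>i=1..d. mscale (c i) (a i)) = 0 \<Longrightarrow> \<forall>i\<in>{1..d}. c i = 0"
    and "(\<Sum>i=1..d. mstar (a i) ** a i) = mat 1"
    and "(\<Sum>i=1..d. a i ** mstar (a i)) = mat 1"
  shows "(T \<in> convex hull Aut_matrices \<longleftrightarrow> abelian_dilation TYPE('i::infinite) T) \<and>
    (abelian_dilation TYPE('i) T \<longleftrightarrow> orthonormal_abelian_unitary TYPE('i) d a)"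
  using convex_hull_imp_orthonormal[OF _ assms(2,3)] orthonormal_imp_dilation[OF assms(2)]
    abelian_dilation_imp_convex_hull by blast

end
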